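(* Let $r\ge 1$ be an integer, let $\alpha\in\mathbb{C}$, and let $M$ be a simple module over the Lie algebra $\mathfrak{a}_r$ such that the action of $\bar d_r$ on $M$ is injective. Then the Virasoro module $\mathcal{N}(M,\alpha)$ is not isomorphic to $V(\dot c,h)\otimes V'_{a,b}$ for any $a,b,\dot c,h\in\mathbb{C}$, and is not isomorphic to $E_h(b,\gamma,p)$ for any $b,h,\gamma,p\in\mathbb{C}$.
   Context: The Virasoro algebra $\mathfrak{V}$ is the complex Lie algebra with basis $\{c,d_i: i\in\mathbb{Z}\}$ and bracket $[d_i,d_j]=(j-i)d_{i+j}+\delta_{i,-j}\frac{i^3-i}{12}c$, $[d_i,c]=0$ for $i,j\in\mathbb{Z}$. Let $\mathfrak{V}_+$ be the Lie subalgebra of $\mathfrak{V}$ spanned by all $d_i$ with $i\geq 0$. For an integer $r\ge 0$ let $\mathfrak{V}_+^{(r)}$ be the Lie subalgebra generated by all $d_i$ with $i>r$ (it is an ideal of $\mathfrak{V}_+$), let $\mathfrak{a}_r=\mathfrak{V}_+/\mathfrak{V}_+^{(r)}$, and let $\bar d_i$ be the image of $d_i$ in $\mathfrak{a}_r$. For an $\mathfrak{a}_r$-module $M$ and $\alpha\in\mathbb{C}$, $\mathcal{N}(M,\alpha)$ is the $\mathfrak{V}$-module with underlying vector space $M\otimes\mathbb{C}[t,t^{-1}]$ and action $$d_m (v\otimes t^n)=\Big(\Big(\alpha+n+\sum_{i=0}^r\frac{m^{i+1}}{(i+1)!}\bar d_i\Big)v\Big)\otimes t^{n+m},\qquad c(v\otimes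 t^n)=0\qquad (m,n\in\mathbb{Z},\ v\in M).$$ Highest weight modules: for $\dot c,h\in\mathbb{C}$ let $U=U(\mathfrak{V})$ be the universal enveloping algebra and let $I(\dot c,h)$ be the left ideal of $U$ generated by $\{d_i: i>0\}\cup\{d_0-h\cdot 1,\ c-\dot c\cdot 1\}$. The Verma module is $\bar V(\dot c,h)=U/I(\dot c,h)$, and $V(\dot c,h)=\bar V(\dot c,h)/J$, where $J$ is the maximal proper submodule of $\bar V(\dot c,h)$. Intermediate series modules: for $a,b\in\mathbb{C}$, $V_{a,b}$ is the $\mathfrak{V}$-module with basis $\{v_{a+i}: i\in\mathbb{Z}\}$, with $c$ acting as $0$ and $d_iv_{a+k}=(a+k+ib)v_{a+k+i}$ for $i,k\in\mathbb{Z}$. One has $V_{a,b}\cong V_{a+1,b}$. $V_{a,b}$ is irreducible unless $a\in\mathbb{Z}$ and $b\in\{0,1\}$. Set $V'_{a,b}=V_{a,b}$ when $V_{a,b}$ is irreducible; let $V'_{0,0}=V_{0,0}/\mathbb{C}v_0$ (which is isomorphic to the submodule $\bigoplus_{i\ne 0}\mathbb{C}v_i$ of $V_{0,1}$), and for $a\in\mathbb{Z}$, $b\in\{0,1\}$ let $V'_{a,b}$ denote $V'_{0,0}$. Modules $E_h(b,\gamma,p)$: for $h,b,\gamma,p\in\mathbb{C}$, $E_h(b,\gamma,p)$ is the $\mathfrak{V}$-module with basis $\{T_i^k: i\in\mathbb{Z},\ k\in\mathbb{Z},\ k\ge 0\}$ and action, for $n\in\mathbb{Z}$, $$d_nT_i^k=(1-e^{nh})T_{i+n}^{k+1}+\big[b+i+n\big(p+\gamma-(\gamma+k)e^{nh}\big)\big]T_{i+n}^k-e^{nh}\sum_{j=0}^{k-1}n^{k-j+1}\Big[\binom{k}{j-1}+\gamma\binom{k}{j}\Big]T_{i+n}^j,$$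 $$c\,E_h(b,\gamma,p)=0,$$ where $\binom{k}{-1}=0$. (Upper indices on $T$ are labels, not powers.) *)

theory Defs
  imports Complex_Main "HOL-Library.Poly_Mapping" "HOL-Algebra.Module" "HOL-Algebra.QuotRing"
begin

definition complex_ring :: "complex ring" where
  "complex_ring = \<lparr>carrier = UNIV, mult = (*), one = 1, zero = 0, add = (+)\<rparr>"

definition generated_submodule :: "(complex, 'v, 'x) module_scheme \<Rightarrow> 'v set \<Rightarrow> 'v set" where
  "generated_submodule V S = \<Inter>{H. submodule H complex_ring V \<and> S \<subseteq> H}"

text \<open>The fields \<open>mult\<close> and \<open>one\<close> of the record type \<open>module\<close> play no role
  for vector spaces and are left unspecified.\<close>

definition quotient_space :: "(complex, 'v, 'x) module_scheme \<Rightarrow> 'v set \<Rightarrow> (complex, 'v set) module"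
  where
  "quotient_space V J = \<lparr>carrier = a_rcosets\<^bsub>V\<^esub> J, mult = undefined, one = undefined,
     zero = J, add = set_add V, smult = (\<lambda>a X. \<Union>x\<in>X. J +>\<^bsub>V\<^esub> (a \<odot>\<^bsub>V\<^esub> x))\<rparr>"

definition free_space :: "'b set \<Rightarrow> (complex, 'b \<Rightarrow>\<^sub>0 complex) module" where
  "free_space B = \<lparr>carrier = {f. Poly_Mapping.keys f \<subseteq> B}, mult = undefined, one = undefined,
     zero = 0, add = (+), smult = (\<lambda>a. Poly_Mapping.map ((*) a))\<rparr>"

definition linear_extension ::
    "(complex, 'v, 'x) module_scheme \<Rightarrow> ('b \<Rightarrow> 'v) \<Rightarrow> ('b \<Rightarrow>\<^sub>0 complex) \<Rightarrow> 'v" where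
  "linear_extension V f x = (\<Oplus>\<^bsub>V\<^esub>b \<in> Poly_Mapping.keys x. Poly_Mapping.lookup x b \<odot>\<^bsub>V\<^esub> f b)"

definition tensor_relations ::
    "(complex, 'v, 'x) module_scheme \<Rightarrow> (complex, 'w, 'y) module_scheme \<Rightarrow> ('v \<times> 'w \<Rightarrow>\<^sub>0 complex) set"
  where
  "tensor_relations V W =
     {Poly_Mapping.single (v \<oplus>\<^bsub>V\<^esub> v', w) 1 - Poly_Mapping.single (v, w) 1 - Poly_Mapping.single (v', w) 1
       | v v' w. v \<in> carrier V \<and> v' \<in> carrier V \<and> w \<in> carrier W} \<union>
     {Poly_Mapping.single (v, w \<oplus>\<^bsub>W\<^esub> w') 1 - Poly_Mapping.single (v, w) 1 - Poly_Mapping.single (v, w') 1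
       | v w w'. v \<in> carrier V \<and> w \<in> carrier W \<and> w' \<in> carrier W} \<union>
     {Poly_Mapping.single (a \<odot>\<^bsub>V\<^esub> v, w) 1 - Poly_Mapping.single (v, w) a
       | a v w. v \<in> carrier V \<and> w \<in> carrier W} \<union>
     {Poly_Mapping.single (v, a \<odot>\<^bsub>W\<^esub> w) 1 - Poly_Mapping.single (v, w) a
       | a v w. v \<in> carrier V \<and> w \<in> carrier W}"

definition tensor_kernel ::
    "(complex, 'v, 'x) module_scheme \<Rightarrow> (complex, 'w, 'y) module_scheme \<Rightarrow> ('v \<times> 'w \<Rightarrow>\<^sub>0 complex) set"
  where
  "tensor_kernel V W =
     generated_submodule (free_space (carrier V \<times> carrier W)) (tensor_relations V W)"

definition tensor_space ::
    "(complex, 'v, 'x) module_scheme \<Rightarrow> (complex, 'w, 'y) module_scheme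
      \<Rightarrow> (complex, ('v \<times> 'w \<Rightarrow>\<^sub>0 complex) set) module" where
  "tensor_space V W = quotient_space (free_space (carrier V \<times> carrier W)) (tensor_kernel V W)"

definition pure_tensor ::
    "(complex, 'v, 'x) module_scheme \<Rightarrow> (complex, 'w, 'y) module_scheme
      \<Rightarrow> 'v \<Rightarrow> 'w \<Rightarrow> ('v \<times> 'w \<Rightarrow>\<^sub>0 complex) set" where
  "pure_tensor V W v w =
     tensor_kernel V W +>\<^bsub>free_space (carrier V \<times> carrier W)\<^esub> Poly_Mapping.single (v, w) 1"

text \<open>The linear map on the tensor product induced by a bilinear map \<open>f\<close> into \<open>P\<close>. For bilinear
  \<open>f\<close> the linear extension to the free space is constant on each coset, so that the image
  below is a singleton.\<close>

definition tensor_lift :: "(complex, 'p, 'z) module_scheme \<Rightarrow> ('v \<Rightarrow> 'w \<Rightarrow> 'p)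
      \<Rightarrow> ('v \<times> 'w \<Rightarrow>\<^sub>0 complex) set \<Rightarrow> 'p" where
  "tensor_lift P f X = the_elem (linear_extension P (\<lambda>(v, w). f v w) ` X)"

record 'l lie_alg = "(complex, 'l) module" +
  lie_bracket :: "'l \<Rightarrow> 'l \<Rightarrow> 'l"

record ('l, 'v) lie_mod = "(complex, 'v) module" +
  act :: "'l \<Rightarrow> 'v \<Rightarrow> 'v"

locale lie_algebra = module complex_ring L for L :: "('l, 'x) lie_alg_scheme" (structure) +
  assumes bracket_closed:
      "\<lbrakk>x \<in> carrier L; y \<in> carrier L\<rbrakk> \<Longrightarrow> lie_bracket L x y \<in> carrier L"
    and bracket_add_left:
      "\<lbrakk>x \<in> carrier L; y \<in> carrier L; z \<in> carrier L\<rbrakk>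
        \<Longrightarrow> lie_bracket L (x \<oplus> y) z = lie_bracket L x z \<oplus> lie_bracket L y z"
    and bracket_add_right:
      "\<lbrakk>x \<in> carrier L; y \<in> carrier L; z \<in> carrier L\<rbrakk>
        \<Longrightarrow> lie_bracket L x (y \<oplus> z) = lie_bracket L x y \<oplus> lie_bracket L x z"
    and bracket_smult_left:
      "\<lbrakk>x \<in> carrier L; y \<in> carrier L\<rbrakk>
        \<Longrightarrow> lie_bracket L (a \<odot> x) y = a \<odot> lie_bracket L x y"
    and bracket_smult_right:
      "\<lbrakk>x \<in> carrier L; y \<in> carrier L\<rbrakk>
        \<Longrightarrow> lie_bracket L x (a \<odot> y) = a \<odot> lie_bracket L x y"
    and bracket_self: "x \<in> carrier L \<Longrightarrow> lie_bracket L x x = \<zero>"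
    and jacobi:
      "\<lbrakk>x \<in> carrier L; y \<in> carrier L; z \<in> carrier L\<rbrakk>
        \<Longrightarrow> lie_bracket L x (lie_bracket L y z) \<oplus> lie_bracket L y (lie_bracket L z x)
            \<oplus> lie_bracket L z (lie_bracket L x y) = \<zero>"

definition lie_subalgebra :: "'l set \<Rightarrow> ('l, 'x) lie_alg_scheme \<Rightarrow> bool" where
  "lie_subalgebra H L \<longleftrightarrow> submodule H complex_ring L \<and> (\<forall>x\<in>H. \<forall>y\<in>H. lie_bracket L x y \<in> H)"

definition generated_lie_subalgebra :: "('l, 'x) lie_alg_scheme \<Rightarrow> 'l set \<Rightarrow> 'l set" where
  "generated_lie_subalgebra L S = \<Inter>{H. lie_subalgebra H L \<and> S \<subseteq> H}"

definition quotient_lie_algebra :: "('l, 'x) lie_alg_scheme \<Rightarrow> 'l set \<Rightarrow> 'l set lie_alg" where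
  "quotient_lie_algebra L I = module.extend (quotient_space L I)
     (lie_alg.fields (\<lambda>X Y. \<Union>x\<in>X. \<Union>y\<in>Y. I +>\<^bsub>L\<^esub> lie_bracket L x y))"

locale lie_module = L?: lie_algebra L + V?: module complex_ring V
  for L :: "('l, 'x) lie_alg_scheme" and V :: "('l, 'v, 'y) lie_mod_scheme" +
  assumes act_closed: "\<lbrakk>x \<in> carrier L; v \<in> carrier V\<rbrakk> \<Longrightarrow> act V x v \<in> carrier V"
    and act_add_left:
      "\<lbrakk>x \<in> carrier L; y \<in> carrier L; v \<in> carrier V\<rbrakk>
        \<Longrightarrow> act V (x \<oplus>\<^bsub>L\<^esub> y) v = act V x v \<oplus>\<^bsub>V\<^esub> act V y v"
    and act_smult_left:
      "\<lbrakk>x \<in> carrier L; v \<in> carrier V\<rbrakk> \<Longrightarrow> act V (a \<odot>\<^bsub>L\<^esub> x) v = a \<odot>\<^bsub>V\<^esub> act V x v"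
    and act_add_right:
      "\<lbrakk>x \<in> carrier L; v \<in> carrier V; w \<in> carrier V\<rbrakk>
        \<Longrightarrow> act V x (v \<oplus>\<^bsub>V\<^esub> w) = act V x v \<oplus>\<^bsub>V\<^esub> act V x w"
    and act_smult_right:
      "\<lbrakk>x \<in> carrier L; v \<in> carrier V\<rbrakk> \<Longrightarrow> act V x (a \<odot>\<^bsub>V\<^esub> v) = a \<odot>\<^bsub>V\<^esub> act V x v"
    and act_bracket:
      "\<lbrakk>x \<in> carrier L; y \<in> carrier L; v \<in> carrier V\<rbrakk>
        \<Longrightarrow> act V (lie_bracket L x y) v = act V x (act V y v) \<ominus>\<^bsub>V\<^esub> act V y (act V x v)"

definition lie_submodule ::
    "'v set \<Rightarrow> ('l, 'x) lie_alg_scheme \<Rightarrow> ('l, 'v, 'y) lie_mod_scheme \<Rightarrow> bool" where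
  "lie_submodule H L V \<longleftrightarrow>
     submodule H complex_ring V \<and> (\<forall>x\<in>carrier L. \<forall>v\<in>H. act V x v \<in> H)"

definition simple_lie_module ::
    "('l, 'x) lie_alg_scheme \<Rightarrow> ('l, 'v, 'y) lie_mod_scheme \<Rightarrow> bool" where
  "simple_lie_module L V \<longleftrightarrow> lie_module L V \<and> carrier V \<noteq> {\<zero>\<^bsub>V\<^esub>} \<and>
     (\<forall>H. lie_submodule H L V \<longrightarrow> H = {\<zero>\<^bsub>V\<^esub>} \<or> H = carrier V)"

definition maximal_proper_lie_submodule ::
    "'v set \<Rightarrow> ('l, 'x) lie_alg_scheme \<Rightarrow> ('l, 'v, 'y) lie_mod_scheme \<Rightarrow> bool" where
  "maximal_proper_lie_submodule J L V \<longleftrightarrow> lie_submodule J L V \<and> J \<noteq> carrier V \<and>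
     (\<forall>H. lie_submodule H L V \<and> J \<subseteq> H \<and> H \<noteq> carrier V \<longrightarrow> H = J)"

definition quotient_lie_module :: "('l, 'v, 'y) lie_mod_scheme \<Rightarrow> 'v set \<Rightarrow> ('l, 'v set) lie_mod" where
  "quotient_lie_module V J = module.extend (quotient_space V J)
     (lie_mod.fields (\<lambda>x X. \<Union>v\<in>X. J +>\<^bsub>V\<^esub> act V x v))"

definition tensor_lie_module :: "('l, 'v, 'x) lie_mod_scheme \<Rightarrow> ('l, 'w, 'y) lie_mod_scheme
      \<Rightarrow> ('l, ('v \<times> 'w \<Rightarrow>\<^sub>0 complex) set) lie_mod" where
  "tensor_lie_module V W = module.extend (tensor_space V W)
     (lie_mod.fields (\<lambda>x. tensor_lift (tensor_space V W)
        (\<lambda>v w. pure_tensor V W (act V x v) w \<oplus>\<^bsub>tensor_space V W\<^esub> pure_tensor V W v (act W x w))))"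

definition lie_module_isomorphic ::
    "('l, 'x) lie_alg_scheme \<Rightarrow> ('l, 'v, 'y) lie_mod_scheme \<Rightarrow> ('l, 'w, 'z) lie_mod_scheme \<Rightarrow> bool"
  where
  "lie_module_isomorphic L V W \<longleftrightarrow> (\<exists>\<phi>. bij_betw \<phi> (carrier V) (carrier W) \<and>
     (\<forall>v\<in>carrier V. \<forall>w\<in>carrier V. \<phi> (v \<oplus>\<^bsub>V\<^esub> w) = \<phi> v \<oplus>\<^bsub>W\<^esub> \<phi> w) \<and>
     (\<forall>a. \<forall>v\<in>carrier V. \<phi> (a \<odot>\<^bsub>V\<^esub> v) = a \<odot>\<^bsub>W\<^esub> \<phi> v) \<and>
     (\<forall>x\<in>carrier L. \<forall>v\<in>carrier V. \<phi> (act V x v) = act W x (\<phi> v)))"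

definition free_algebra :: "'l set \<Rightarrow> ('l list \<Rightarrow>\<^sub>0 complex) ring" where
  "free_algebra A = \<lparr>carrier = {f. Poly_Mapping.keys f \<subseteq> lists A},
     mult = (\<lambda>f g. \<Sum>u\<in>Poly_Mapping.keys f. \<Sum>v\<in>Poly_Mapping.keys g. Poly_Mapping.single (u @ v) (Poly_Mapping.lookup f u * Poly_Mapping.lookup g v)),
     one = Poly_Mapping.single [] 1, zero = 0, add = (+)\<rparr>"

text \<open>Presenting \<open>U(L)\<close> by the elements of \<open>L\<close> as generators: the first two families of relations
  make the free algebra into the tensor algebra of \<open>L\<close>.\<close>

definition uea_relations :: "('l, 'x) lie_alg_scheme \<Rightarrow> ('l list \<Rightarrow>\<^sub>0 complex) set" where
  "uea_relations L =
     {Poly_Mapping.single [x \<oplus>\<^bsub>L\<^esub> y] 1 - Poly_Mapping.single [x] 1 - Poly_Mapping.single [y] 1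
       | x y. x \<in> carrier L \<and> y \<in> carrier L} \<union>
     {Poly_Mapping.single [a \<odot>\<^bsub>L\<^esub> x] 1 - Poly_Mapping.single [x] a | a x. x \<in> carrier L} \<union>
     {Poly_Mapping.single [x, y] 1 - Poly_Mapping.single [y, x] 1
        - Poly_Mapping.single [lie_bracket L x y] 1
       | x y. x \<in> carrier L \<and> y \<in> carrier L}"

definition uea_ideal :: "('l, 'x) lie_alg_scheme \<Rightarrow> ('l list \<Rightarrow>\<^sub>0 complex) set" where
  "uea_ideal L = genideal (free_algebra (carrier L)) (uea_relations L)"

definition uea :: "('l, 'x) lie_alg_scheme \<Rightarrow> (complex, ('l list \<Rightarrow>\<^sub>0 complex) set) module" where
  "uea L = ring.extend (free_algebra (carrier L) Quot uea_ideal L)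
     (module.fields (\<lambda>a X. \<Union>f\<in>X. uea_ideal L +>\<^bsub>free_algebra (carrier L)\<^esub> Poly_Mapping.map ((*) a) f))"

definition uea_embed :: "('l, 'x) lie_alg_scheme \<Rightarrow> 'l \<Rightarrow> ('l list \<Rightarrow>\<^sub>0 complex) set" where
  "uea_embed L x = uea_ideal L +>\<^bsub>free_algebra (carrier L)\<^esub> Poly_Mapping.single [x] 1"

definition uea_regular_module ::
    "('l, 'x) lie_alg_scheme \<Rightarrow> ('l, ('l list \<Rightarrow>\<^sub>0 complex) set) lie_mod" where
  "uea_regular_module L = module.extend (uea L) (lie_mod.fields (\<lambda>x u. uea_embed L x \<otimes>\<^bsub>uea L\<^esub> u))"

definition left_ideal :: "'u set \<Rightarrow> ('u, 'x) ring_scheme \<Rightarrow> bool" where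
  "left_ideal I R \<longleftrightarrow> additive_subgroup I R \<and> (\<forall>r\<in>carrier R. \<forall>x\<in>I. r \<otimes>\<^bsub>R\<^esub> x \<in> I)"

definition generated_left_ideal :: "('u, 'x) ring_scheme \<Rightarrow> 'u set \<Rightarrow> 'u set" where
  "generated_left_ideal R S = \<Inter>{I. left_ideal I R \<and> S \<subseteq> I}"

datatype vir_basis = C | D int

type_synonym vir = "vir_basis \<Rightarrow>\<^sub>0 complex"

fun vir_basis_bracket :: "vir_basis \<Rightarrow> vir_basis \<Rightarrow> vir" where
  "vir_basis_bracket (D i) (D j) = Poly_Mapping.single (D (i + j)) (of_int (j - i)) +
     (if i = - j then Poly_Mapping.single C ((of_int i ^ 3 - of_int i) / 12) else 0)"
| "vir_basis_bracket C _ = 0"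
| "vir_basis_bracket _ C = 0"

definition virasoro :: "vir lie_alg" where
  "virasoro = (let V = free_space UNIV in
     module.extend V (lie_alg.fields
       (\<lambda>x y. linear_extension V (\<lambda>p. linear_extension V (vir_basis_bracket p) y) x)))"

definition vir_c :: vir where
  "vir_c = Poly_Mapping.single C 1"

definition vir_d :: "int \<Rightarrow> vir" where
  "vir_d i = Poly_Mapping.single (D i) 1"

definition vir_module ::
    "(complex, 'v) module \<Rightarrow> (int \<Rightarrow> 'v \<Rightarrow> 'v) \<Rightarrow> ('v \<Rightarrow> 'v) \<Rightarrow> (vir, 'v) lie_mod" where
  "vir_module V dd cc = module.extend V (lie_mod.fields
     (\<lambda>x v. linear_extension V (\<lambda>p. case p of C \<Rightarrow> cc v | D i \<Rightarrow> dd i v) x))"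

definition vir_plus :: "vir lie_alg" where
  "vir_plus = virasoro\<lparr>carrier := generated_submodule virasoro {vir_d i | i. i \<ge> 0}\<rparr>"

definition vir_plus_ideal :: "nat \<Rightarrow> vir set" where
  "vir_plus_ideal r = generated_lie_subalgebra virasoro {vir_d i | i. i > int r}"

definition lie_a :: "nat \<Rightarrow> vir set lie_alg" where
  "lie_a r = quotient_lie_algebra vir_plus (vir_plus_ideal r)"

definition dbar :: "nat \<Rightarrow> nat \<Rightarrow> vir set" where
  "dbar r i = vir_plus_ideal r +>\<^bsub>vir_plus\<^esub> vir_d (int i)"

abbreviation laurent :: "(complex, int \<Rightarrow>\<^sub>0 complex) module" where
  "laurent \<equiv> free_space UNIV"

abbreviation tpow :: "int \<Rightarrow> (int \<Rightarrow>\<^sub>0 complex)" where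
  "tpow n \<equiv> Poly_Mapping.single n 1"

definition N_module :: "nat \<Rightarrow> (vir set, 'v) lie_mod \<Rightarrow> complex
      \<Rightarrow> (vir, ('v \<times> (int \<Rightarrow>\<^sub>0 complex) \<Rightarrow>\<^sub>0 complex) set) lie_mod" where
  "N_module r M \<alpha> = (let T = tensor_space M laurent in
     vir_module T
       (\<lambda>m. tensor_lift T (\<lambda>v. linear_extension T (\<lambda>n. pure_tensor M laurent
          (((\<alpha> + of_int n) \<odot>\<^bsub>M\<^esub> v) \<oplus>\<^bsub>M\<^esub>
            (\<Oplus>\<^bsub>M\<^esub>i \<in> {0..r}. (of_int m ^ (i + 1) / fact (i + 1)) \<odot>\<^bsub>M\<^esub> act M (dbar r i) v))
          (tpow (n + m)))))
       (\<lambda>_. \<zero>\<^bsub>T\<^esub>))"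

definition verma_left_ideal :: "complex \<Rightarrow> complex \<Rightarrow> (vir list \<Rightarrow>\<^sub>0 complex) set set" where
  "verma_left_ideal cd h = (let U = uea virasoro in generated_left_ideal U
     ({uea_embed virasoro (vir_d i) | i. i > 0} \<union>
      {uea_embed virasoro (vir_d 0) \<ominus>\<^bsub>U\<^esub> h \<odot>\<^bsub>U\<^esub> \<one>\<^bsub>U\<^esub>,
       uea_embed virasoro vir_c \<ominus>\<^bsub>U\<^esub> cd \<odot>\<^bsub>U\<^esub> \<one>\<^bsub>U\<^esub>}))"

definition verma :: "complex \<Rightarrow> complex \<Rightarrow> (vir, (vir list \<Rightarrow>\<^sub>0 complex) set set) lie_mod" where
  "verma cd h = quotient_lie_module (uea_regular_module virasoro) (verma_left_ideal cd h)"

text \<open>The basis vector \<open>v\<^bsub>a+k\<^esub>\<close> is represented by the index \<open>k\<close>.\<close>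

definition intermediate :: "complex \<Rightarrow> complex \<Rightarrow> (vir, int \<Rightarrow>\<^sub>0 complex) lie_mod" where
  "intermediate a b = (let V = free_space UNIV in
     vir_module V
       (\<lambda>i. linear_extension V
          (\<lambda>k. Poly_Mapping.single (k + i) (a + of_int k + of_int i * b)))
       (\<lambda>_. 0))"

text \<open>The reducible case is \<open>a \<in> \<int>\<close>, \<open>b \<in> {0, 1}\<close>. In the irreducible case the quotient by the zero
  submodule is taken only in order to have a module of the same type in both cases.\<close>

definition intermediate' :: "complex \<Rightarrow> complex \<Rightarrow> (vir, (int \<Rightarrow>\<^sub>0 complex) set) lie_mod" where
  "intermediate' a b =
     (if simple_lie_module virasoro (intermediate a b)
      then quotient_lie_module (intermediate a b) {0}
      else quotient_lie_module (intermediate 0 0)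
             (generated_submodule (intermediate 0 0) {Poly_Mapping.single 0 1}))"

text \<open>The basis vector \<open>T\<^sub>i\<^sup>k\<close> is represented by the pair \<open>(i, k)\<close>.\<close>

definition E_module :: "complex \<Rightarrow> complex \<Rightarrow> complex \<Rightarrow> complex
      \<Rightarrow> (vir, int \<times> nat \<Rightarrow>\<^sub>0 complex) lie_mod" where
  "E_module h b \<gamma> p = (let V = free_space UNIV in
     vir_module V
       (\<lambda>n. linear_extension V (\<lambda>(i, k).
          Poly_Mapping.single (i + n, k + 1) (1 - exp (of_int n * h)) +
          Poly_Mapping.single (i + n, k)
            (b + of_int i + of_int n * (p + \<gamma> - (\<gamma> + of_nat k) * exp (of_int n * h))) -
          (\<Sum>j<k. Poly_Mapping.single (i + n, j)
            (exp (of_int n * h) * of_int n ^ (k - j + 1) *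
              (of_nat (if j = 0 then 0 else k choose (j - 1)) + \<gamma> * of_nat (k choose j))))))
       (\<lambda>_. 0))"

end

theory Submission
  imports Defs "HOL-Computational_Algebra.Polynomial"
begin

text \<open>The proof attaches to a Virasoro module a number that exceeds \<open>2\<close> for \<open>N(M, \<alpha>)\<close> but never does so for
the modules of the other two families. For \<open>s \<ge> 0\<close> and \<open>l, m \<in> \<int>\<close> consider the operator
\<open>\<Sum>i\<le>s. (-1)\<^sup>i (s choose i) d\<^bsub>l-m-i\<^esub> d\<^bsub>m+i\<^esub>\<close>, which is up to sign the \<open>s\<close>-th finite
difference in \<open>m\<close> of the word \<open>d\<^bsub>l-m\<^esub> d\<^bsub>m\<^esub>\<close> (\<open>quad_difference\<close>). Say that a module has difference order \<open>s\<close> if all the operators of order \<open>s + 1\<close>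
vanish on it and all those of order \<open>s\<close> are injective (\<open>difference_order\<close>). This is invariant under
isomorphism (\<open>difference_order_isomorphic\<close>).

On \<open>N(M, \<alpha>)\<close> identify each \<open>M \<otimes> t\<^sup>n\<close> with \<open>M\<close>. Then \<open>d\<^bsub>l-m\<^esub> d\<^bsub>m\<^esub>\<close> becomes a polynomial in \<open>m\<close> with
coefficients in the operators on \<open>M\<close>. Since \<open>r \<ge> 1\<close>, its degree is \<open>2 (r + 1)\<close>, and the top
coefficient is a nonzero multiple of the square of the action of \<open>dbar r r\<close>, which is injective. Hence
\<open>N(M, \<alpha>)\<close> has difference order \<open>2 (r + 1) > 2\<close> (\<open>difference_order_N\<close>).

On the intermediate series the coefficient of \<open>d\<^bsub>l-m\<^esub> d\<^bsub>m\<^esub> v\<^bsub>a+k\<^esub>\<close> is quadratic in \<open>m\<close>, so that all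
differences of order \<open>s > 2\<close> vanish. Let now \<open>v\<close> be the highest weight vector of \<open>V(c, h)\<close> and suppose
that the tensor product has difference order \<open>s > 2\<close>. For \<open>j < 0\<close> apply the
operator of order \<open>s + 1\<close> with \<open>l = j + 1\<close> and \<open>m = 1\<close> to \<open>v \<otimes> v\<^bsub>a+k\<^esub>\<close>: the component of the result
in \<open>V(c, h) \<otimes> v\<^bsub>a+k+1\<^esub>\<close> is a multiple of \<open>d\<^bsub>j\<^esub> v \<otimes> v\<^bsub>a+k+1\<^esub>\<close>, nonzero for a suitable \<open>k\<close> unless
\<open>d\<^bsub>j\<^esub> v = 0\<close>. Therefore \<open>d\<^bsub>j\<^esub> v = 0\<close> for all \<open>j \<noteq> 0\<close>, which reduces the action of
the words \<open>d\<^bsub>-1-i\<^esub> d\<^bsub>1+i\<^esub>\<close> on \<open>v \<otimes> v\<^bsub>a+k\<^esub>\<close> to the second factor. There their difference of order \<open>s\<close> is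
zero, contrary to injectivity (\<open>tensor_intermediate_no_difference_order\<close>).

On \<open>E\<^sub>h(b, \<gamma>, p)\<close> put \<open>q = exp h\<close>. If \<open>q = 1\<close>, the words map \<open>T\<^sub>i\<^sup>0\<close> to multiples of \<open>T\<^bsub>i+l\<^esub>\<^sup>0\<close>
with coefficients quadratic in \<open>m\<close>, and the operators of order \<open>s > 2\<close> are again not injective.
If \<open>q \<noteq> 1\<close>, the words produce the exponentials \<open>(1 - q\<^sup>m) (1 - q\<^bsup>l-m\<^esup>)\<close> in front of \<open>T\<^sub>l\<^sup>2\<close>, and no difference operator kills these for
all \<open>l\<close> (\<open>E_module_no_difference_order\<close>).\<close>

section \<open>Complex vector spaces and linear maps\<close>

lemma complex_ring_simps [simp]:
  "carrier complex_ring = UNIV" "add complex_ring = (+)" "monoid.mult complex_ring = (*)"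
  "zero complex_ring = 0" "one complex_ring = 1"
  by (simp_all add: complex_ring_def)

lemma cring_complex_ring: "cring complex_ring"
proof (rule cringI)
  show "abelian_group complex_ring"
    by (rule abelian_groupI) (auto simp: algebra_simps intro: exI[of _ "- _"])
  show "comm_monoid complex_ring"
    by (rule comm_monoidI) auto
qed (auto simp: algebra_simps)

abbreviation cspace :: "(complex, 'v, 'x) module_scheme \<Rightarrow> bool" where
  "cspace V \<equiv> module complex_ring V"

text \<open>Lie algebras and Lie modules extend the record of vector spaces; this carries the vector space
  structure over to the extended record.\<close>

lemma cspace_cong:
  assumes "cspace V" "carrier W = carrier V" "add W = add V" "zero W = zero V" "module.smult W = module.smult V"
  shows "cspace W"
proof -
  interpret V: module complex_ring V by fact
  have "abelian_group W"
    by (rule abelian_groupI) (use assms V.a_ac V.l_neg in \<open>auto intro!: bexI[of _ "\<ominus>\<^bsub>V\<^esub> _"]\<close>)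
  then show ?thesis
    by (intro moduleI cring_complex_ring)
      (use assms V.smult_l_distr V.smult_r_distr V.smult_assoc1 V.smult_one in auto)
qed

lemma
  assumes "cspace V"
  shows smult_one_left: "x \<in> carrier V \<Longrightarrow> 1 \<odot>\<^bsub>V\<^esub> x = x"
    and smult_zero_left: "x \<in> carrier V \<Longrightarrow> 0 \<odot>\<^bsub>V\<^esub> x = \<zero>\<^bsub>V\<^esub>"
    and smult_zero_right: "a \<odot>\<^bsub>V\<^esub> \<zero>\<^bsub>V\<^esub> = \<zero>\<^bsub>V\<^esub>"
    and smult_add_left: "x \<in> carrier V \<Longrightarrow> (a + b) \<odot>\<^bsub>V\<^esub> x = a \<odot>\<^bsub>V\<^esub> x \<oplus>\<^bsub>V\<^esub> b \<odot>\<^bsub>V\<^esub> x"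
    and smult_mult_left: "x \<in> carrier V \<Longrightarrow> (a * b) \<odot>\<^bsub>V\<^esub> x = a \<odot>\<^bsub>V\<^esub> (b \<odot>\<^bsub>V\<^esub> x)"
    and smult_in_carrier: "x \<in> carrier V \<Longrightarrow> a \<odot>\<^bsub>V\<^esub> x \<in> carrier V"
proof -
  interpret V: module complex_ring V by fact
  show "x \<in> carrier V \<Longrightarrow> 1 \<odot>\<^bsub>V\<^esub> x = x"
    "x \<in> carrier V \<Longrightarrow> 0 \<odot>\<^bsub>V\<^esub> x = \<zero>\<^bsub>V\<^esub>"
    "a \<odot>\<^bsub>V\<^esub> \<zero>\<^bsub>V\<^esub> = \<zero>\<^bsub>V\<^esub>"
    "x \<in> carrier V \<Longrightarrow> (a + b) \<odot>\<^bsub>V\<^esub> x = a \<odot>\<^bsub>V\<^esub> x \<oplus>\<^bsub>V\<^esub> b \<odot>\<^bsub>V\<^esub> x"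
    "x \<in> carrier V \<Longrightarrow> (a * b) \<odot>\<^bsub>V\<^esub> x = a \<odot>\<^bsub>V\<^esub> (b \<odot>\<^bsub>V\<^esub> x)"
    "x \<in> carrier V \<Longrightarrow> a \<odot>\<^bsub>V\<^esub> x \<in> carrier V"
    using V.smult_one[of x] V.smult_l_null[of x] V.smult_r_null[of a] V.smult_l_distr[of a b x]
      V.smult_assoc1[of a b x] by simp_all
qed

lemma smult_eq_zeroD:
  assumes "cspace V" "x \<in> carrier V" "a \<noteq> 0" "a \<odot>\<^bsub>V\<^esub> x = \<zero>\<^bsub>V\<^esub>"
  shows "x = \<zero>\<^bsub>V\<^esub>"
proof -
  have "x = (inverse a * a) \<odot>\<^bsub>V\<^esub> x"
    using assms(3) smult_one_left[OF assms(1,2)] by simp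
  also have "\<dots> = \<zero>\<^bsub>V\<^esub>"
    by (simp add: smult_mult_left[OF assms(1,2)] assms(4) smult_zero_right[OF assms(1)])
  finally show ?thesis .
qed

lemma smult_swap:
  assumes "cspace V" "x \<in> carrier V"
  shows "a \<odot>\<^bsub>V\<^esub> (b \<odot>\<^bsub>V\<^esub> x) = b \<odot>\<^bsub>V\<^esub> (a \<odot>\<^bsub>V\<^esub> x)"
  using smult_mult_left[OF assms, of a b] smult_mult_left[OF assms, of b a] by (simp add: mult.commute)

definition linear_map ::
    "(complex, 'v, 'x) module_scheme \<Rightarrow> (complex, 'w, 'y) module_scheme \<Rightarrow> ('v \<Rightarrow> 'w) \<Rightarrow> bool" where
  "linear_map V W f \<longleftrightarrow> f \<in> carrier V \<rightarrow> carrier W \<and>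
     (\<forall>x\<in>carrier V. \<forall>y\<in>carrier V. f (x \<oplus>\<^bsub>V\<^esub> y) = f x \<oplus>\<^bsub>W\<^esub> f y) \<and>
     (\<forall>a. \<forall>x\<in>carrier V. f (a \<odot>\<^bsub>V\<^esub> x) = a \<odot>\<^bsub>W\<^esub> f x)"

lemma linear_mapI:
  assumes "\<And>x. x \<in> carrier V \<Longrightarrow> f x \<in> carrier W"
    and "\<And>x y. \<lbrakk>x \<in> carrier V; y \<in> carrier V\<rbrakk> \<Longrightarrow> f (x \<oplus>\<^bsub>V\<^esub> y) = f x \<oplus>\<^bsub>W\<^esub> f y"
    and "\<And>a x. x \<in> carrier V \<Longrightarrow> f (a \<odot>\<^bsub>V\<^esub> x) = a \<odot>\<^bsub>W\<^esub> f x"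
  shows "linear_map V W f"
  using assms by (auto simp: linear_map_def)

lemma linear_map_closed: "\<lbrakk>linear_map V W f; x \<in> carrier V\<rbrakk> \<Longrightarrow> f x \<in> carrier W"
  and linear_map_add: "\<lbrakk>linear_map V W f; x \<in> carrier V; y \<in> carrier V\<rbrakk>
    \<Longrightarrow> f (x \<oplus>\<^bsub>V\<^esub> y) = f x \<oplus>\<^bsub>W\<^esub> f y"
  and linear_map_smult: "\<lbrakk>linear_map V W f; x \<in> carrier V\<rbrakk> \<Longrightarrow> f (a \<odot>\<^bsub>V\<^esub> x) = a \<odot>\<^bsub>W\<^esub> f x"
  by (auto simp: linear_map_def)

lemma linear_map_zero:
  assumes "cspace V" "cspace W" "linear_map V W f"
  shows "f \<zero>\<^bsub>V\<^esub> = \<zero>\<^bsub>W\<^esub>"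
proof -
  interpret V: module complex_ring V by fact
  interpret W: module complex_ring W by fact
  have "f (0 \<odot>\<^bsub>V\<^esub> \<zero>\<^bsub>V\<^esub>) = 0 \<odot>\<^bsub>W\<^esub> f \<zero>\<^bsub>V\<^esub>"
    using V.zero_closed by (rule linear_map_smult[OF assms(3)])
  then show ?thesis
    using V.smult_l_null W.smult_l_null linear_map_closed[OF assms(3)] by simp
qed

lemma smult_minus_one:
  assumes "cspace V" "x \<in> carrier V"
  shows "\<ominus>\<^bsub>V\<^esub> x = (- 1) \<odot>\<^bsub>V\<^esub> x"
proof -
  interpret V: module complex_ring V by fact
  have "\<ominus>\<^bsub>complex_ring\<^esub> 1 = - 1"
    using V.R.minus_equality[of "-1" 1] by simp
  then show ?thesis
    using V.smult_l_minus[of 1 x] V.smult_one assms by simp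
qed

lemma linear_map_neg:
  assumes "cspace V" "cspace W" "linear_map V W f" "x \<in> carrier V"
  shows "f (\<ominus>\<^bsub>V\<^esub> x) = \<ominus>\<^bsub>W\<^esub> f x"
  using assms by (simp add: smult_minus_one linear_map_smult linear_map_closed)

lemma linear_map_finsum:
  assumes "cspace V" "cspace W" "linear_map V W f" "finite A" "g \<in> A \<rightarrow> carrier V"
  shows "f (finsum V g A) = (\<Oplus>\<^bsub>W\<^esub>a\<in>A. f (g a))"
proof -
  interpret V: module complex_ring V by fact
  interpret W: module complex_ring W by fact
  show ?thesis
    using assms(4,5)
  proof (induction rule: finite_induct)
    case empty
    then show ?case by (simp add: linear_map_zero[OF assms(1-3)])
  next
    case (insert a A)
    then have "g \<in> A \<rightarrow> carrier V" "g a \<in> carrier V" by auto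
    moreover have "(\<lambda>a. f (g a)) \<in> A \<rightarrow> carrier W" "f (g a) \<in> carrier W"
      using calculation linear_map_closed[OF assms(3)] by auto
    ultimately show ?case
      using insert by (simp add: linear_map_add[OF assms(3)])
  qed
qed

lemma linear_map_comp:
  assumes "linear_map V W f" "linear_map W X g"
  shows "linear_map V X (\<lambda>x. g (f x))"
  using assms by (auto simp: linear_map_def Pi_iff)

lemma linear_map_add_fun:
  assumes "cspace W" "linear_map V W f" "linear_map V W g"
  shows "linear_map V W (\<lambda>x. f x \<oplus>\<^bsub>W\<^esub> g x)"
proof -
  interpret W: module complex_ring W by fact
  show ?thesis
    by (rule linear_mapI)
      (use assms in \<open>auto simp: linear_map_closed linear_map_add linear_map_smult W.smult_r_distr W.a_ac\<close>)
qed

lemma linear_map_smult_fun: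
  assumes "cspace W" "linear_map V W f"
  shows "linear_map V W (\<lambda>x. a \<odot>\<^bsub>W\<^esub> f x)"
proof -
  interpret W: module complex_ring W by fact
  show ?thesis
    by (intro linear_mapI)
      (use assms in \<open>auto simp: linear_map_closed linear_map_add linear_map_smult W.smult_r_distr
        smult_swap[OF assms(1), of _ a]\<close>)
qed

lemma linear_map_id: "linear_map V V (\<lambda>x. x)"
  by (simp add: linear_map_def)

lemma linear_map_finsum_fun:
  assumes "cspace V" "cspace W" "finite A" "\<And>a. a \<in> A \<Longrightarrow> linear_map V W (f a)"
  shows "linear_map V W (\<lambda>x. \<Oplus>\<^bsub>W\<^esub>a\<in>A. f a x)"
proof -
  interpret V: module complex_ring V by fact
  interpret W: module complex_ring W by fact
  have cl: "(\<lambda>a. f a x) \<in> A \<rightarrow> carrier W" if "x \<in> carrier V" for x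
    using that assms(4) linear_map_closed by fast
  show ?thesis
  proof (rule linear_mapI)
    show "(\<Oplus>\<^bsub>W\<^esub>a\<in>A. f a x) \<in> carrier W" if "x \<in> carrier V" for x
      using cl[OF that] by simp
    show "(\<Oplus>\<^bsub>W\<^esub>a\<in>A. f a (x \<oplus>\<^bsub>V\<^esub> y)) = (\<Oplus>\<^bsub>W\<^esub>a\<in>A. f a x) \<oplus>\<^bsub>W\<^esub> (\<Oplus>\<^bsub>W\<^esub>a\<in>A. f a y)"
      if "x \<in> carrier V" "y \<in> carrier V" for x y
    proof -
      have "(\<Oplus>\<^bsub>W\<^esub>a\<in>A. f a (x \<oplus>\<^bsub>V\<^esub> y)) = (\<Oplus>\<^bsub>W\<^esub>a\<in>A. f a x \<oplus>\<^bsub>W\<^esub> f a y)"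
        using cl[OF that(1)] cl[OF that(2)] that assms(4)
        by (intro W.finsum_cong') (auto simp: linear_map_add Pi_iff)
      then show ?thesis
        using cl[OF that(1)] cl[OF that(2)] by (simp add: W.finsum_addf)
    qed
    show "(\<Oplus>\<^bsub>W\<^esub>i\<in>A. f i (a \<odot>\<^bsub>V\<^esub> x)) = a \<odot>\<^bsub>W\<^esub> (\<Oplus>\<^bsub>W\<^esub>i\<in>A. f i x)" if "x \<in> carrier V" for a x
    proof -
      have "(\<Oplus>\<^bsub>W\<^esub>i\<in>A. f i (a \<odot>\<^bsub>V\<^esub> x)) = (\<Oplus>\<^bsub>W\<^esub>i\<in>A. a \<odot>\<^bsub>W\<^esub> f i x)"
        using cl[OF that] that assms(4)
        by (intro W.finsum_cong') (auto simp: linear_map_smult Pi_iff)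
      then show ?thesis
        using cl[OF that] assms(3) by (simp add: W.finsum_smult_ldistr)
    qed
  qed
qed

section \<open>Quotient spaces\<close>

lemma submodule_abelian_subgroup:
  assumes "cspace V" "submodule J complex_ring V"
  shows "abelian_subgroup J V"
proof -
  interpret V: module complex_ring V by fact
  show ?thesis
    using submodule.axioms(1)[OF assms(2)] by (intro abelian_subgroupI3 additive_subgroupI V.abelian_group_axioms)
qed

lemma quotient_space_simps [simp]:
  "carrier (quotient_space V J) = a_rcosets\<^bsub>V\<^esub> J"
  "zero (quotient_space V J) = J"
  "add (quotient_space V J) = set_add V"
  "module.smult (quotient_space V J) = (\<lambda>a X. \<Union>x\<in>X. J +>\<^bsub>V\<^esub> (a \<odot>\<^bsub>V\<^esub> x))"
  by (simp_all add: quotient_space_def)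

lemma mem_a_rcosets_iff: "X \<in> a_rcosets\<^bsub>V\<^esub> J \<longleftrightarrow> (\<exists>x\<in>carrier V. X = J +>\<^bsub>V\<^esub> x)"
  by (auto simp: A_RCOSETS_def')

lemma coset_in_rcosets: "x \<in> carrier V \<Longrightarrow> J +>\<^bsub>V\<^esub> x \<in> a_rcosets\<^bsub>V\<^esub> J"
  by (auto simp: A_RCOSETS_def')

lemma coset_eq_iff:
  assumes "cspace V" "submodule J complex_ring V" "x \<in> carrier V" "y \<in> carrier V"
  shows "J +>\<^bsub>V\<^esub> x = J +>\<^bsub>V\<^esub> y \<longleftrightarrow> x \<oplus>\<^bsub>V\<^esub> \<ominus>\<^bsub>V\<^esub> y \<in> J"
proof -
  interpret V: module complex_ring V by fact
  interpret J: abelian_subgroup J V by (rule submodule_abelian_subgroup[OF assms(1,2)])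
  show ?thesis
    using J.a_rcos_module[of y x] J.a_repr_independence'[of x y] J.a_rcos_self[of x] assms by metis
qed

text \<open>The scalar multiplication of a quotient space and the action on a quotient module are defined as
  unions over all representatives of a coset. If the map preserves \<open>J\<close>, all representatives contribute
  the same coset, so that the union can be computed on one of them.\<close>

lemma coset_UNION:
  assumes "cspace V" "submodule J complex_ring V" "linear_map V V f" "f ` J \<subseteq> J" "x \<in> carrier V"
  shows "(\<Union>y\<in>J +>\<^bsub>V\<^esub> x. J +>\<^bsub>V\<^esub> f y) = J +>\<^bsub>V\<^esub> f x"
proof -
  interpret V: module complex_ring V by fact
  interpret J: abelian_subgroup J V by (rule submodule_abelian_subgroup[OF assms(1,2)])
  have "J +>\<^bsub>V\<^esub> f y = J +>\<^bsub>V\<^esub> f x" if "y \<in> J +>\<^bsub>V\<^esub> x" for y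
  proof -
    have y: "y \<in> carrier V" using that assms J.a_elemrcos_carrier by blast
    then have "y \<oplus>\<^bsub>V\<^esub> \<ominus>\<^bsub>V\<^esub> x \<in> J" using J.a_rcos_module that assms by blast
    then have "f (y \<oplus>\<^bsub>V\<^esub> \<ominus>\<^bsub>V\<^esub> x) \<in> J" using assms by blast
    then show ?thesis
      using y assms by (simp add: coset_eq_iff linear_map_add linear_map_neg linear_map_closed)
  qed
  then show ?thesis using J.a_rcos_self[of x] assms by blast
qed

lemma smult_submodule: "submodule J complex_ring V \<Longrightarrow> (\<lambda>x. a \<odot>\<^bsub>V\<^esub> x) ` J \<subseteq> J"
  using submodule.smult_closed by fastforce

lemma coset_smult:
  assumes "cspace V" "submodule J complex_ring V" "x \<in> carrier V"
  shows "a \<odot>\<^bsub>quotient_space V J\<^esub> (J +>\<^bsub>V\<^esub> x) = J +>\<^bsub>V\<^esub> (a \<odot>\<^bsub>V\<^esub> x)"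
  using coset_UNION[OF assms(1,2) linear_map_smult_fun[OF assms(1) linear_map_id] smult_submodule[OF assms(2)] assms(3)]
  by simp

lemma coset_add:
  assumes "cspace V" "submodule J complex_ring V" "x \<in> carrier V" "y \<in> carrier V"
  shows "(J +>\<^bsub>V\<^esub> x) \<oplus>\<^bsub>quotient_space V J\<^esub> (J +>\<^bsub>V\<^esub> y) = J +>\<^bsub>V\<^esub> (x \<oplus>\<^bsub>V\<^esub> y)"
proof -
  interpret V: module complex_ring V by fact
  interpret J: abelian_subgroup J V by (rule submodule_abelian_subgroup[OF assms(1,2)])
  show ?thesis using J.a_rcos_sum assms by simp
qed

lemma coset_zero:
  assumes "cspace V" "submodule J complex_ring V" "x \<in> carrier V"
  shows "J +>\<^bsub>V\<^esub> x = J \<longleftrightarrow> x \<in> J"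
proof -
  interpret V: module complex_ring V by fact
  interpret J: abelian_subgroup J V by (rule submodule_abelian_subgroup[OF assms(1,2)])
  show ?thesis
    using J.a_rcos_self assms J.a_rcos_const by metis
qed

lemma cspace_quotient:
  assumes "cspace V" "submodule J complex_ring V"
  shows "cspace (quotient_space V J)"
proof -
  interpret V: module complex_ring V by fact
  interpret J: abelian_subgroup J V using assms by (rule submodule_abelian_subgroup)
  note [simp del] = quotient_space_simps(3,4)
  have "comm_group (add_monoid (quotient_space V J))"
  proof -
    have "carrier (V A_Mod J) = a_rcosets\<^bsub>V\<^esub> J" "monoid.mult (V A_Mod J) = set_add V" "one (V A_Mod J) = J"
      by (simp_all add: A_FactGroup_def FactGroup_def A_RCOSETS_def set_add_def)
    moreover have "comm_group (add_monoid (quotient_space V J)) = comm_group (V A_Mod J)"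
      by (simp add: quotient_space_def comm_group_def comm_monoid_def group_def monoid_def
          comm_monoid_axioms_def group_axioms_def Units_def calculation)
    ultimately show ?thesis using J.a_factorgroup_is_comm_group by simp
  qed
  then have "abelian_group (quotient_space V J)"
    by (simp add: abelian_group_def abelian_monoid_def abelian_group_axioms_def comm_group.axioms)
  then show ?thesis
    by (intro moduleI cring_complex_ring)
      (auto simp: mem_a_rcosets_iff coset_smult[OF assms] coset_add[OF assms]
        V.smult_l_distr[simplified] V.smult_r_distr V.smult_assoc1[simplified] V.smult_one[simplified])
qed

lemma linear_map_coset:
  assumes "cspace V" "submodule J complex_ring V"
  shows "linear_map V (quotient_space V J) (\<lambda>x. J +>\<^bsub>V\<^esub> x)"
  by (rule linear_mapI) (use coset_add[OF assms] coset_smult[OF assms] in \<open>auto simp: coset_in_rcosets\<close>)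

text \<open>The universal property of quotient spaces, in the form used by \<open>tensor_lift\<close>: a map that vanishes
  on \<open>J\<close> has a single value on each coset.\<close>

lemma the_elem_coset:
  assumes "cspace V" "cspace W" "submodule J complex_ring V" "linear_map V W f" "f ` J \<subseteq> {\<zero>\<^bsub>W\<^esub>}" "x \<in> carrier V"
  shows "the_elem (f ` (J +>\<^bsub>V\<^esub> x)) = f x"
proof -
  interpret V: module complex_ring V by fact
  interpret W: module complex_ring W by fact
  interpret J: abelian_subgroup J V by (rule submodule_abelian_subgroup[OF assms(1,3)])
  have "f y = f x" if yx: "y \<in> J +>\<^bsub>V\<^esub> x" for y
  proof -
    from yx obtain j where "j \<in> J" "y = j \<oplus>\<^bsub>V\<^esub> x" by (auto simp: a_r_coset_def')
    then show ?thesis using assms linear_map_closed[OF assms(4)] J.a_Hcarr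
      by (force simp: linear_map_add[OF assms(4)])
  qed
  then have "f ` (J +>\<^bsub>V\<^esub> x) = {f x}" using J.a_rcos_self[of x] assms by blast
  then show ?thesis by simp
qed

lemma linear_map_the_elem:
  assumes "cspace V" "cspace W" "submodule J complex_ring V" "linear_map V W f" "f ` J \<subseteq> {\<zero>\<^bsub>W\<^esub>}"
  shows "linear_map (quotient_space V J) W (\<lambda>X. the_elem (f ` X))"
proof -
  interpret V: module complex_ring V by fact
  note [simp del] = quotient_space_simps(3,4)
  note [simp] = the_elem_coset[OF assms] coset_add[OF assms(1,3)] coset_smult[OF assms(1,3)]
  show ?thesis
    by (rule linear_mapI)
      (auto simp: mem_a_rcosets_iff linear_map_add[OF assms(4)] linear_map_smult[OF assms(4)] intro: linear_map_closed[OF assms(4)])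
qed

lemma generated_submodule_superset: "S \<subseteq> generated_submodule V S"
  by (auto simp: generated_submodule_def)

lemma generated_submodule_minimal:
  "submodule H complex_ring V \<Longrightarrow> S \<subseteq> H \<Longrightarrow> generated_submodule V S \<subseteq> H"
  by (auto simp: generated_submodule_def)

lemma cspace_submoduleI:
  assumes "cspace V" "H \<subseteq> carrier V" "\<zero>\<^bsub>V\<^esub> \<in> H" "\<And>x y. x \<in> H \<Longrightarrow> y \<in> H \<Longrightarrow> x \<oplus>\<^bsub>V\<^esub> y \<in> H"
    "\<And>a x. x \<in> H \<Longrightarrow> a \<odot>\<^bsub>V\<^esub> x \<in> H"
  shows "submodule H complex_ring V"
proof -
  interpret V: module complex_ring V by fact
  show ?thesis
    by (rule V.submoduleI) (use assms in \<open>auto simp: smult_minus_one[OF assms(1)] subset_iff\<close>)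
qed

lemma cspace_submoduleD:
  assumes "submodule H complex_ring V"
  shows "H \<subseteq> carrier V" "\<zero>\<^bsub>V\<^esub> \<in> H" "\<And>x y. x \<in> H \<Longrightarrow> y \<in> H \<Longrightarrow> x \<oplus>\<^bsub>V\<^esub> y \<in> H"
    "\<And>a x. x \<in> H \<Longrightarrow> a \<odot>\<^bsub>V\<^esub> x \<in> H"
  using subgroup.subset[OF submodule.axioms(1)[OF assms]] subgroup.one_closed[OF submodule.axioms(1)[OF assms]]
    subgroup.m_closed[OF submodule.axioms(1)[OF assms]] submodule.smult_closed[OF assms] by auto

lemma submodule_carrier: "cspace V \<Longrightarrow> submodule (carrier V) complex_ring V"
proof -
  assume V: "cspace V"
  interpret V: module complex_ring V by fact
  show ?thesis by (rule cspace_submoduleI[OF V]) auto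
qed

lemma submodule_generated:
  assumes "cspace V" "S \<subseteq> carrier V"
  shows "submodule (generated_submodule V S) complex_ring V"
proof (rule cspace_submoduleI[OF assms(1)])
  have "submodule (carrier V) complex_ring V" using assms by (simp add: submodule_carrier)
  then show "generated_submodule V S \<subseteq> carrier V" by (simp add: generated_submodule_minimal assms)
qed (auto simp: generated_submodule_def dest: cspace_submoduleD(3,4) cspace_submoduleD(2))

lemma submodule_kernel:
  assumes "cspace V" "cspace W" "linear_map V W f"
  shows "submodule {x \<in> carrier V. f x = \<zero>\<^bsub>W\<^esub>} complex_ring V"
proof -
  interpret V: module complex_ring V by fact
  interpret W: module complex_ring W by fact
  have "a \<odot>\<^bsub>W\<^esub> \<zero>\<^bsub>W\<^esub> = \<zero>\<^bsub>W\<^esub>" for a using W.smult_r_null by simp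
  then show ?thesis
    by (intro cspace_submoduleI[OF assms(1)])
      (auto simp: linear_map_zero[OF assms] linear_map_add[OF assms(3)] linear_map_smult[OF assms(3)])
qed

text \<open>The kernel is a submodule, so that it contains everything generated by elements of it.\<close>

lemma linear_map_generated_submodule:
  assumes "cspace V" "cspace W" "linear_map V W f" "S \<subseteq> carrier V" "f ` S \<subseteq> {\<zero>\<^bsub>W\<^esub>}"
  shows "f ` generated_submodule V S \<subseteq> {\<zero>\<^bsub>W\<^esub>}"
  using generated_submodule_minimal[OF submodule_kernel[OF assms(1-3)], of S] assms(4,5) by blast

section \<open>Free spaces\<close>

lemma lookup_map_times [simp]: "Poly_Mapping.lookup (Poly_Mapping.map ((*) a) x) k = a * Poly_Mapping.lookup x k"
  for a :: complex
  by (simp add: map.rep_eq when_def)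

lemma free_space_simps [simp]:
  "carrier (free_space B) = {f. Poly_Mapping.keys f \<subseteq> B}" "zero (free_space B) = 0"
  "add (free_space B) = (+)" "module.smult (free_space B) = (\<lambda>a. Poly_Mapping.map ((*) a))"
  by (simp_all add: free_space_def)

lemma single_in_free_space: "b \<in> B \<Longrightarrow> Poly_Mapping.single b a \<in> carrier (free_space B)"
  by auto

lemma keys_map_times: "Poly_Mapping.keys (Poly_Mapping.map ((*) a) x) \<subseteq> Poly_Mapping.keys x" for a :: complex
  by (auto simp: in_keys_iff)

lemma cspace_free_space: "cspace (free_space B)"
proof (intro moduleI cring_complex_ring)
  show "abelian_group (free_space B)"
  proof (rule abelian_groupI)
    fix x assume "x \<in> carrier (free_space B)"
    then show "\<exists>y\<in>carrier (free_space B). y \<oplus>\<^bsub>free_space B\<^esub> x = \<zero>\<^bsub>free_space B\<^esub>"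
      by (intro bexI[of _ "- x"]) auto
  qed (use Poly_Mapping.keys_add in \<open>fastforce simp: algebra_simps\<close>)+
qed (use keys_map_times in \<open>fastforce simp: algebra_simps lookup_add intro: poly_mapping_eqI\<close>)+

lemma finsum_free_space:
  assumes "finite A" "g \<in> A \<rightarrow> carrier (free_space B)"
  shows "finsum (free_space B) g A = sum g A"
proof -
  interpret F: module complex_ring "free_space B" by (rule cspace_free_space)
  show ?thesis
    using assms by (induction rule: finite_induct) (auto simp: Pi_iff)
qed

lemma sum_single_lookup:
  assumes "finite A" "Poly_Mapping.keys x \<subseteq> A"
  shows "(\<Sum>b\<in>A. Poly_Mapping.single b (Poly_Mapping.lookup x b)) = x"
proof (rule poly_mapping_eqI)
  fix k
  have "(\<Sum>b\<in>A. Poly_Mapping.lookup (Poly_Mapping.single b (Poly_Mapping.lookup x b)) k)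
      = (\<Sum>b\<in>A. if b = k then Poly_Mapping.lookup x k else 0)"
    by (intro sum.cong) (auto simp: lookup_single when_def)
  then show "Poly_Mapping.lookup (\<Sum>b\<in>A. Poly_Mapping.single b (Poly_Mapping.lookup x b)) k = Poly_Mapping.lookup x k"
    using assms by (auto simp: lookup_sum in_keys_iff subset_iff)
qed

lemma map_times_single [simp]: "Poly_Mapping.map ((*) a) (Poly_Mapping.single b c) = Poly_Mapping.single b (a * c)"
  for a :: complex
  by (rule poly_mapping_eqI) (simp add: lookup_single when_def)

text \<open>Summation over a set larger than the support allows two vectors to be compared term by term.\<close>

lemma linear_extension_eq:
  assumes "cspace V" "f \<in> A \<rightarrow> carrier V" "finite A" "Poly_Mapping.keys x \<subseteq> A"
  shows "linear_extension V f x = (\<Oplus>\<^bsub>V\<^esub>b\<in>A. Poly_Mapping.lookup x b \<odot>\<^bsub>V\<^esub> f b)"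
proof -
  interpret V: module complex_ring V by fact
  have "\<forall>i\<in>A - Poly_Mapping.keys x. Poly_Mapping.lookup x i \<odot>\<^bsub>V\<^esub> f i = \<zero>\<^bsub>V\<^esub>"
    using assms by (auto simp: in_keys_iff smult_zero_left[OF assms(1)] Pi_iff)
  then show ?thesis
    unfolding linear_extension_def using assms
    by (intro V.add.finprod_mono_neutral_cong_left) (auto simp: Pi_iff)
qed

lemma linear_map_linear_extension:
  assumes "cspace V" "f \<in> B \<rightarrow> carrier V"
  shows "linear_map (free_space B) V (linear_extension V f)"
proof -
  interpret V: module complex_ring V by fact
  have e: "linear_extension V f x = (\<Oplus>\<^bsub>V\<^esub>b\<in>A. Poly_Mapping.lookup x b \<odot>\<^bsub>V\<^esub> f b)"
    if "finite A" "Poly_Mapping.keys x \<subseteq> A" "A \<subseteq> B" for x A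
    using that assms by (intro linear_extension_eq) auto
  have cl: "(\<lambda>b. Poly_Mapping.lookup x b \<odot>\<^bsub>V\<^esub> f b) \<in> A \<rightarrow> carrier V" if "A \<subseteq> B" for x A
    using that assms by (auto intro!: smult_in_carrier[OF assms(1)])
  show ?thesis
  proof (rule linear_mapI)
    fix x y a assume xy: "x \<in> carrier (free_space B)" "y \<in> carrier (free_space B)"
    let ?A = "Poly_Mapping.keys x \<union> Poly_Mapping.keys y"
    have A: "?A \<subseteq> B" "finite ?A" using xy by auto
    have "linear_extension V f (x + y) = (\<Oplus>\<^bsub>V\<^esub>b\<in>?A. Poly_Mapping.lookup (x + y) b \<odot>\<^bsub>V\<^esub> f b)"
      using xy Poly_Mapping.keys_add[of x y] by (intro e) auto
    also have "\<dots> = (\<Oplus>\<^bsub>V\<^esub>b\<in>?A. Poly_Mapping.lookup x b \<odot>\<^bsub>V\<^esub> f b \<oplus>\<^bsub>V\<^esub> Poly_Mapping.lookup y b \<odot>\<^bsub>V\<^esub> f b)"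
      using assms A by (intro V.finsum_cong') (auto simp: lookup_add smult_add_left[OF assms(1)] Pi_iff subset_iff)
    also have "\<dots> = linear_extension V f x \<oplus>\<^bsub>V\<^esub> linear_extension V f y"
      using A cl[OF A(1)] by (simp add: V.finsum_addf e[OF A(2) _ A(1)])
    finally show "linear_extension V f (x \<oplus>\<^bsub>free_space B\<^esub> y) = linear_extension V f x \<oplus>\<^bsub>V\<^esub> linear_extension V f y"
      by simp
  next
    fix x y a assume xy: "x \<in> carrier (free_space B)"
    let ?A = "Poly_Mapping.keys x"
    have A: "?A \<subseteq> B" "finite ?A" using xy by auto
    have "linear_extension V f (Poly_Mapping.map ((*) a) x) = (\<Oplus>\<^bsub>V\<^esub>b\<in>?A. (a * Poly_Mapping.lookup x b) \<odot>\<^bsub>V\<^esub> f b)"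
      using A keys_map_times[of a x] by (subst e[of ?A]) auto
    also have "\<dots> = (\<Oplus>\<^bsub>V\<^esub>b\<in>?A. a \<odot>\<^bsub>V\<^esub> (Poly_Mapping.lookup x b \<odot>\<^bsub>V\<^esub> f b))"
      using assms A by (intro V.finsum_cong') (auto simp: smult_mult_left[OF assms(1)] Pi_iff subset_iff)
    also have "\<dots> = a \<odot>\<^bsub>V\<^esub> linear_extension V f x"
      using A cl[OF A(1)] by (subst V.finsum_smult_ldistr[symmetric]) (auto simp: e[OF A(2) _ A(1)])
    finally show "linear_extension V f (a \<odot>\<^bsub>free_space B\<^esub> x) = a \<odot>\<^bsub>V\<^esub> linear_extension V f x"
      by simp
  next
    fix x assume "x \<in> carrier (free_space B)"
    then show "linear_extension V f x \<in> carrier V"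
      unfolding linear_extension_def using cl by (intro V.finsum_closed) auto
  qed
qed

lemma linear_extension_single:
  assumes "cspace V" "f b \<in> carrier V"
  shows "linear_extension V f (Poly_Mapping.single b a) = a \<odot>\<^bsub>V\<^esub> f b"
proof -
  interpret V: module complex_ring V by fact
  show ?thesis
    using assms by (subst linear_extension_eq[of V f "{b}"]) (auto simp: V.finsum_insert)
qed

text \<open>By expansion in the basis. Most identities between linear maps below are reduced to basis vectors
  with this lemma.\<close>

lemma linear_map_free_space_eqI:
  assumes "cspace V" "linear_map (free_space B) V f" "linear_map (free_space B) V g"
    and "\<And>b. b \<in> B \<Longrightarrow> f (Poly_Mapping.single b 1) = g (Poly_Mapping.single b 1)"
    and "x \<in> carrier (free_space B)"
  shows "f x = g x"
proof -
  interpret V: module complex_ring V by fact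
  have *: "h x = (\<Oplus>\<^bsub>V\<^esub>b\<in>Poly_Mapping.keys x. Poly_Mapping.lookup x b \<odot>\<^bsub>V\<^esub> h (Poly_Mapping.single b 1))"
    if h: "linear_map (free_space B) V h" for h
  proof -
    let ?s = "\<lambda>b. Poly_Mapping.lookup x b \<odot>\<^bsub>free_space B\<^esub> Poly_Mapping.single b 1"
    have c: "?s \<in> Poly_Mapping.keys x \<rightarrow> carrier (free_space B)"
      using assms(5) by (auto split: if_splits)
    have "finsum (free_space B) ?s (Poly_Mapping.keys x) = x"
      using c by (subst finsum_free_space) (auto simp: sum_single_lookup)
    then have "h x = h (finsum (free_space B) ?s (Poly_Mapping.keys x))" by simp
    also have "\<dots> = (\<Oplus>\<^bsub>V\<^esub>b\<in>Poly_Mapping.keys x. h (?s b))"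
      by (rule linear_map_finsum[OF cspace_free_space assms(1) h _ c]) simp
    also have "\<dots> = (\<Oplus>\<^bsub>V\<^esub>b\<in>Poly_Mapping.keys x. Poly_Mapping.lookup x b \<odot>\<^bsub>V\<^esub> h (Poly_Mapping.single b 1))"
    proof (rule V.finsum_cong'[OF refl])
      have b: "Poly_Mapping.single b 1 \<in> carrier (free_space B)" if "b \<in> Poly_Mapping.keys x" for b
        using that assms(5) by auto
      show "(\<lambda>b. Poly_Mapping.lookup x b \<odot>\<^bsub>V\<^esub> h (Poly_Mapping.single b 1)) \<in> Poly_Mapping.keys x \<rightarrow> carrier V"
        using linear_map_closed[OF h b] by auto
      show "h (?s b) = Poly_Mapping.lookup x b \<odot>\<^bsub>V\<^esub> h (Poly_Mapping.single b 1)" if "b \<in> Poly_Mapping.keys x" for b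
        by (rule linear_map_smult[OF h b[OF that]])
    qed
    finally show ?thesis .
  qed
  have "(\<Oplus>\<^bsub>V\<^esub>b\<in>Poly_Mapping.keys x. Poly_Mapping.lookup x b \<odot>\<^bsub>V\<^esub> f (Poly_Mapping.single b 1))
      = (\<Oplus>\<^bsub>V\<^esub>b\<in>Poly_Mapping.keys x. Poly_Mapping.lookup x b \<odot>\<^bsub>V\<^esub> g (Poly_Mapping.single b 1))"
    using assms(4,5) linear_map_closed[OF assms(3)]
    by (intro V.finsum_cong') (auto intro!: smult_in_carrier[OF assms(1)])
  then show ?thesis using *[OF assms(2)] *[OF assms(3)] by simp
qed

text \<open>The one-dimensional space, the target of coordinate functionals: with it the universal properties
  of quotients and tensor products apply to functionals as well.\<close>

definition complex_line :: "(complex, complex) module" where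
  "complex_line = \<lparr>carrier = UNIV, monoid.mult = (*), one = 1, zero = 0, add = (+), module.smult = (*)\<rparr>"

lemma complex_line_simps [simp]:
  "carrier complex_line = UNIV" "add complex_line = (+)" "zero complex_line = 0" "module.smult complex_line = (*)"
  by (simp_all add: complex_line_def)

lemma cspace_complex_line: "cspace complex_line"
proof (intro moduleI cring_complex_ring)
  show "abelian_group complex_line"
    by (rule abelian_groupI) (auto simp: algebra_simps intro: exI[of _ "- _"])
qed (auto simp: algebra_simps)

lemma linear_map_lookup: "linear_map (free_space UNIV) complex_line (\<lambda>x. Poly_Mapping.lookup x k)"
  by (simp add: linear_map_def lookup_add)

lemma linear_map_smult_vector:
  assumes "cspace V" "v \<in> carrier V"
  shows "linear_map complex_line V (\<lambda>a. a \<odot>\<^bsub>V\<^esub> v)"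
  by (rule linear_mapI)
    (use assms in \<open>auto simp: smult_in_carrier smult_add_left smult_mult_left\<close>)

section \<open>Tensor products of vector spaces\<close>

definition bilinear_map where
  "bilinear_map V W P g \<longleftrightarrow> (\<forall>v\<in>carrier V. linear_map W P (g v)) \<and> (\<forall>w\<in>carrier W. linear_map V P (\<lambda>v. g v w))"

lemma tensor_relations_subset:
  assumes "cspace V" "cspace W"
  shows "tensor_relations V W \<subseteq> carrier (free_space (carrier V \<times> carrier W))"
proof -
  interpret V: module complex_ring V by fact
  interpret W: module complex_ring W by fact
  have d: "x - y \<in> carrier (free_space A)"
    if "x \<in> carrier (free_space A)" "y \<in> carrier (free_space A)" for x y and A :: "('a \<times> 'c) set"
    using that keys_diff[of x y] by auto
  show ?thesis
    unfolding tensor_relations_def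
    by (auto simp del: free_space_simps intro!: d single_in_free_space
        smult_in_carrier[OF assms(1)] smult_in_carrier[OF assms(2)])
qed

lemma submodule_tensor_kernel:
  assumes "cspace V" "cspace W"
  shows "submodule (tensor_kernel V W) complex_ring (free_space (carrier V \<times> carrier W))"
  unfolding tensor_kernel_def
  by (intro submodule_generated cspace_free_space tensor_relations_subset assms)

lemma cspace_tensor_space:
  "cspace V \<Longrightarrow> cspace W \<Longrightarrow> cspace (tensor_space V W)"
  unfolding tensor_space_def by (intro cspace_quotient cspace_free_space submodule_tensor_kernel)

lemma linear_map_diff:
  assumes "linear_map (free_space B) P f" "cspace P" "x \<in> carrier (free_space B)" "y \<in> carrier (free_space B)"
  shows "f (x - y) = f x \<ominus>\<^bsub>P\<^esub> f y"
proof -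
  interpret P: module complex_ring P by fact
  interpret F: module complex_ring "free_space B" by (rule cspace_free_space)
  have "\<ominus>\<^bsub>free_space B\<^esub> y = - y"
    using assms by (intro F.minus_equality) auto
  then have "f (x - y) = f (x \<oplus>\<^bsub>free_space B\<^esub> \<ominus>\<^bsub>free_space B\<^esub> y)" by simp
  also have "\<dots> = f x \<oplus>\<^bsub>P\<^esub> f (\<ominus>\<^bsub>free_space B\<^esub> y)"
    by (rule linear_map_add[OF assms(1,3) F.a_inv_closed[OF assms(4)]])
  also have "f (\<ominus>\<^bsub>free_space B\<^esub> y) = \<ominus>\<^bsub>P\<^esub> f y"
    by (rule linear_map_neg[OF cspace_free_space assms(2,1,4)])
  finally show ?thesis by (simp add: P.minus_eq)
qed

text \<open>Each of the four families of relations is killed by one of the four identities that make up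
  bilinearity.\<close>

lemma linear_extension_tensor_relations:
  assumes "cspace V" "cspace W" "cspace P" "bilinear_map V W P g"
  shows "linear_extension P (\<lambda>(v, w). g v w) ` tensor_kernel V W \<subseteq> {\<zero>\<^bsub>P\<^esub>}"
proof -
  interpret V: module complex_ring V by fact
  interpret W: module complex_ring W by fact
  interpret P: module complex_ring P by fact
  let ?g = "\<lambda>(v, w). g v w"
  let ?F = "free_space (carrier V \<times> carrier W)"
  have lv: "linear_map V P (\<lambda>v. g v w)" if "w \<in> carrier W" for w
    using assms that by (auto simp: bilinear_map_def)
  have lw: "linear_map W P (g v)" if "v \<in> carrier V" for v
    using assms that by (auto simp: bilinear_map_def)
  have cl: "g v w \<in> carrier P" if "v \<in> carrier V" "w \<in> carrier W" for v w
    using linear_map_closed[OF lw[OF that(1)] that(2)] .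
  have lin: "linear_map ?F P (linear_extension P ?g)"
    using cl by (intro linear_map_linear_extension assms) auto
  have single: "linear_extension P ?g (Poly_Mapping.single (v, w) a) = a \<odot>\<^bsub>P\<^esub> g v w"
    if "v \<in> carrier V" "w \<in> carrier W" for v w a
    using linear_extension_single[OF assms(3), of ?g "(v, w)" a] cl that by simp
  have diff: "linear_extension P ?g (x - y) = linear_extension P ?g x \<ominus>\<^bsub>P\<^esub> linear_extension P ?g y"
    if "x \<in> carrier ?F" "y \<in> carrier ?F" for x y
    using linear_map_diff[OF lin assms(3) that] .
  have dcl: "x - y \<in> carrier ?F" if "x \<in> carrier ?F" "y \<in> carrier ?F" for x y
    using that keys_diff[of x y] by auto
  have z: "(x \<oplus>\<^bsub>P\<^esub> y) \<ominus>\<^bsub>P\<^esub> x \<ominus>\<^bsub>P\<^esub> y = \<zero>\<^bsub>P\<^esub>" if "x \<in> carrier P" "y \<in> carrier P" for x y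
    using P.r_neg[of "x \<oplus>\<^bsub>P\<^esub> y"] that by (simp add: P.minus_eq P.minus_add P.a_ac)
  have z': "x \<ominus>\<^bsub>P\<^esub> x = \<zero>\<^bsub>P\<^esub>" if "x \<in> carrier P" for x
    using that by (simp add: P.minus_eq P.r_neg)
  have "linear_extension P ?g ` tensor_relations V W \<subseteq> {\<zero>\<^bsub>P\<^esub>}"
    unfolding tensor_relations_def
    by (auto simp del: free_space_simps
        simp: diff dcl single_in_free_space single cl z smult_one_left[OF assms(3)] z'
        linear_map_add[OF lv] linear_map_add[OF lw] linear_map_smult[OF lv] linear_map_smult[OF lw]
        smult_in_carrier[OF assms(1)] smult_in_carrier[OF assms(2)] smult_in_carrier[OF assms(3)])
  then show ?thesis
    unfolding tensor_kernel_def
    using linear_map_generated_submodule[OF cspace_free_space assms(3) lin tensor_relations_subset[OF assms(1,2)]]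
    by blast
qed

lemma bilinear_map_closed:
  "\<lbrakk>bilinear_map V W P g; v \<in> carrier V; w \<in> carrier W\<rbrakk> \<Longrightarrow> g v w \<in> carrier P"
  by (auto simp: bilinear_map_def dest: linear_map_closed)

lemma linear_map_tensor_lift:
  assumes "cspace V" "cspace W" "cspace P" "bilinear_map V W P g"
  shows "linear_map (tensor_space V W) P (tensor_lift P g)"
  unfolding tensor_space_def tensor_lift_def
  by (rule linear_map_the_elem[OF cspace_free_space assms(3) submodule_tensor_kernel[OF assms(1,2)]
        linear_map_linear_extension[OF assms(3)] linear_extension_tensor_relations[OF assms]])
    (auto intro: bilinear_map_closed[OF assms(4)])

lemma tensor_lift_pure_tensor:
  assumes "cspace V" "cspace W" "cspace P" "bilinear_map V W P g" "v \<in> carrier V" "w \<in> carrier W"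
  shows "tensor_lift P g (pure_tensor V W v w) = g v w"
proof -
  let ?g = "\<lambda>(v, w). g v w"
  have "tensor_lift P g (pure_tensor V W v w) = linear_extension P ?g (Poly_Mapping.single (v, w) 1)"
    unfolding tensor_lift_def pure_tensor_def
    by (rule the_elem_coset[OF cspace_free_space assms(3) submodule_tensor_kernel[OF assms(1,2)]
        linear_map_linear_extension[OF assms(3)] linear_extension_tensor_relations[OF assms(1-4)]])
      (use assms in \<open>auto intro: bilinear_map_closed[OF assms(4)]\<close>)
  also have "\<dots> = g v w"
    using linear_extension_single[OF assms(3), of ?g "(v, w)" 1] bilinear_map_closed[OF assms(4-6)]
    by (simp add: smult_one_left[OF assms(3)])
  finally show ?thesis .
qed

lemma bilinear_map_pure_tensor:
  assumes "cspace V" "cspace W"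
  shows "bilinear_map V W (tensor_space V W) (pure_tensor V W)"
proof -
  interpret V: module complex_ring V by fact
  interpret W: module complex_ring W by fact
  let ?F = "free_space (carrier V \<times> carrier W)"
  let ?K = "tensor_kernel V W"
  interpret F: module complex_ring ?F by (rule cspace_free_space)
  note K = cspace_free_space[of "carrier V \<times> carrier W"] submodule_tensor_kernel[OF assms]
  have rel: "tensor_relations V W \<subseteq> ?K"
    unfolding tensor_kernel_def by (rule generated_submodule_superset)
  have eqI: "?K +>\<^bsub>?F\<^esub> x = ?K +>\<^bsub>?F\<^esub> y" if "x - y \<in> tensor_relations V W" "x \<in> carrier ?F" "y \<in> carrier ?F" for x y
  proof -
    have "\<ominus>\<^bsub>?F\<^esub> y = - y"
      using that by (intro F.minus_equality) auto
    then show ?thesis using coset_eq_iff[OF K that(2,3)] that rel by auto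
  qed
  have fadd: "pure_tensor V W v w \<oplus>\<^bsub>tensor_space V W\<^esub> pure_tensor V W v' w'
      = ?K +>\<^bsub>?F\<^esub> (Poly_Mapping.single (v, w) 1 + Poly_Mapping.single (v', w') 1)"
    if "v \<in> carrier V" "w \<in> carrier W" "v' \<in> carrier V" "w' \<in> carrier W" for v v' w w'
    using coset_add[OF K, of "Poly_Mapping.single (v, w) 1" "Poly_Mapping.single (v', w') 1"] that
    unfolding pure_tensor_def tensor_space_def by simp
  have fsmult: "a \<odot>\<^bsub>tensor_space V W\<^esub> pure_tensor V W v w = ?K +>\<^bsub>?F\<^esub> Poly_Mapping.single (v, w) a"
    if "v \<in> carrier V" "w \<in> carrier W" for v w a
    using coset_smult[OF K, of "Poly_Mapping.single (v, w) 1" a] that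
    unfolding pure_tensor_def tensor_space_def by simp
  have cl: "pure_tensor V W v w \<in> carrier (tensor_space V W)" if "v \<in> carrier V" "w \<in> carrier W" for v w
    using that unfolding pure_tensor_def tensor_space_def by (auto intro!: coset_in_rcosets)
  have sum: "x + y \<in> carrier ?F" if "x \<in> carrier ?F" "y \<in> carrier ?F" for x y
    using F.a_closed[OF that] by simp
  show ?thesis
    unfolding bilinear_map_def
  proof (intro conjI ballI linear_mapI)
    fix v w v' assume *: "v \<in> carrier V" "w \<in> carrier W" "v' \<in> carrier V"
    show "pure_tensor V W (v \<oplus>\<^bsub>V\<^esub> v') w = pure_tensor V W v w \<oplus>\<^bsub>tensor_space V W\<^esub> pure_tensor V W v' w"
      unfolding fadd[OF *(1,2,3,2)] unfolding pure_tensor_def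
    proof (rule eqI)
      show "Poly_Mapping.single (v \<oplus>\<^bsub>V\<^esub> v', w) 1 - (Poly_Mapping.single (v, w) 1 + Poly_Mapping.single (v', w) 1)
          \<in> tensor_relations V W"
        unfolding tensor_relations_def diff_diff_eq[symmetric] using * by blast
    qed (use * in \<open>auto intro!: sum single_in_free_space simp del: free_space_simps\<close>)
  next
    fix v w w' assume *: "v \<in> carrier V" "w \<in> carrier W" "w' \<in> carrier W"
    show "pure_tensor V W v (w \<oplus>\<^bsub>W\<^esub> w') = pure_tensor V W v w \<oplus>\<^bsub>tensor_space V W\<^esub> pure_tensor V W v w'"
      unfolding fadd[OF *(1,2,1,3)] unfolding pure_tensor_def
    proof (rule eqI)
      show "Poly_Mapping.single (v, w \<oplus>\<^bsub>W\<^esub> w') 1 - (Poly_Mapping.single (v, w) 1 + Poly_Mapping.single (v, w') 1)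
          \<in> tensor_relations V W"
        unfolding tensor_relations_def diff_diff_eq[symmetric] using * by blast
    qed (use * in \<open>auto intro!: sum single_in_free_space simp del: free_space_simps\<close>)
  next
    fix v w a assume *: "v \<in> carrier V" "w \<in> carrier W"
    show "pure_tensor V W (a \<odot>\<^bsub>V\<^esub> v) w = a \<odot>\<^bsub>tensor_space V W\<^esub> pure_tensor V W v w"
      unfolding fsmult[OF *] unfolding pure_tensor_def
    proof (rule eqI)
      show "Poly_Mapping.single (a \<odot>\<^bsub>V\<^esub> v, w) 1 - Poly_Mapping.single (v, w) a \<in> tensor_relations V W"
        unfolding tensor_relations_def using * by blast
    qed (use * in \<open>auto intro!: single_in_free_space smult_in_carrier[OF assms(1)] simp del: free_space_simps\<close>)
    show "pure_tensor V W v (a \<odot>\<^bsub>W\<^esub> w) = a \<odot>\<^bsub>tensor_space V W\<^esub> pure_tensor V W v w"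
      unfolding fsmult[OF *] unfolding pure_tensor_def
    proof (rule eqI)
      show "Poly_Mapping.single (v, a \<odot>\<^bsub>W\<^esub> w) 1 - Poly_Mapping.single (v, w) a \<in> tensor_relations V W"
        unfolding tensor_relations_def using * by blast
    qed (use * in \<open>auto intro!: single_in_free_space smult_in_carrier[OF assms(2)] simp del: free_space_simps\<close>)
  qed (auto intro: cl)
qed

text \<open>The classes of the basis vectors of the free space are the pure tensors, hence these span.\<close>

lemma tensor_map_eqI:
  assumes "cspace V" "cspace W" "cspace P" "linear_map (tensor_space V W) P f" "linear_map (tensor_space V W) P g"
    and "\<And>v w. \<lbrakk>v \<in> carrier V; w \<in> carrier W\<rbrakk> \<Longrightarrow> f (pure_tensor V W v w) = g (pure_tensor V W v w)"
    and "x \<in> carrier (tensor_space V W)"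
  shows "f x = g x"
proof -
  let ?F = "free_space (carrier V \<times> carrier W)"
  let ?q = "\<lambda>y. tensor_kernel V W +>\<^bsub>?F\<^esub> y"
  have q: "linear_map ?F (tensor_space V W) ?q"
    unfolding tensor_space_def by (intro linear_map_coset cspace_free_space submodule_tensor_kernel assms)
  from assms(7) obtain y where y: "y \<in> carrier ?F" "x = ?q y"
    unfolding tensor_space_def quotient_space_simps mem_a_rcosets_iff by auto
  have "f (?q y) = g (?q y)"
  proof (rule linear_map_free_space_eqI[OF assms(3) _ _ _ y(1)])
    show "linear_map ?F P (\<lambda>y. f (?q y))" "linear_map ?F P (\<lambda>y. g (?q y))"
      using linear_map_comp q assms by blast+
    show "f (?q (Poly_Mapping.single b 1)) = g (?q (Poly_Mapping.single b 1))" if "b \<in> carrier V \<times> carrier W" for b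
      using that assms(6) unfolding pure_tensor_def by auto
  qed
  then show ?thesis using y by simp
qed

section \<open>Finite differences\<close>

definition alt_binomial :: "nat \<Rightarrow> nat \<Rightarrow> complex" where
  "alt_binomial s i = (- 1) ^ i * of_nat (s choose i)"

text \<open>The absorption identity \<open>i (s choose i) = s (s - 1 choose i - 1)\<close> lowers the exponent and the order
  of the difference at the same time, down to the alternating sum of a row of binomial coefficients.\<close>

lemma sum_alt_binomial_power:
  assumes "j \<le> s"
  shows "(\<Sum>i\<le>s. alt_binomial s i * (x + of_nat i) ^ j) = (if j = s then (- 1) ^ s * fact s else 0)"
  using assms
proof (induction j arbitrary: s x)
  case 0
  then show ?case
    using choose_alternating_sum[of s, where ?'a = complex] by (cases "s = 0") (auto simp: alt_binomial_def)
next
  case (Suc j)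
  then obtain t where s: "s = Suc t" by (cases s) auto
  have "(\<Sum>i\<le>s. alt_binomial s i * (x + of_nat i) ^ Suc j)
      = x * (\<Sum>i\<le>s. alt_binomial s i * (x + of_nat i) ^ j) + (\<Sum>i\<le>s. of_nat i * alt_binomial s i * (x + of_nat i) ^ j)"
    by (simp add: algebra_simps sum.distrib sum_distrib_left)
  also have "(\<Sum>i\<le>s. of_nat i * alt_binomial s i * (x + of_nat i) ^ j)
      = (\<Sum>i\<le>t. of_nat (Suc i) * alt_binomial s (Suc i) * (x + of_nat (Suc i)) ^ j)"
    unfolding s by (subst sum.atMost_Suc_shift) simp
  also have "\<dots> = (\<Sum>i\<le>t. - of_nat s * (alt_binomial t i * ((x + 1) + of_nat i) ^ j))"
  proof (rule sum.cong)
    fix i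
    have "of_nat (Suc i) * of_nat (s choose Suc i) = (of_nat s * of_nat (t choose i) :: complex)"
      using Suc_times_binomial_eq[of t i] unfolding s of_nat_mult[symmetric] by (simp only: mult.commute)
    then have "of_nat (Suc i) * alt_binomial s (Suc i) = - of_nat s * alt_binomial t i"
      unfolding alt_binomial_def by (simp only: power_Suc mult.left_commute[of "of_nat (Suc i)"]) (simp add: mult_ac)
    then show "of_nat (Suc i) * alt_binomial s (Suc i) * (x + of_nat (Suc i)) ^ j
        = - of_nat s * (alt_binomial t i * ((x + 1) + of_nat i) ^ j)"
      by (simp only: mult.assoc[symmetric]) (simp add: add_ac)
  qed simp
  also have "\<dots> = - of_nat s * (if j = t then (- 1) ^ t * fact t else 0)"
    unfolding sum_distrib_left[symmetric] using Suc s by (subst Suc.IH) auto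
  also have "(\<Sum>i\<le>s. alt_binomial s i * (x + of_nat i) ^ j) = 0"
    using Suc s by (subst Suc.IH) auto
  finally have "(\<Sum>i\<le>s. alt_binomial s i * (x + of_nat i) ^ Suc j)
      = - of_nat s * (if j = t then (- 1) ^ t * fact t else 0)" by simp
  then show ?case unfolding s by (simp only: fact_Suc power_Suc) (simp add: mult_ac del: of_nat_Suc)
qed

lemma sum_alt_binomial_poly:
  assumes "degree p \<le> s"
  shows "(\<Sum>i\<le>s. alt_binomial s i * poly p (x + of_nat i)) = (- 1) ^ s * fact s * coeff p s"
proof -
  have p: "poly p y = (\<Sum>j\<le>s. coeff p j * y ^ j)" for y
    unfolding poly_altdef using assms by (intro sum.mono_neutral_left) (auto simp: coeff_eq_0)
  have "(\<Sum>i\<le>s. alt_binomial s i * poly p (x + of_nat i))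
      = (\<Sum>i\<le>s. \<Sum>j\<le>s. coeff p j * (alt_binomial s i * (x + of_nat i) ^ j))"
    unfolding p sum_distrib_left by (simp add: mult_ac)
  also have "\<dots> = (\<Sum>j\<le>s. coeff p j * (\<Sum>i\<le>s. alt_binomial s i * (x + of_nat i) ^ j))"
    by (subst sum.swap) (simp add: sum_distrib_left)
  also have "\<dots> = (\<Sum>j\<le>s. if j = s then coeff p s * ((- 1) ^ s * fact s) else 0)"
    by (intro sum.cong refl, subst sum_alt_binomial_power) auto
  also have "\<dots> = (- 1) ^ s * fact s * coeff p s"
    by simp
  finally show ?thesis .
qed

lemma sum_alt_binomial_poly_zero:
  assumes "degree p < s"
  shows "(\<Sum>i\<le>s. alt_binomial s i * poly p (x + of_nat i)) = 0"
  using sum_alt_binomial_poly[of p s x] assms by (simp add: coeff_eq_0)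

lemma sum_alt_binomial_geometric:
  "(\<Sum>i\<le>s. alt_binomial s i * q ^ i) = (1 - q) ^ s"
proof -
  have "(1 - q) ^ s = (- q + 1) ^ s" by simp
  also have "\<dots> = (\<Sum>i\<le>s. of_nat (s choose i) * (- q) ^ i * 1 ^ (s - i))"
    by (rule binomial_ring)
  also have "\<dots> = (\<Sum>i\<le>s. alt_binomial s i * q ^ i)"
    by (intro sum.cong refl) (simp add: alt_binomial_def power_minus[of q])
  finally show ?thesis by simp
qed

text \<open>The form in which quadratic coefficients occur in the intermediate series and in \<open>E\<^sub>h\<close>.\<close>

lemma sum_alt_binomial_quadratic:
  assumes "s > 2"
  shows "(\<Sum>i\<le>s. alt_binomial s i * ((a + b * (m + of_nat i)) * (c + e * (m + of_nat i)))) = 0"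
proof -
  have "degree ([:a, b:] * [:c, e:]) \<le> 2"
    by (rule order_trans[OF degree_mult_le]) simp
  then show ?thesis
    using sum_alt_binomial_poly_zero[of "[:a, b:] * [:c, e:]" s m] assms
    by (simp only: poly_mult poly_pCons poly_0) (simp add: mult.commute[of "m + of_nat _"])
qed

section \<open>The difference order of a Virasoro module\<close>

text \<open>Up to sign, this is the \<open>s\<close>-th finite difference of the word \<open>d\<^bsub>l-m\<^esub> d\<^bsub>m\<^esub>\<close>, as a function of \<open>m\<close>.\<close>

definition quad_difference ::
    "(vir, 'v, 'x) lie_mod_scheme \<Rightarrow> nat \<Rightarrow> int \<Rightarrow> int \<Rightarrow> 'v \<Rightarrow> 'v" where
  "quad_difference V s l m x = (\<Oplus>\<^bsub>V\<^esub>i\<in>{..s}. alt_binomial s i \<odot>\<^bsub>V\<^esub>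
     act V (vir_d (l - m - int i)) (act V (vir_d (m + int i)) x))"

text \<open>The part of a module structure on which differences of words depend.\<close>

definition vir_linear :: "(vir, 'v, 'x) lie_mod_scheme \<Rightarrow> bool" where
  "vir_linear V \<longleftrightarrow> cspace V \<and> (\<forall>i. linear_map V V (act V (vir_d i)))"

text \<open>The model case is a module on which \<open>d\<^bsub>l-m\<^esub> d\<^bsub>m\<^esub>\<close> is polynomial of degree \<open>s\<close> in \<open>m\<close> with an injective
  top coefficient.\<close>

definition difference_order :: "(vir, 'v, 'x) lie_mod_scheme \<Rightarrow> nat \<Rightarrow> bool" where
  "difference_order V s \<longleftrightarrow>
     (\<forall>l m. \<forall>x\<in>carrier V. quad_difference V (Suc s) l m x = \<zero>\<^bsub>V\<^esub>) \<and>
     (\<forall>l m. \<forall>x\<in>carrier V. quad_difference V s l m x = \<zero>\<^bsub>V\<^esub> \<longrightarrow> x = \<zero>\<^bsub>V\<^esub>)"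

lemma vir_linear_closed: "vir_linear V \<Longrightarrow> x \<in> carrier V \<Longrightarrow> act V (vir_d i) x \<in> carrier V"
  unfolding vir_linear_def using linear_map_closed by fast

lemma vir_linear_cspace: "vir_linear V \<Longrightarrow> cspace V"
  and vir_linear_act: "vir_linear V \<Longrightarrow> linear_map V V (act V (vir_d i))"
  unfolding vir_linear_def by auto

text \<open>Compatibility with the action is asked for only at the indices that occur: the embedding
  \<open>w \<mapsto> v \<otimes> w\<close>, to which this is applied later, commutes with \<open>d\<^bsub>i\<^esub>\<close> only for \<open>i \<noteq> 0\<close>.\<close>

lemma linear_map_quad_difference:
  assumes "vir_linear V" "vir_linear W" "linear_map V W f" "x \<in> carrier V"
    and "\<And>i y. \<lbrakk>i \<le> s; y \<in> carrier V\<rbrakk> \<Longrightarrow> f (act V (vir_d (m + int i)) y) = act W (vir_d (m + int i)) (f y)"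
    and "\<And>i y. \<lbrakk>i \<le> s; y \<in> carrier V\<rbrakk> \<Longrightarrow> f (act V (vir_d (l - m - int i)) y) = act W (vir_d (l - m - int i)) (f y)"
  shows "f (quad_difference V s l m x) = quad_difference W s l m (f x)"
proof -
  interpret W: module complex_ring W using assms(2) by (rule vir_linear_cspace)
  let ?d = "\<lambda>i. act V (vir_d (l - m - int i)) (act V (vir_d (m + int i)) x)"
  have d: "?d i \<in> carrier V" for i
    using assms(1,4) by (intro vir_linear_closed)
  have "f (quad_difference V s l m x) = (\<Oplus>\<^bsub>W\<^esub>i\<in>{..s}. f (alt_binomial s i \<odot>\<^bsub>V\<^esub> ?d i))"
    unfolding quad_difference_def using d smult_in_carrier[OF vir_linear_cspace[OF assms(1)]]
    by (intro linear_map_finsum[OF vir_linear_cspace[OF assms(1)] vir_linear_cspace[OF assms(2)] assms(3)]) auto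
  also have "\<dots> = quad_difference W s l m (f x)"
    unfolding quad_difference_def
    by (rule W.finsum_cong')
      (use assms d in \<open>auto simp: linear_map_smult[OF assms(3)] vir_linear_closed
        intro!: smult_in_carrier[OF vir_linear_cspace[OF assms(2)]] linear_map_closed[OF assms(3)]
          vir_linear_closed[OF assms(2)]\<close>)
  finally show ?thesis .
qed

lemma virasoro_carrier [simp]: "carrier virasoro = UNIV"
  by (simp add: virasoro_def Let_def module.defs)

lemma difference_order_isomorphic:
  assumes "vir_linear V" "vir_linear W" "lie_module_isomorphic virasoro V W" "difference_order V s"
  shows "difference_order W s"
proof -
  from assms(3) obtain f where bij: "bij_betw f (carrier V) (carrier W)"
    and add: "\<forall>v\<in>carrier V. \<forall>w\<in>carrier V. f (v \<oplus>\<^bsub>V\<^esub> w) = f v \<oplus>\<^bsub>W\<^esub> f w"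
    and smult: "\<forall>a. \<forall>v\<in>carrier V. f (a \<odot>\<^bsub>V\<^esub> v) = a \<odot>\<^bsub>W\<^esub> f v"
    and act: "\<forall>x. \<forall>v\<in>carrier V. f (act V x v) = act W x (f v)"
    unfolding lie_module_isomorphic_def by auto
  have f: "linear_map V W f"
    using bij add smult by (auto simp: linear_map_def bij_betw_def)
  interpret V: module complex_ring V using assms(1) by (rule vir_linear_cspace)
  have f0: "f \<zero>\<^bsub>V\<^esub> = \<zero>\<^bsub>W\<^esub>"
    using assms f by (simp add: linear_map_zero vir_linear_cspace)
  have q: "f (quad_difference V t l m x) = quad_difference W t l m (f x)" if "x \<in> carrier V" for t l m x
    using linear_map_quad_difference[OF assms(1,2) f that] act by blast
  have cl: "quad_difference V t l m x \<in> carrier V" if "x \<in> carrier V" for t l m x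
    unfolding quad_difference_def using that vir_linear_closed[OF assms(1)]
      smult_in_carrier[OF vir_linear_cspace[OF assms(1)]] by (intro V.finsum_closed) auto
  have inj: "x = \<zero>\<^bsub>V\<^esub>" if "f x = \<zero>\<^bsub>W\<^esub>" "x \<in> carrier V" for x
    using that f0 bij by (metis V.zero_closed bij_betw_inv_into_left)
  have surj: "\<exists>x\<in>carrier V. y = f x" if "y \<in> carrier W" for y
    using that bij by (auto simp: bij_betw_def)
  show ?thesis
    unfolding difference_order_def
  proof (intro conjI allI ballI impI)
    fix l m y assume "y \<in> carrier W"
    then obtain x where x: "x \<in> carrier V" "y = f x" using surj by blast
    show "quad_difference W (Suc s) l m y = \<zero>\<^bsub>W\<^esub>"
      using assms(4) x f0 by (simp add: difference_order_def flip: q)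
    show "y = \<zero>\<^bsub>W\<^esub>" if "quad_difference W s l m y = \<zero>\<^bsub>W\<^esub>"
    proof -
      have "quad_difference V s l m x = \<zero>\<^bsub>V\<^esub>"
        using that x cl q inj by metis
      then show ?thesis
        using assms(4) x f0 unfolding difference_order_def by metis
    qed
  qed
qed

section \<open>Constructions of Virasoro modules\<close>

lemma extend_simps [simp]:
  "carrier (module.extend V z) = carrier V" "add (module.extend V z) = add V"
  "zero (module.extend V z) = zero V" "module.smult (module.extend V z) = module.smult V"
  by (simp_all add: module.defs)

lemma act_extend [simp]: "act (module.extend V (lie_mod.fields g)) = g"
  by (simp add: module.defs lie_mod.defs)

lemma cspace_extend [simp]: "cspace V \<Longrightarrow> cspace (module.extend V z)"
  by (erule cspace_cong) simp_all

lemma linear_map_extend [simp]: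
  "linear_map (module.extend V z) W f = linear_map V W f"
  "linear_map W' (module.extend V z) g = linear_map W' V g"
  by (simp_all add: linear_map_def)

lemma vir_module_simps [simp]:
  "carrier (vir_module V dd cc) = carrier V" "add (vir_module V dd cc) = add V"
  "zero (vir_module V dd cc) = zero V" "module.smult (vir_module V dd cc) = module.smult V"
  by (simp_all add: vir_module_def)

lemma act_vir_module:
  assumes "cspace V" "dd i v \<in> carrier V"
  shows "act (vir_module V dd cc) (vir_d i) v = dd i v"
  unfolding vir_module_def vir_d_def act_extend
  using assms linear_extension_single[of V "\<lambda>p. case p of C \<Rightarrow> cc v | D i \<Rightarrow> dd i v" "D i" 1]
  by (simp add: smult_one_left)

lemma linear_map_cong:
  assumes "linear_map V W f" "\<And>x. x \<in> carrier V \<Longrightarrow> f x = g x" "cspace V"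
  shows "linear_map V W g"
proof -
  interpret V: module complex_ring V by fact
  show ?thesis
    using assms smult_in_carrier[OF assms(3)] by (auto simp: linear_map_def Pi_iff)
qed

lemma vir_linear_vir_module:
  assumes "cspace V" "\<And>i. linear_map V V (dd i)"
  shows "vir_linear (vir_module V dd cc)"
  unfolding vir_linear_def
proof
  show "cspace (vir_module V dd cc)"
    unfolding vir_module_def using assms by simp
  show "\<forall>i. linear_map (vir_module V dd cc) (vir_module V dd cc) (act (vir_module V dd cc) (vir_d i))"
  proof
    fix i
    have "linear_map V V (act (vir_module V dd cc) (vir_d i))"
      by (rule linear_map_cong[OF assms(2) _ assms(1)])
        (simp add: act_vir_module assms linear_map_closed[OF assms(2)])
    then show "linear_map (vir_module V dd cc) (vir_module V dd cc) (act (vir_module V dd cc) (vir_d i))"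
      by (simp add: linear_map_def)
  qed
qed

text \<open>The identity map is linear between the two spaces. As \<open>finsum\<close> takes the whole record as
  its argument, sums over a module and over its underlying space are different terms.\<close>

lemma finsum_same_space:
  assumes "cspace V" "cspace W" "carrier W = carrier V" "add W = add V" "module.smult W = module.smult V"
    "finite A" "g \<in> A \<rightarrow> carrier V"
  shows "finsum W g A = finsum V g A"
proof -
  have "linear_map V W (\<lambda>x. x)" using assms by (simp add: linear_map_def)
  from linear_map_finsum[OF assms(1,2) this assms(6,7)] show ?thesis by simp
qed

lemma vir_linear_quotient:
  assumes "vir_linear V" "submodule S complex_ring V" "\<And>i. act V (vir_d i) ` S \<subseteq> S"
  shows "vir_linear (quotient_lie_module V S)"
    and "x \<in> carrier V \<Longrightarrow> act (quotient_lie_module V S) (vir_d i) (S +>\<^bsub>V\<^esub> x) = S +>\<^bsub>V\<^esub> act V (vir_d i) x"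
    and "carrier (quotient_lie_module V S) = a_rcosets\<^bsub>V\<^esub> S"
    and "zero (quotient_lie_module V S) = S"
    and "linear_map V (quotient_lie_module V S) (\<lambda>x. S +>\<^bsub>V\<^esub> x)"
proof -
  note V = vir_linear_cspace[OF assms(1)]
  note qc = linear_map_coset[OF V assms(2)]
  show ac: "act (quotient_lie_module V S) (vir_d i) (S +>\<^bsub>V\<^esub> x) = S +>\<^bsub>V\<^esub> act V (vir_d i) x"
    if "x \<in> carrier V" for x i
    unfolding quotient_lie_module_def act_extend
    by (rule coset_UNION[OF V assms(2) vir_linear_act[OF assms(1)] assms(3) that])
  show "carrier (quotient_lie_module V S) = a_rcosets\<^bsub>V\<^esub> S" "zero (quotient_lie_module V S) = S"
    by (simp_all add: quotient_lie_module_def)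
  show "linear_map V (quotient_lie_module V S) (\<lambda>x. S +>\<^bsub>V\<^esub> x)"
    unfolding quotient_lie_module_def linear_map_extend by (rule qc)
  have "linear_map (quotient_space V S) (quotient_space V S) (act (quotient_lie_module V S) (vir_d i))" for i
  proof (rule linear_mapI)
    note cl = linear_map_closed[OF vir_linear_act[OF assms(1)]]
    interpret V: module complex_ring V by (rule V)
    fix X assume "X \<in> carrier (quotient_space V S)"
    then obtain x where x: "x \<in> carrier V" "X = S +>\<^bsub>V\<^esub> x" by (auto simp: mem_a_rcosets_iff)
    show "act (quotient_lie_module V S) (vir_d i) X \<in> carrier (quotient_space V S)"
      using x ac[OF x(1)] linear_map_closed[OF qc cl[OF x(1)]] by simp
    show "act (quotient_lie_module V S) (vir_d i) (a \<odot>\<^bsub>quotient_space V S\<^esub> X)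
        = a \<odot>\<^bsub>quotient_space V S\<^esub> act (quotient_lie_module V S) (vir_d i) X" for a
      using x by (simp only: coset_smult[OF V assms(2)] ac smult_in_carrier[OF V] cl linear_map_smult[OF vir_linear_act[OF assms(1)]])
    fix Y assume "Y \<in> carrier (quotient_space V S)"
    then obtain y where y: "y \<in> carrier V" "Y = S +>\<^bsub>V\<^esub> y" by (auto simp: mem_a_rcosets_iff)
    show "act (quotient_lie_module V S) (vir_d i) (X \<oplus>\<^bsub>quotient_space V S\<^esub> Y)
        = act (quotient_lie_module V S) (vir_d i) X \<oplus>\<^bsub>quotient_space V S\<^esub> act (quotient_lie_module V S) (vir_d i) Y"
      using x y by (simp only: coset_add[OF V assms(2)] ac V.a_closed cl linear_map_add[OF vir_linear_act[OF assms(1)]])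
  qed
  then show "vir_linear (quotient_lie_module V S)"
    unfolding vir_linear_def using cspace_quotient[OF V assms(2)]
    by (simp add: quotient_lie_module_def)
qed

text \<open>The simplification rule \<open>single_one\<close> would turn the basis vector with index \<open>0\<close> into the unit of the
  ring of finitely supported functions.\<close>

declare single_one [simp del]

section \<open>The modules \<open>E\<^sub>h(b, \<gamma>, p)\<close>\<close>

lemma quad_difference_free:
  assumes "\<And>i. linear_map (free_space UNIV) (free_space UNIV) (dd i)"
  shows "quad_difference (vir_module (free_space UNIV) dd cc) s l m x
    = (\<Sum>i\<le>s. Poly_Mapping.map ((*) (alt_binomial s i)) (dd (l - m - int i) (dd (m + int i) x)))"
  unfolding quad_difference_def
  by (subst finsum_same_space[of "free_space UNIV"])
    (auto simp: cspace_free_space vir_linear_cspace[OF vir_linear_vir_module] assms finsum_free_space act_vir_module)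

lemma map_add_times: "Poly_Mapping.map ((*) a) (x + y) = Poly_Mapping.map ((*) a) x + Poly_Mapping.map ((*) a) y"
  for a :: complex
  by (rule poly_mapping_eqI) (simp add: lookup_add algebra_simps)

lemma exp_of_int_times: "exp (of_int n * h) = exp h powi n" for h :: complex
  by (simp add: exp_power_int mult.commute)

text \<open>The vector \<open>T\<^sub>0\<^sup>0\<close> is enough. The coefficient of \<open>T\<^sub>l\<^sup>2\<close> in \<open>d\<^bsub>l-m\<^esub> d\<^bsub>m\<^esub> T\<^sub>0\<^sup>0\<close> is \<open>(1 - q\<^sup>m) (1 - q\<^bsup>l-m\<^esup>)\<close> with
  \<open>q = exp h\<close>. A difference annihilates the constant part of it and multiplies \<open>q\<^sup>m\<close> and \<open>q\<^bsup>-m\<^esup>\<close> by powers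
  of \<open>1 - q\<close> and \<open>1 - 1/q\<close>; the two remaining terms depend differently on \<open>l\<close>, which forces \<open>q = 1\<close>. In
  that case \<open>d\<^bsub>n\<^esub> T\<^sub>i\<^sup>0 = (b + i + n p) T\<^bsub>i+n\<^esub>\<^sup>0\<close>, and the coefficients of the words are quadratic.\<close>

lemma E_module_no_difference_order:
  assumes "s > 2" "difference_order (E_module h b \<gamma> p) s"
  shows False
proof -
  let ?V = "free_space UNIV :: (complex, int \<times> nat \<Rightarrow>\<^sub>0 complex) module"
  define e where "e = (\<lambda>n (i, k).
          Poly_Mapping.single (i + n, k + 1) (1 - exp (of_int n * h)) +
          Poly_Mapping.single (i + n, k)
            (b + of_int i + of_int n * (p + \<gamma> - (\<gamma> + of_nat k) * exp (of_int n * h))) -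
          (\<Sum>j<k. Poly_Mapping.single (i + n, j)
            (exp (of_int n * h) * of_int n ^ (k - j + 1) *
              (of_nat (if j = 0 then 0 else k choose (j - 1)) + \<gamma> * of_nat (k choose j)))))"
  define d where "d n = linear_extension ?V (e n)" for n
  have E: "E_module h b \<gamma> p = vir_module ?V d (\<lambda>_. 0)"
    unfolding E_module_def Let_def d_def e_def ..
  have d: "linear_map ?V ?V (d n)" for n
    unfolding d_def by (intro linear_map_linear_extension cspace_free_space) auto
  have d_add: "d n (x + y) = d n x + d n y" for n x y
    using linear_map_add[OF d, of x y n] by simp
  have d_single: "d n (Poly_Mapping.single ik c) = Poly_Mapping.map ((*) c) (e n ik)" for n ik c
    using linear_extension_single[OF cspace_free_space[of UNIV], of "e n" ik c] by (simp add: d_def)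
  let ?x = "Poly_Mapping.single (0, 0) 1 :: int \<times> nat \<Rightarrow>\<^sub>0 complex"
  have zero: "zero (E_module h b \<gamma> p) = 0" and carrier: "?x \<in> carrier (E_module h b \<gamma> p)"
    by (simp_all add: E)
  have Q: "quad_difference (E_module h b \<gamma> p) t l m ?x
      = (\<Sum>i\<le>t. Poly_Mapping.map ((*) (alt_binomial t i)) (d (l - m - int i) (d (m + int i) ?x)))" for t l m
    unfolding E by (rule quad_difference_free[OF d])
  have "quad_difference (E_module h b \<gamma> p) (Suc s) l m ?x = 0" for l m
    using assms(2) carrier unfolding difference_order_def zero by blast
  note vanish = this[unfolded Q]
  have "?x \<noteq> 0"
    by (metis lookup_single_eq lookup_zero zero_neq_one)
  then have "quad_difference (E_module h b \<gamma> p) s l m ?x \<noteq> 0" for l m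
    using assms(2) carrier unfolding difference_order_def zero by blast
  note inj = this[unfolded Q]
  define q where "q = exp h"
  have q0: "q \<noteq> 0" by (simp add: q_def)
  have lookup2: "Poly_Mapping.lookup (d n (d m ?x)) (n + m, 2) = (1 - q powi m) * (1 - q powi n)" for n m
  proof -
    have "d m ?x = Poly_Mapping.single (m, 1) (1 - q powi m) + Poly_Mapping.single (m, 0) (b + of_int m * (p + \<gamma> - \<gamma> * q powi m))"
      by (simp add: d_single e_def exp_of_int_times q_def map_add_times)
    then show ?thesis
      by (simp add: d_add d_single e_def exp_of_int_times lookup_add lookup_minus lookup_single q_def add.commute)
  qed
  have "q = 1"
  proof (rule ccontr)
    assume "q \<noteq> 1"
    let ?S = "Suc s"
    define X Y where "X = (1 - q) ^ ?S" and "Y = (1 - inverse q) ^ ?S"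
    have "X + q powi l * Y = 0" for l
    proof -
      have summand: "Poly_Mapping.lookup (d (l - 0 - int i) (d (0 + int i) ?x)) (l, 2)
          = (1 + q powi l) - q ^ i - q powi l * inverse q ^ i" for i
        using lookup2[of "l - int i" "int i"] q0
        by (simp add: power_int_diff) (simp add: field_simps power_inverse)
      have "0 = (\<Sum>i\<le>?S. alt_binomial ?S i * ((1 + q powi l) - q ^ i - q powi l * inverse q ^ i))"
        using arg_cong[OF vanish[of l 0], of "\<lambda>y. Poly_Mapping.lookup y (l, 2)"]
        by (simp only: lookup_sum lookup_map_times summand lookup_zero)
      also have "\<dots> = (1 + q powi l) * (\<Sum>i\<le>?S. alt_binomial ?S i * 1 ^ i) - (\<Sum>i\<le>?S. alt_binomial ?S i * q ^ i)
          - q powi l * (\<Sum>i\<le>?S. alt_binomial ?S i * inverse q ^ i)"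
        by (simp only: sum_distrib_left sum_subtractf[symmetric]) (intro sum.cong refl, simp add: algebra_simps)
      also have "\<dots> = - (X + q powi l * Y)"
        unfolding X_def Y_def sum_alt_binomial_geometric by simp
      finally show ?thesis by (metis neg_0_equal_iff_equal)
    qed
    \<comment> \<open>The two terms scale differently in \<open>l\<close>, so two values of \<open>l\<close> separate them.\<close>
    from this[of 0] this[of 1] have XY: "X + Y = 0" "X + q * Y = 0"
      by simp_all
    have "(q - 1) * Y = (X + q * Y) - (X + Y)" by (simp only: algebra_simps) simp
    then have "(q - 1) * Y = 0" unfolding XY by simp
    then have "Y = 0" using \<open>q \<noteq> 1\<close> by simp
    then have "1 - inverse q = 0" unfolding Y_def by (simp only: power_eq_0_iff)
    then show False using \<open>q \<noteq> 1\<close> by simp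
  qed
  then have "exp (of_int n * h) = 1" for n
    by (simp add: exp_of_int_times q_def)
  then have d0: "d n (Poly_Mapping.single (i, 0) c) = Poly_Mapping.single (i + n, 0) (c * (b + of_int i + of_int n * p))"
    for n i c
    by (simp add: d_single e_def)
  have "(\<Sum>i\<le>s. Poly_Mapping.map ((*) (alt_binomial s i)) (d (0 - 0 - int i) (d (0 + int i) ?x)))
      = (\<Sum>i\<le>s. Poly_Mapping.single (0, 0) (alt_binomial s i * ((b + p * (0 + of_nat i)) * (b + (1 - p) * (0 + of_nat i)))))"
    by (intro sum.cong refl) (simp add: d0 algebra_simps)
  also have "\<dots> = Poly_Mapping.single (0, 0)
      (\<Sum>i\<le>s. alt_binomial s i * ((b + p * (0 + of_nat i)) * (b + (1 - p) * (0 + of_nat i))))"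
    by (rule poly_mapping_eqI) (simp add: lookup_sum lookup_single when_def)
  also have "\<dots> = 0"
    by (simp only: sum_alt_binomial_quadratic[OF assms(1)] single_zero)
  finally show False using inj by blast
qed

lemma vir_linear_E_module: "vir_linear (E_module h b \<gamma> p)"
  unfolding E_module_def Let_def
  by (intro vir_linear_vir_module linear_map_linear_extension cspace_free_space) auto

section \<open>The intermediate series\<close>

lemma intermediate_simps [simp]:
  "carrier (intermediate a b) = UNIV" "zero (intermediate a b) = 0"
  "add (intermediate a b) = (+)" "module.smult (intermediate a b) = (\<lambda>a. Poly_Mapping.map ((*) a))"
  by (simp_all add: intermediate_def Let_def)

lemma linear_map_intermediate [simp]:
  "linear_map (intermediate a b) W f = linear_map (free_space UNIV) W f"
  by (simp add: linear_map_def)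

text \<open>With \<open>x = m + i\<close>, the word \<open>d\<^bsub>l-x\<^esub> d\<^bsub>x\<^esub>\<close> multiplies \<open>v\<^bsub>a+k\<^esub>\<close> by \<open>(a + k + b x) (a + k + l b + (1 - b) x)\<close>, which
  is quadratic in \<open>x\<close>.\<close>

lemma
  shows vir_linear_intermediate: "vir_linear (intermediate a b)"
    and act_intermediate: "act (intermediate a b) (vir_d i) (Poly_Mapping.single k c)
      = Poly_Mapping.single (k + i) (c * (a + of_int k + of_int i * b))"
    and quad_difference_intermediate:
      "s > 2 \<Longrightarrow> quad_difference (intermediate a b) s l m (Poly_Mapping.single k 1) = 0"
proof -
  let ?V = "free_space UNIV :: (complex, int \<Rightarrow>\<^sub>0 complex) module"
  define e where "e = (\<lambda>i k. Poly_Mapping.single (k + i) (a + of_int k + of_int i * b))"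
  define d where "d i = linear_extension ?V (e i)" for i
  have I: "intermediate a b = vir_module ?V d (\<lambda>_. 0)"
    unfolding intermediate_def Let_def d_def e_def ..
  have d: "linear_map ?V ?V (d n)" for n
    unfolding d_def by (intro linear_map_linear_extension cspace_free_space) auto
  have d_single: "d i (Poly_Mapping.single k c) = Poly_Mapping.single (k + i) (c * (a + of_int k + of_int i * b))" for i k c
    using linear_extension_single[OF cspace_free_space[of UNIV], of "e i" k c] by (simp add: d_def e_def)
  show "vir_linear (intermediate a b)"
    unfolding I by (intro vir_linear_vir_module cspace_free_space d)
  show "act (intermediate a b) (vir_d i) (Poly_Mapping.single k c)
      = Poly_Mapping.single (k + i) (c * (a + of_int k + of_int i * b))"
    unfolding I by (simp add: act_vir_module cspace_free_space d_single)
  assume "s > 2"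
  have "quad_difference (intermediate a b) s l m (Poly_Mapping.single k 1)
      = (\<Sum>i\<le>s. Poly_Mapping.single (k + l) (alt_binomial s i *
          ((a + of_int k + b * (of_int m + of_nat i)) * (a + of_int k + of_int l * b + (1 - b) * (of_int m + of_nat i)))))"
    unfolding I quad_difference_free[OF d] by (intro sum.cong refl) (simp add: d_single algebra_simps)
  also have "\<dots> = Poly_Mapping.single (k + l) (\<Sum>i\<le>s. alt_binomial s i *
          ((a + of_int k + b * (of_int m + of_nat i)) * (a + of_int k + of_int l * b + (1 - b) * (of_int m + of_nat i))))"
    by (rule poly_mapping_eqI) (simp add: lookup_sum lookup_single when_def)
  finally show "quad_difference (intermediate a b) s l m (Poly_Mapping.single k 1) = 0"
    by (simp only: sum_alt_binomial_quadratic[OF \<open>s > 2\<close>] single_zero)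
qed

text \<open>In both cases of its definition, \<open>V'\<^bsub>a,b\<^esub>\<close> is a quotient by an invariant subspace that involves at most
  the basis vector with index \<open>0\<close>. All other coordinates descend to the quotient, and the
  corresponding basis vectors survive in it.\<close>

lemma intermediate'_cases:
  obtains a' b' S where "intermediate' a b = quotient_lie_module (intermediate a' b') S"
    "submodule S complex_ring (intermediate a' b')" "\<And>i. act (intermediate a' b') (vir_d i) ` S \<subseteq> S"
    "\<And>x k. \<lbrakk>x \<in> S; k \<noteq> 0\<rbrakk> \<Longrightarrow> Poly_Mapping.lookup x k = 0"
proof (cases "simple_lie_module virasoro (intermediate a b)")
  case True
  note V = vir_linear_cspace[OF vir_linear_intermediate[of a b]]
  have "act (intermediate a b) (vir_d i) 0 = 0" for i
    using linear_map_zero[OF V V vir_linear_act[OF vir_linear_intermediate]] by simp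
  moreover have "submodule {0} complex_ring (intermediate a b)"
    by (rule cspace_submoduleI[OF V]) (auto intro: poly_mapping_eqI)
  ultimately show ?thesis
    using True by (intro that[of a b "{0}"]) (auto simp: intermediate'_def)
next
  case False
  let ?I = "intermediate 0 0" and ?v = "Poly_Mapping.single (0::int) (1::complex)"
  let ?S = "generated_submodule ?I {?v}"
  note V = vir_linear_cspace[OF vir_linear_intermediate[of 0 0]]
  have sub: "submodule ?S complex_ring ?I"
    by (rule submodule_generated[OF V]) simp
  have act0: "act ?I (vir_d i) ` ?S \<subseteq> {0}" for i
    using linear_map_generated_submodule[OF V V vir_linear_act[OF vir_linear_intermediate], of "{?v}" i]
    by (simp add: act_intermediate)
  have look: "Poly_Mapping.lookup x k = 0" if "x \<in> ?S" "k \<noteq> 0" for x k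
  proof -
    have "submodule {x. Poly_Mapping.lookup x k = 0} complex_ring ?I"
      by (rule cspace_submoduleI[OF V]) (auto simp: lookup_add)
    from generated_submodule_minimal[OF this, of "{?v}"] that show ?thesis
      by (auto simp: lookup_single when_def)
  qed
  have "act ?I (vir_d i) ` ?S \<subseteq> ?S" for i
    using act0[of i] cspace_submoduleD(2)[OF sub] by auto
  moreover have "intermediate' a b = quotient_lie_module ?I ?S"
    using False unfolding intermediate'_def by simp
  ultimately show ?thesis
    using that[OF _ sub _ look] by blast
qed

lemma vir_linear_intermediate': "vir_linear (intermediate' a b)"
  by (rule intermediate'_cases[of a b]) (simp add: vir_linear_quotient(1)[OF vir_linear_intermediate])

section \<open>Tensor products with the intermediate series\<close>

lemma tensor_lie_module_simps [simp]:
  "carrier (tensor_lie_module V W) = carrier (tensor_space V W)" "zero (tensor_lie_module V W) = zero (tensor_space V W)"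
  "add (tensor_lie_module V W) = add (tensor_space V W)" "module.smult (tensor_lie_module V W) = module.smult (tensor_space V W)"
  by (simp_all add: tensor_lie_module_def)

lemma linear_map_tensor_lie_module [simp]:
  "linear_map (tensor_lie_module V W) P f = linear_map (tensor_space V W) P f"
  "linear_map Q (tensor_lie_module V W) g = linear_map Q (tensor_space V W) g"
  by (simp_all add: linear_map_def)

lemma
  assumes "vir_linear V" "vir_linear W"
  shows vir_linear_tensor: "vir_linear (tensor_lie_module V W)"
    and act_tensor: "\<lbrakk>v \<in> carrier V; w \<in> carrier W\<rbrakk> \<Longrightarrow> act (tensor_lie_module V W) (vir_d i) (pure_tensor V W v w)
      = pure_tensor V W (act V (vir_d i) v) w \<oplus>\<^bsub>tensor_space V W\<^esub> pure_tensor V W v (act W (vir_d i) w)"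
proof -
  note V = vir_linear_cspace[OF assms(1)] and W = vir_linear_cspace[OF assms(2)]
  note T = cspace_tensor_space[OF V W]
  let ?T = "tensor_space V W"
  let ?g = "\<lambda>i v w. pure_tensor V W (act V (vir_d i) v) w \<oplus>\<^bsub>?T\<^esub> pure_tensor V W v (act W (vir_d i) w)"
  have pv: "linear_map V ?T (\<lambda>v. pure_tensor V W v w)" if "w \<in> carrier W" for w
    using bilinear_map_pure_tensor[OF V W] that unfolding bilinear_map_def by blast
  have pw: "linear_map W ?T (pure_tensor V W v)" if "v \<in> carrier V" for v
    using bilinear_map_pure_tensor[OF V W] that unfolding bilinear_map_def by blast
  have bil: "bilinear_map V W ?T (?g i)" for i
    unfolding bilinear_map_def
  proof (intro conjI ballI linear_map_add_fun[OF T])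
    fix v assume v: "v \<in> carrier V"
    show "linear_map W ?T (pure_tensor V W (act V (vir_d i) v))"
      by (intro pw vir_linear_closed[OF assms(1)] v)
    show "linear_map W ?T (\<lambda>w. pure_tensor V W v (act W (vir_d i) w))"
      by (rule linear_map_comp[OF vir_linear_act[OF assms(2)] pw[OF v]])
  next
    fix w assume w: "w \<in> carrier W"
    show "linear_map V ?T (\<lambda>v. pure_tensor V W v (act W (vir_d i) w))"
      by (intro pv vir_linear_closed[OF assms(2)] w)
    show "linear_map V ?T (\<lambda>v. pure_tensor V W (act V (vir_d i) v) w)"
      by (rule linear_map_comp[OF vir_linear_act[OF assms(1)] pv[OF w]])
  qed
  have act: "act (tensor_lie_module V W) (vir_d i) = tensor_lift ?T (?g i)" for i
    by (simp add: tensor_lie_module_def)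
  show "vir_linear (tensor_lie_module V W)"
    unfolding vir_linear_def using linear_map_tensor_lift[OF V W T bil] T
    by (auto simp: act) (simp add: tensor_lie_module_def)
  show "act (tensor_lie_module V W) (vir_d i) (pure_tensor V W v w) = ?g i v w"
    if "v \<in> carrier V" "w \<in> carrier W"
    unfolding act by (rule tensor_lift_pure_tensor[OF V W T bil that])
qed

text \<open>Vanishing in order \<open>s + 1\<close> forces \<open>d\<^bsub>j\<^esub> v = 0\<close> for \<open>j < 0\<close>, because the terms in which the second letter
  of a word acts on \<open>V'\<close> and the first one on \<open>v\<close> lie in different weight components of \<open>V'\<close>. Then
  \<open>v \<otimes> V'\<close> behaves like \<open>V'\<close> itself for words without \<open>d\<^bsub>0\<^esub>\<close>, and injectivity in order \<open>s\<close> fails.\<close>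

lemma tensor_intermediate_no_difference_order:
  assumes V: "vir_linear V" and v: "v \<in> carrier V" "v \<noteq> \<zero>\<^bsub>V\<^esub>"
    and high: "\<And>i. i > 0 \<Longrightarrow> act V (vir_d i) v = \<zero>\<^bsub>V\<^esub>"
    and s: "s > 2" and order: "difference_order (tensor_lie_module V (intermediate' a b)) s"
  shows False
proof -
  obtain a' b' S where W_eq: "intermediate' a b = quotient_lie_module (intermediate a' b') S"
    and S: "submodule S complex_ring (intermediate a' b')" "\<And>i. act (intermediate a' b') (vir_d i) ` S \<subseteq> S"
    and S0: "\<And>x k. \<lbrakk>x \<in> S; k \<noteq> 0\<rbrakk> \<Longrightarrow> Poly_Mapping.lookup x k = 0"
    by (rule intermediate'_cases[of a b], rule that)
  let ?I = "intermediate a' b'"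
  let ?W = "quotient_lie_module ?I S"
  let ?T = "tensor_lie_module V ?W"
  define q where "q x = S +>\<^bsub>?I\<^esub> x" for x
  note I = vir_linear_intermediate[of a' b']
  note W = vir_linear_quotient[OF I S, folded q_def]
  note T = vir_linear_tensor[OF V W(1)]
  note Vc = vir_linear_cspace[OF V] and Wc = vir_linear_cspace[OF W(1)] and Ic = vir_linear_cspace[OF I]
  note Tc = cspace_tensor_space[OF Vc Wc]
  interpret V: module complex_ring V by (rule Vc)
  interpret T: module complex_ring "tensor_space V ?W" by (rule Tc)
  let ?p = "pure_tensor V ?W"
  have q_closed: "q x \<in> carrier ?W" for x
    using linear_map_closed[OF W(5)] by simp
  have act_q: "act ?W (vir_d i) (q x) = q (act ?I (vir_d i) x)" for i x
    using W(2)[of x] by simp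
  have pw: "linear_map ?W (tensor_space V ?W) (?p u)" if "u \<in> carrier V" for u
    using bilinear_map_pure_tensor[OF Vc Wc] that unfolding bilinear_map_def by blast
  have pv: "linear_map V (tensor_space V ?W) (\<lambda>u. ?p u w)" if "w \<in> carrier ?W" for w
    using bilinear_map_pure_tensor[OF Vc Wc] that unfolding bilinear_map_def by blast

  define coord where "coord k X = the_elem ((\<lambda>x. Poly_Mapping.lookup x k) ` X)" for k :: int and X :: "(int \<Rightarrow>\<^sub>0 complex) set"
  have coord: "linear_map ?W complex_line (coord k)" "coord k (q x) = Poly_Mapping.lookup x k" if "k \<noteq> 0" for k x
  proof -
    have l: "linear_map ?I complex_line (\<lambda>x. Poly_Mapping.lookup x k)" "(\<lambda>x. Poly_Mapping.lookup x k) ` S \<subseteq> {\<zero>\<^bsub>complex_line\<^esub>}"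
      using linear_map_lookup[of k] S0 that by auto
    show "linear_map ?W complex_line (coord k)"
      unfolding quotient_lie_module_def linear_map_extend coord_def
      by (rule linear_map_the_elem[OF Ic cspace_complex_line S(1) l])
    show "coord k (q x) = Poly_Mapping.lookup x k"
      unfolding coord_def q_def by (rule the_elem_coset[OF Ic cspace_complex_line S(1) l]) simp
  qed
  define contract where "contract k = tensor_lift V (\<lambda>u X. coord k X \<odot>\<^bsub>V\<^esub> u)" for k
  have contract: "linear_map (tensor_space V ?W) V (contract k)"
    "\<And>u X. \<lbrakk>u \<in> carrier V; X \<in> carrier ?W\<rbrakk> \<Longrightarrow> contract k (?p u X) = coord k X \<odot>\<^bsub>V\<^esub> u" if "k \<noteq> 0" for k
  proof -
    have bil: "bilinear_map V ?W V (\<lambda>u X. coord k X \<odot>\<^bsub>V\<^esub> u)"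
      unfolding bilinear_map_def
      using linear_map_comp[OF coord(1)[OF that] linear_map_smult_vector[OF Vc]]
        linear_map_smult_fun[OF Vc linear_map_id] by blast
    show "linear_map (tensor_space V ?W) V (contract k)"
      unfolding contract_def by (rule linear_map_tensor_lift[OF Vc Wc Vc bil])
    show "contract k (?p u X) = coord k X \<odot>\<^bsub>V\<^esub> u" if "u \<in> carrier V" "X \<in> carrier ?W" for u X
      unfolding contract_def by (rule tensor_lift_pure_tensor[OF Vc Wc Vc bil that])
  qed

  \<comment> \<open>The coefficient of \<open>d\<^bsub>1\<^esub> w\<^bsub>k\<^esub>\<close> must not vanish, which rules out at most one of \<open>k = 1, 2\<close>. Positivity of
    \<open>k\<close> keeps \<open>k\<close> and \<open>k + 1\<close> away from the index \<open>0\<close> that may be lost in the quotient.\<close>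
  obtain k :: int where k: "k > 0" "a' + of_int k + b' \<noteq> 0"
  proof (cases "a' + 1 + b' = 0")
    case True
    have "a' + of_int 2 + b' = (a' + 1 + b') + 1" by simp
    also have "\<dots> = 1" unfolding True by simp
    finally have "a' + of_int 2 + b' \<noteq> 0" by (metis one_neq_zero)
    then show ?thesis using that[of 2] by simp
  qed (use that[of 1] in simp)
  let ?w = "q (Poly_Mapping.single k 1)"
  have w: "?w \<in> carrier ?W" by (rule q_closed)
  have z: "?p v ?w \<in> carrier ?T"
    using linear_map_closed[OF pw[OF v(1)] w] by simp

  \<comment> \<open>Contract with the coordinate \<open>k + 1\<close>. With \<open>m = 1\<close> the letter \<open>d\<^bsub>1+i\<^esub>\<close> kills \<open>v\<close> and moves \<open>w\<^bsub>k\<^esub>\<close> to index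
    \<open>k + 1 + i\<close>, and a full word acting on the second factor moves it to \<open>k + j + 1 < k + 1\<close>. So only the
    term \<open>i = 0\<close> survives, with \<open>d\<^bsub>j\<^esub>\<close> acting on \<open>v\<close>.\<close>
  have low: "act V (vir_d j) v = \<zero>\<^bsub>V\<^esub>" if "j < 0" for j
  proof -
    let ?d = "\<lambda>n. act V (vir_d n)"
    let ?c = "a' + of_int k + b'"
    have term_i: "contract (k + 1) (act ?T (vir_d ((j + 1) - 1 - int i)) (act ?T (vir_d (1 + int i)) (?p v ?w)))
        = (if i = 0 then ?c \<odot>\<^bsub>V\<^esub> ?d j v else \<zero>\<^bsub>V\<^esub>)" (is "?lhs = _") for i
    proof -
      define y where "y = Poly_Mapping.single (k + (1 + int i)) (a' + of_int k + of_int (1 + int i) * b')"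
      have "act ?T (vir_d (1 + int i)) (?p v ?w) = ?p (\<zero>\<^bsub>V\<^esub>) ?w \<oplus>\<^bsub>tensor_space V ?W\<^esub> ?p v (q y)"
        unfolding act_tensor[OF V W(1) v(1) w] act_q act_intermediate y_def using high[of "1 + int i"] by simp
      also have "\<dots> = ?p v (q y)"
        using linear_map_zero[OF Vc Tc pv[OF w]] linear_map_closed[OF pw[OF v(1)] q_closed] by simp
      finally have "act ?T (vir_d ((j + 1) - 1 - int i)) (act ?T (vir_d (1 + int i)) (?p v ?w))
          = ?p (?d (j - int i) v) (q y) \<oplus>\<^bsub>tensor_space V ?W\<^esub> ?p v (q (act ?I (vir_d (j - int i)) y))"
        by (simp add: act_tensor[OF V W(1) v(1) q_closed] act_q)
      then have "?lhs = Poly_Mapping.lookup y (k + 1) \<odot>\<^bsub>V\<^esub> ?d (j - int i) v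
          \<oplus>\<^bsub>V\<^esub> Poly_Mapping.lookup (act ?I (vir_d (j - int i)) y) (k + 1) \<odot>\<^bsub>V\<^esub> v"
        using k linear_map_closed[OF pw[OF v(1)] q_closed] linear_map_closed[OF pw[OF vir_linear_closed[OF V v(1)]] q_closed]
        by (simp add: linear_map_add[OF contract(1)] contract(2) coord(2) q_closed v vir_linear_closed[OF V])
      moreover have "Poly_Mapping.lookup (act ?I (vir_d (j - int i)) y) (k + 1) = 0"
        using that unfolding y_def act_intermediate by (simp add: lookup_single when_def)
      moreover have "Poly_Mapping.lookup y (k + 1) = (if i = 0 then ?c else 0)"
        unfolding y_def by (simp add: lookup_single when_def)
      ultimately show ?thesis
        using v vir_linear_closed[OF V v(1)] by (simp add: smult_zero_left[OF Vc] smult_in_carrier[OF Vc])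
    qed
    have cl: "act ?T (vir_d m) (act ?T (vir_d n) (?p v ?w)) \<in> carrier (tensor_space V ?W)" for m n
      using vir_linear_closed[OF T vir_linear_closed[OF T z]] by simp
    have dj: "?d j v \<in> carrier V" by (rule vir_linear_closed[OF V v(1)])
    have "quad_difference ?T (Suc s) (j + 1) 1 (?p v ?w) = \<zero>\<^bsub>tensor_space V ?W\<^esub>"
      using order z unfolding difference_order_def W_eq by simp
    then have "\<zero>\<^bsub>V\<^esub> = contract (k + 1) (quad_difference ?T (Suc s) (j + 1) 1 (?p v ?w))"
      using linear_map_zero[OF Tc Vc contract(1)] k by simp
    also have "\<dots> = (\<Oplus>\<^bsub>V\<^esub>i\<in>{..Suc s}. contract (k + 1) (alt_binomial (Suc s) i \<odot>\<^bsub>tensor_space V ?W\<^esub>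
        act ?T (vir_d ((j + 1) - 1 - int i)) (act ?T (vir_d (1 + int i)) (?p v ?w))))"
    proof -
      have "linear_map ?T V (contract (k + 1))" using contract(1)[of "k + 1"] k by simp
      then show ?thesis
        unfolding quad_difference_def tensor_lie_module_simps(4)
        by (rule linear_map_finsum[OF vir_linear_cspace[OF T] Vc]) (use cl smult_in_carrier[OF Tc] in auto)
    qed
    also have "\<dots> = (\<Oplus>\<^bsub>V\<^esub>i\<in>{..Suc s}. if i = 0 then ?c \<odot>\<^bsub>V\<^esub> ?d j v else \<zero>\<^bsub>V\<^esub>)"
    proof (rule V.finsum_cong'[OF refl])
      show "contract (k + 1) (alt_binomial (Suc s) i \<odot>\<^bsub>tensor_space V ?W\<^esub>
          act ?T (vir_d ((j + 1) - 1 - int i)) (act ?T (vir_d (1 + int i)) (?p v ?w)))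
          = (if i = 0 then ?c \<odot>\<^bsub>V\<^esub> ?d j v else \<zero>\<^bsub>V\<^esub>)" for i
        using k dj by (subst linear_map_smult[OF contract(1) cl], simp, subst term_i)
          (simp add: smult_zero_right[OF Vc] smult_one_left[OF Vc] smult_in_carrier[OF Vc] alt_binomial_def)
    qed (use dj smult_in_carrier[OF Vc] in auto)
    also have "\<dots> = ?c \<odot>\<^bsub>V\<^esub> ?d j v"
      using dj smult_in_carrier[OF Vc]
      by (subst V.finsum_singleton[of 0 "{..Suc s}" "\<lambda>i. ?c \<odot>\<^bsub>V\<^esub> ?d j v", symmetric])
        (auto intro!: V.finsum_cong' simp: eq_commute)
    finally have cd: "?c \<odot>\<^bsub>V\<^esub> ?d j v = \<zero>\<^bsub>V\<^esub>" by (rule sym)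
    show ?thesis
      by (rule smult_eq_zeroD[OF Vc dj k(2) cd])
  qed

  have lift: "?p v (act ?W (vir_d i) y) = act ?T (vir_d i) (?p v y)" if "i \<noteq> 0" "y \<in> carrier ?W" for i y
  proof -
    have "act V (vir_d i) v = \<zero>\<^bsub>V\<^esub>" using that high low by (cases "i > 0") auto
    then show ?thesis
      using that linear_map_zero[OF Vc Tc pv[OF that(2)]] linear_map_closed[OF pw[OF v(1)] vir_linear_closed[OF W(1) that(2)]]
      by (simp add: act_tensor[OF V W(1) v(1)])
  qed
  \<comment> \<open>For \<open>l = 0\<close> and \<open>m = 1\<close> only the letters \<open>d\<^bsub>1+i\<^esub>\<close> and \<open>d\<^bsub>-1-i\<^esub>\<close> occur, never \<open>d\<^bsub>0\<^esub>\<close>.\<close>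
  have "quad_difference ?T s 0 1 (?p v ?w) = ?p v (quad_difference ?W s 0 1 ?w)"
    using linear_map_quad_difference[OF W(1) T _ w, of "?p v" s 1 0] lift pw[OF v(1)] by simp
  also have "quad_difference ?W s 0 1 ?w = q (quad_difference ?I s 0 1 (Poly_Mapping.single k 1))"
    using linear_map_quad_difference[OF I W(1) W(5), of "Poly_Mapping.single k 1" s 1 0] by (simp add: act_q)
  also have "\<dots> = \<zero>\<^bsub>?W\<^esub>"
    using linear_map_zero[OF Ic Wc W(5)] by (simp add: quad_difference_intermediate[OF s])
  also have "?p v \<zero>\<^bsub>?W\<^esub> = \<zero>\<^bsub>?T\<^esub>"
    using linear_map_zero[OF Wc Tc pw[OF v(1)]] by simp
  finally have "?p v ?w = \<zero>\<^bsub>?T\<^esub>"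
    using order z unfolding difference_order_def W_eq by blast
  then have "contract k (?p v ?w) = \<zero>\<^bsub>V\<^esub>"
    using linear_map_zero[OF Tc Vc contract(1)] k by simp
  then show False
    using k v w by (simp add: contract(2) coord(2) smult_one_left[OF Vc])
qed

section \<open>The free algebra\<close>

definition word_times :: "('l list \<Rightarrow>\<^sub>0 complex) \<Rightarrow> ('l list \<Rightarrow>\<^sub>0 complex) \<Rightarrow> ('l list \<Rightarrow>\<^sub>0 complex)" where
  "word_times f g = (\<Sum>u\<in>Poly_Mapping.keys f. \<Sum>v\<in>Poly_Mapping.keys g.
     Poly_Mapping.single (u @ v) (Poly_Mapping.lookup f u * Poly_Mapping.lookup g v))"

lemma word_times_superset:
  assumes "finite X" "finite Y" "Poly_Mapping.keys f \<subseteq> X" "Poly_Mapping.keys g \<subseteq> Y"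
  shows "word_times f g = (\<Sum>u\<in>X. \<Sum>v\<in>Y.
     Poly_Mapping.single (u @ v) (Poly_Mapping.lookup f u * Poly_Mapping.lookup g v))"
proof -
  have "word_times f g = (\<Sum>u\<in>Poly_Mapping.keys f. \<Sum>v\<in>Y.
      Poly_Mapping.single (u @ v) (Poly_Mapping.lookup f u * Poly_Mapping.lookup g v))"
    unfolding word_times_def using assms
    by (intro sum.cong refl sum.mono_neutral_left) (auto simp: in_keys_iff)
  also have "\<dots> = (\<Sum>u\<in>X. \<Sum>v\<in>Y.
      Poly_Mapping.single (u @ v) (Poly_Mapping.lookup f u * Poly_Mapping.lookup g v))"
    using assms by (intro sum.mono_neutral_left) (auto simp: in_keys_iff)
  finally show ?thesis .
qed

lemma word_times_single: "word_times (Poly_Mapping.single u a) (Poly_Mapping.single v b) = Poly_Mapping.single (u @ v) (a * b)"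
  by (subst word_times_superset[of "{u}" "{v}"]) auto

lemma word_times_add_left: "word_times (f + f') g = word_times f g + word_times f' g"
  using Poly_Mapping.keys_add[of f f']
  by (simp add: word_times_superset[of "Poly_Mapping.keys f \<union> Poly_Mapping.keys f'" "Poly_Mapping.keys g"]
      lookup_add distrib_right single_add sum.distrib)

lemma word_times_add_right: "word_times g (f + f') = word_times g f + word_times g f'"
  using Poly_Mapping.keys_add[of f f']
  by (simp add: word_times_superset[of "Poly_Mapping.keys g" "Poly_Mapping.keys f \<union> Poly_Mapping.keys f'"]
      lookup_add distrib_left single_add sum.distrib)

lemma map_times_sum:
  "Poly_Mapping.map ((*) a) (\<Sum>i\<in>A. f i) = (\<Sum>i\<in>A. Poly_Mapping.map ((*) a) (f i))" for a :: complex
  by (rule poly_mapping_eqI) (simp add: lookup_sum sum_distrib_left)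

lemma word_times_smult:
  "word_times (Poly_Mapping.map ((*) a) f) g = Poly_Mapping.map ((*) a) (word_times f g)"
  "word_times f (Poly_Mapping.map ((*) a) g) = Poly_Mapping.map ((*) a) (word_times f g)"
  using keys_map_times[of a f] keys_map_times[of a g]
  by (simp_all add: word_times_superset[of "Poly_Mapping.keys f" "Poly_Mapping.keys g"] map_times_sum mult_ac)

lemma linear_map_word_times:
  "linear_map (free_space UNIV) (free_space UNIV) (\<lambda>f. word_times f g)"
  "linear_map (free_space UNIV) (free_space UNIV) (word_times g)"
  by (simp_all add: linear_map_def word_times_add_left word_times_add_right word_times_smult)

text \<open>Both sides are linear in each argument, so that it suffices to concatenate words.\<close>

lemma word_times_assoc: "word_times (word_times f g) k = word_times f (word_times g k)"
proof -
  note eqI = linear_map_free_space_eqI[OF cspace_free_space[of UNIV], of UNIV]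
  note comp = linear_map_comp[of "free_space UNIV" "free_space UNIV" _ "free_space UNIV"]
  have 1: "word_times (word_times (Poly_Mapping.single u 1) (Poly_Mapping.single v 1)) k
      = word_times (Poly_Mapping.single u 1) (word_times (Poly_Mapping.single v 1) k)" for u v
    by (rule eqI[OF linear_map_word_times(2) comp[OF linear_map_word_times(2) linear_map_word_times(2)]])
      (simp_all add: word_times_single)
  have 2: "word_times (word_times (Poly_Mapping.single u 1) g) k = word_times (Poly_Mapping.single u 1) (word_times g k)" for u
    by (rule eqI[OF comp[OF linear_map_word_times(2) linear_map_word_times(1)] comp[OF linear_map_word_times(1) linear_map_word_times(2)]])
      (simp_all add: 1)
  show ?thesis
    by (rule eqI[OF comp[OF linear_map_word_times(1) linear_map_word_times(1)] linear_map_word_times(1)])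
      (simp_all add: 2)
qed

lemma word_times_one: "word_times (Poly_Mapping.single [] 1) f = f" "word_times f (Poly_Mapping.single [] 1) = f"
proof -
  note eqI = linear_map_free_space_eqI[OF cspace_free_space[of UNIV], of UNIV]
  show "word_times (Poly_Mapping.single [] 1) f = f"
    by (rule eqI[OF linear_map_word_times(2) linear_map_id]) (simp_all add: word_times_single)
  show "word_times f (Poly_Mapping.single [] 1) = f"
    by (rule eqI[OF linear_map_word_times(1) linear_map_id]) (simp_all add: word_times_single)
qed

lemma word_times_scalar: "word_times (Poly_Mapping.single [] a) f = Poly_Mapping.map ((*) a) f"
  using word_times_smult(1)[of a "Poly_Mapping.single [] 1" f] by (simp add: word_times_one)

lemma free_algebra_simps [simp]:
  "carrier (free_algebra B) = {f. Poly_Mapping.keys f \<subseteq> lists B}" "monoid.mult (free_algebra B) = word_times"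
  "one (free_algebra B) = Poly_Mapping.single [] 1" "zero (free_algebra B) = 0" "add (free_algebra B) = (+)"
  by (simp_all add: free_algebra_def word_times_def fun_eq_iff)

lemma ring_free_algebra: "ring (free_algebra UNIV)"
proof (rule ringI)
  show "abelian_group (free_algebra UNIV :: ('a list \<Rightarrow>\<^sub>0 complex) ring)"
    by (rule abelian_groupI) (auto simp: algebra_simps intro: exI[of _ "- _"])
  show "monoid (free_algebra UNIV :: ('a list \<Rightarrow>\<^sub>0 complex) ring)"
    by (rule monoidI) (auto simp: word_times_assoc word_times_one)
qed (auto simp: word_times_add_left word_times_add_right)

section \<open>Highest weight modules\<close>

abbreviation uea_class :: "(vir list \<Rightarrow>\<^sub>0 complex) \<Rightarrow> (vir list \<Rightarrow>\<^sub>0 complex) set" where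
  "uea_class f \<equiv> uea_ideal virasoro +>\<^bsub>free_space UNIV\<^esub> f"

lemma ideal_uea_ideal: "ideal (uea_ideal virasoro) (free_algebra UNIV)"
  unfolding uea_ideal_def virasoro_carrier
  by (rule ring.genideal_ideal[OF ring_free_algebra]) simp

lemma submodule_uea_ideal: "submodule (uea_ideal virasoro) complex_ring (free_space UNIV)"
proof -
  interpret I: ideal "uea_ideal virasoro" "free_algebra UNIV" by (rule ideal_uea_ideal)
  show ?thesis
  proof (rule cspace_submoduleI[OF cspace_free_space])
    show "x \<oplus>\<^bsub>free_space UNIV\<^esub> y \<in> uea_ideal virasoro" if "x \<in> uea_ideal virasoro" "y \<in> uea_ideal virasoro" for x y
      using additive_subgroup.a_closed[OF I.is_additive_subgroup that] by simp
    show "a \<odot>\<^bsub>free_space UNIV\<^esub> x \<in> uea_ideal virasoro" if "x \<in> uea_ideal virasoro" for a x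
      using I.I_l_closed[OF that, of "Poly_Mapping.single [] a"] by (simp add: word_times_scalar)
    show "\<zero>\<^bsub>free_space UNIV\<^esub> \<in> uea_ideal virasoro" using additive_subgroup.zero_closed[OF I.is_additive_subgroup] by simp
  qed simp
qed

lemma a_r_coset_free_algebra: "a_r_coset (free_algebra UNIV) = a_r_coset (free_space UNIV)"
  by (intro ext) (simp add: a_r_coset_def')

lemma a_rcosets_free_algebra: "A_RCOSETS (free_algebra UNIV) = A_RCOSETS (free_space UNIV)"
  by (intro ext) (simp only: A_RCOSETS_def' a_r_coset_free_algebra free_algebra_simps free_space_simps lists_UNIV)

lemma set_add_free_algebra: "set_add (free_algebra UNIV) = set_add (free_space UNIV)"
  by (intro ext) (simp only: set_add_def' free_algebra_simps free_space_simps)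

lemma uea_simps:
  "carrier (uea virasoro) = a_rcosets\<^bsub>free_space UNIV\<^esub> (uea_ideal virasoro)"
  "add (uea virasoro) = set_add (free_space UNIV)"
  "zero (uea virasoro) = uea_ideal virasoro"
  "one (uea virasoro) = uea_class (Poly_Mapping.single [] 1)"
  "module.smult (uea virasoro) = (\<lambda>a X. \<Union>x\<in>X. uea_class (a \<odot>\<^bsub>free_space UNIV\<^esub> x))"
  "monoid.mult (uea virasoro) = rcoset_mult (free_algebra UNIV) (uea_ideal virasoro)"
  unfolding uea_def FactRing_def ring.defs module.defs virasoro_carrier
    a_rcosets_free_algebra set_add_free_algebra a_r_coset_free_algebra
  by simp_all

lemma cspace_uea: "cspace (uea virasoro)"
  by (rule cspace_cong[OF cspace_quotient[OF cspace_free_space submodule_uea_ideal]])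
    (simp_all only: uea_simps quotient_space_simps)

lemma linear_map_uea_class: "linear_map (free_space UNIV) (uea virasoro) uea_class"
proof -
  have "linear_map (free_space UNIV) (quotient_space (free_space UNIV) (uea_ideal virasoro)) uea_class"
    by (rule linear_map_coset[OF cspace_free_space submodule_uea_ideal])
  then show ?thesis unfolding linear_map_def uea_simps quotient_space_simps .
qed

lemma uea_times: "uea_class f \<otimes>\<^bsub>uea virasoro\<^esub> uea_class g = uea_class (word_times f g)"
  unfolding uea_simps a_r_coset_free_algebra[symmetric]
  using ideal.rcoset_mult_add[OF ideal_uea_ideal, of f g] by simp

lemma uea_class_closed: "uea_class f \<in> carrier (uea virasoro)"
  unfolding uea_simps by (rule coset_in_rcosets) simp

lemma uea_cases:
  assumes "X \<in> carrier (uea virasoro)"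
  obtains f where "X = uea_class f"
  using assms unfolding uea_simps mem_a_rcosets_iff by blast

text \<open>Scalars act through the algebra itself; in particular left ideals are subspaces.\<close>

lemma uea_smult: "a \<odot>\<^bsub>uea virasoro\<^esub> X = uea_class (Poly_Mapping.single [] a) \<otimes>\<^bsub>uea virasoro\<^esub> X"
  if "X \<in> carrier (uea virasoro)"
proof -
  from that obtain f where f: "X = uea_class f" by (rule uea_cases)
  show ?thesis
    using linear_map_smult[OF linear_map_uea_class, of f a]
    unfolding f uea_times word_times_scalar free_space_simps by auto
qed

lemma uea_times_closed:
  "\<lbrakk>X \<in> carrier (uea virasoro); Y \<in> carrier (uea virasoro)\<rbrakk> \<Longrightarrow> X \<otimes>\<^bsub>uea virasoro\<^esub> Y \<in> carrier (uea virasoro)"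
  by (elim uea_cases) (simp only: uea_times uea_class_closed)

lemma uea_embed_eq: "uea_embed virasoro x = uea_class (Poly_Mapping.single [x] 1)"
  by (simp add: uea_embed_def a_r_coset_free_algebra)

lemma uea_regular_simps [simp]:
  "carrier (uea_regular_module virasoro) = carrier (uea virasoro)"
  "add (uea_regular_module virasoro) = add (uea virasoro)"
  "zero (uea_regular_module virasoro) = zero (uea virasoro)"
  "module.smult (uea_regular_module virasoro) = module.smult (uea virasoro)"
  "act (uea_regular_module virasoro) x u = uea_embed virasoro x \<otimes>\<^bsub>uea virasoro\<^esub> u"
  by (simp_all add: uea_regular_module_def)

lemma vir_linear_uea_regular: "vir_linear (uea_regular_module virasoro)"
  and linear_map_act_uea_regular:
    "linear_map (uea_regular_module virasoro) (uea_regular_module virasoro) (act (uea_regular_module virasoro) x)"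
proof -
  have lin: "linear_map (uea virasoro) (uea virasoro) (\<lambda>u. uea_embed virasoro x \<otimes>\<^bsub>uea virasoro\<^esub> u)" for x
  proof (rule linear_mapI)
    show "uea_embed virasoro x \<otimes>\<^bsub>uea virasoro\<^esub> X \<in> carrier (uea virasoro)" if "X \<in> carrier (uea virasoro)" for X
      using that by (simp add: uea_times_closed uea_embed_eq uea_class_closed)
    show "uea_embed virasoro x \<otimes>\<^bsub>uea virasoro\<^esub> (X \<oplus>\<^bsub>uea virasoro\<^esub> Y)
        = (uea_embed virasoro x \<otimes>\<^bsub>uea virasoro\<^esub> X) \<oplus>\<^bsub>uea virasoro\<^esub> (uea_embed virasoro x \<otimes>\<^bsub>uea virasoro\<^esub> Y)"
      if "X \<in> carrier (uea virasoro)" "Y \<in> carrier (uea virasoro)" for X Y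
      using that
    proof (elim uea_cases)
      fix f g assume *: "X = uea_class f" "Y = uea_class g"
      have add: "uea_class f \<oplus>\<^bsub>uea virasoro\<^esub> uea_class g = uea_class (f + g)" for f g
        using linear_map_add[OF linear_map_uea_class, of f g] by simp
      show ?thesis
        unfolding * uea_embed_eq uea_times add word_times_add_right ..
    qed
    show "uea_embed virasoro x \<otimes>\<^bsub>uea virasoro\<^esub> (a \<odot>\<^bsub>uea virasoro\<^esub> X)
        = a \<odot>\<^bsub>uea virasoro\<^esub> (uea_embed virasoro x \<otimes>\<^bsub>uea virasoro\<^esub> X)" if "X \<in> carrier (uea virasoro)" for a X
      using that
    proof (elim uea_cases)
      fix f assume *: "X = uea_class f"
      have smult: "a \<odot>\<^bsub>uea virasoro\<^esub> uea_class f = uea_class (Poly_Mapping.map ((*) a) f)" for f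
        using linear_map_smult[OF linear_map_uea_class, of f a] by simp
      show ?thesis
        unfolding * uea_embed_eq uea_times smult word_times_smult ..
    qed
  qed
  show "linear_map (uea_regular_module virasoro) (uea_regular_module virasoro) (act (uea_regular_module virasoro) x)"
    for x
    using lin[of x] by (simp add: linear_map_def Pi_iff)
  then show "vir_linear (uea_regular_module virasoro)"
    unfolding vir_linear_def using cspace_uea by (simp add: uea_regular_module_def)
qed

definition verma_relations :: "complex \<Rightarrow> complex \<Rightarrow> (vir list \<Rightarrow>\<^sub>0 complex) set set" where
  "verma_relations cd h = (let U = uea virasoro in
     ({uea_embed virasoro (vir_d i) | i. i > 0} \<union>
      {uea_embed virasoro (vir_d 0) \<ominus>\<^bsub>U\<^esub> h \<odot>\<^bsub>U\<^esub> \<one>\<^bsub>U\<^esub>,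
       uea_embed virasoro vir_c \<ominus>\<^bsub>U\<^esub> cd \<odot>\<^bsub>U\<^esub> \<one>\<^bsub>U\<^esub>}))"

lemma verma_left_ideal_eq: "verma_left_ideal cd h = generated_left_ideal (uea virasoro) (verma_relations cd h)"
  unfolding verma_left_ideal_def verma_relations_def Let_def ..

lemma
  shows submodule_verma_left_ideal: "submodule (verma_left_ideal cd h) complex_ring (uea_regular_module virasoro)"
    and act_verma_left_ideal: "act (uea_regular_module virasoro) x ` verma_left_ideal cd h \<subseteq> verma_left_ideal cd h"
    and uea_embed_in_verma_left_ideal: "i > 0 \<Longrightarrow> uea_embed virasoro (vir_d i) \<in> verma_left_ideal cd h"
proof -
  let ?U = "uea virasoro"
  let ?J = "verma_left_ideal cd h"
  interpret U: module complex_ring ?U by (rule cspace_uea)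
  have J: "?J = \<Inter>{I. left_ideal I ?U \<and> verma_relations cd h \<subseteq> I}"
    unfolding verma_left_ideal_eq generated_left_ideal_def ..
  have carr: "verma_relations cd h \<subseteq> carrier ?U"
  proof -
    have "\<one>\<^bsub>?U\<^esub> \<in> carrier ?U" using uea_class_closed by (simp only: uea_simps(4))
    then show ?thesis
      using uea_class_closed by (auto simp: verma_relations_def Let_def uea_embed_eq U.minus_eq smult_in_carrier[OF cspace_uea])
  qed
  have "left_ideal (carrier ?U) ?U"
    unfolding left_ideal_def using U.add.subgroup_self uea_times_closed by (auto intro!: additive_subgroupI)
  then have sub: "?J \<subseteq> carrier ?U" unfolding J using carr by blast
  have I: "\<zero>\<^bsub>?U\<^esub> \<in> I" "\<And>x y. x \<in> I \<Longrightarrow> y \<in> I \<Longrightarrow> x \<oplus>\<^bsub>?U\<^esub> y \<in> I"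
    "\<And>r x. r \<in> carrier ?U \<Longrightarrow> x \<in> I \<Longrightarrow> r \<otimes>\<^bsub>?U\<^esub> x \<in> I" if "left_ideal I ?U" for I
    using that additive_subgroup.zero_closed additive_subgroup.a_closed unfolding left_ideal_def by metis+
  have mult: "r \<otimes>\<^bsub>?U\<^esub> x \<in> ?J" if "r \<in> carrier ?U" "x \<in> ?J" for r x
    using that I(3) unfolding J by blast
  show "submodule ?J complex_ring (uea_regular_module virasoro)"
  proof (rule cspace_submoduleI[OF vir_linear_cspace[OF vir_linear_uea_regular]])
    show "a \<odot>\<^bsub>uea_regular_module virasoro\<^esub> x \<in> ?J" if "x \<in> ?J" for a x
      using that sub mult uea_class_closed by (auto simp: uea_smult)
  qed (use sub I(1,2) in \<open>auto simp: J\<close>)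
  show "act (uea_regular_module virasoro) x ` ?J \<subseteq> ?J"
    using mult uea_class_closed by (auto simp: uea_embed_eq)
  show "uea_embed virasoro (vir_d i) \<in> ?J" if "i > 0"
    using that unfolding J verma_relations_def Let_def by blast
qed

lemma act_quotient_lie_module:
  assumes "cspace V" "submodule S complex_ring V" "linear_map V V (act V x)" "act V x ` S \<subseteq> S" "y \<in> carrier V"
  shows "act (quotient_lie_module V S) x (S +>\<^bsub>V\<^esub> y) = S +>\<^bsub>V\<^esub> act V x y"
  unfolding quotient_lie_module_def act_extend by (rule coset_UNION[OF assms])

text \<open>The vector is the class of \<open>1\<close>. It generates the Verma module, since every element is a combination of
  words applied to it; hence it does not lie in the proper submodule \<open>J\<close>.\<close>

lemma highest_weight_quotient:
  assumes "maximal_proper_lie_submodule J virasoro (verma cd h)"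
  obtains v where "vir_linear (quotient_lie_module (verma cd h) J)" "v \<in> carrier (quotient_lie_module (verma cd h) J)"
    "v \<noteq> zero (quotient_lie_module (verma cd h) J)"
    "\<And>i. i > 0 \<Longrightarrow> act (quotient_lie_module (verma cd h) J) (vir_d i) v = zero (quotient_lie_module (verma cd h) J)"
proof -
  let ?R = "uea_regular_module virasoro" and ?K = "verma_left_ideal cd h" and ?V = "verma cd h"
  note K = submodule_verma_left_ideal[of cd h]
  note Rc = vir_linear_cspace[OF vir_linear_uea_regular]
  note V = vir_linear_quotient[OF vir_linear_uea_regular K act_verma_left_ideal, folded verma_def]
  note Vc = vir_linear_cspace[OF V(1)]
  have J: "submodule J complex_ring ?V" "\<And>x v. v \<in> J \<Longrightarrow> act ?V x v \<in> J" "J \<noteq> carrier ?V"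
    using assms by (auto simp: maximal_proper_lie_submodule_def lie_submodule_def)
  have "act ?V (vir_d i) ` J \<subseteq> J" for i using J(2) by auto
  note L = vir_linear_quotient[OF V(1) J(1) this]
  define c where "c f = ?K +>\<^bsub>?R\<^esub> uea_class f" for f
  have "linear_map (free_space UNIV) ?R uea_class"
    using linear_map_uea_class by (simp add: linear_map_def)
  then have c_lin: "linear_map (free_space UNIV) ?V c"
    unfolding c_def by (rule linear_map_comp[OF _ V(5)])
  have c_closed: "c f \<in> carrier ?V" for f
    using linear_map_closed[OF c_lin] by simp
  have c_act: "act ?V x (c f) = c (word_times (Poly_Mapping.single [x] 1) f)" for x f
    unfolding c_def verma_def
    by (subst act_quotient_lie_module[OF Rc K linear_map_act_uea_regular act_verma_left_ideal])
      (simp_all only: uea_regular_simps uea_class_closed uea_embed_eq uea_times)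
  let ?u = "c (Poly_Mapping.single [] 1)"
  have gen: "J = carrier ?V" if u: "?u \<in> J"
  proof -
    have word: "c (Poly_Mapping.single w 1) \<in> J" for w
    proof (induction w)
      case (Cons x w)
      then show ?case using J(2)[OF Cons, of x] by (simp add: c_act word_times_single)
    qed (rule u)
    have "c f \<in> J" for f
    proof -
      have sub: "\<And>x y. x \<in> J \<Longrightarrow> y \<in> J \<Longrightarrow> x \<oplus>\<^bsub>?V\<^esub> y \<in> J" "\<And>a x. x \<in> J \<Longrightarrow> a \<odot>\<^bsub>?V\<^esub> x \<in> J" "\<zero>\<^bsub>?V\<^esub> \<in> J"
        using cspace_submoduleD[OF J(1)] by auto
      have single: "c (Poly_Mapping.single w a) \<in> J" for w a
        using sub(2)[OF word[of w], of a] linear_map_smult[OF c_lin, of "Poly_Mapping.single w 1" a] by simp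
      have "c (\<Sum>w\<in>A. Poly_Mapping.single w (g w)) \<in> J" if "finite A" for A g
        using that
      proof (induction rule: finite_induct)
        case empty
        then show ?case using sub(3) linear_map_zero[OF cspace_free_space Vc c_lin] by simp
      next
        case (insert w A)
        then show ?case using sub(1)[OF single insert(3)] linear_map_add[OF c_lin] by simp
      qed
      from this[of "Poly_Mapping.keys f" "Poly_Mapping.lookup f"] show ?thesis
        by (simp add: sum_single_lookup)
    qed
    moreover have "\<exists>f. X = c f" if "X \<in> carrier ?V" for X
      using that unfolding V(3) mem_a_rcosets_iff c_def uea_regular_simps by (metis uea_cases)
    ultimately show ?thesis using cspace_submoduleD(1)[OF J(1)] by blast
  qed
  show ?thesis
  proof (rule that)
    show "vir_linear (quotient_lie_module ?V J)" by (rule L(1))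
    show "J +>\<^bsub>?V\<^esub> ?u \<in> carrier (quotient_lie_module ?V J)"
      unfolding L(3) using c_closed by (rule coset_in_rcosets)
    show "J +>\<^bsub>?V\<^esub> ?u \<noteq> zero (quotient_lie_module ?V J)"
      unfolding L(4) using coset_zero[OF Vc J(1) c_closed] gen J(3) by blast
    fix i :: int assume "i > 0"
    then have "uea_class (Poly_Mapping.single [vir_d i] 1) \<in> ?K"
      using uea_embed_in_verma_left_ideal[of i] by (simp add: uea_embed_eq)
    then have "act ?V (vir_d i) ?u = \<zero>\<^bsub>?V\<^esub>"
      unfolding c_act word_times_one V(4) unfolding c_def
      using coset_zero[OF Rc K] uea_class_closed by simp
    then show "act (quotient_lie_module ?V J) (vir_d i) (J +>\<^bsub>?V\<^esub> ?u) = zero (quotient_lie_module ?V J)"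
      unfolding L(2)[OF c_closed] L(4) using coset_zero[OF Vc J(1)] cspace_submoduleD(1,2)[OF J(1)] by auto
  qed
qed

section \<open>Polynomial families of operators\<close>

lemma finsum_swap:
  assumes "cspace V" "finite I" "finite J" "\<And>i j. i \<in> I \<Longrightarrow> j \<in> J \<Longrightarrow> f i j \<in> carrier V"
  shows "(\<Oplus>\<^bsub>V\<^esub>i\<in>I. \<Oplus>\<^bsub>V\<^esub>j\<in>J. f i j) = (\<Oplus>\<^bsub>V\<^esub>j\<in>J. \<Oplus>\<^bsub>V\<^esub>i\<in>I. f i j)"
proof -
  interpret V: module complex_ring V by fact
  show ?thesis
    using assms(2,4)
  proof (induction rule: finite_induct)
    case empty
    then show ?case by simp
  next
    case (insert i I)
    have "(\<Oplus>\<^bsub>V\<^esub>j\<in>J. \<Oplus>\<^bsub>V\<^esub>i\<in>insert i I. f i j) = (\<Oplus>\<^bsub>V\<^esub>j\<in>J. f i j \<oplus>\<^bsub>V\<^esub> (\<Oplus>\<^bsub>V\<^esub>i\<in>I. f i j))"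
      using insert by (intro V.finsum_cong') (auto simp: Pi_iff intro!: V.finsum_insert)
    also have "\<dots> = (\<Oplus>\<^bsub>V\<^esub>j\<in>J. f i j) \<oplus>\<^bsub>V\<^esub> (\<Oplus>\<^bsub>V\<^esub>j\<in>J. \<Oplus>\<^bsub>V\<^esub>i\<in>I. f i j)"
      using insert by (intro V.finsum_addf) auto
    finally show ?case
      using insert by (subst V.finsum_insert) auto
  qed
qed

lemma smult_sum_left:
  assumes "cspace V" "v \<in> carrier V" "finite I"
  shows "(\<Sum>i\<in>I. a i) \<odot>\<^bsub>V\<^esub> v = (\<Oplus>\<^bsub>V\<^esub>i\<in>I. a i \<odot>\<^bsub>V\<^esub> v)"
proof -
  interpret V: module complex_ring V by fact
  show ?thesis
    using assms(3) by (induction rule: finite_induct)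
      (use assms(1,2) in \<open>auto simp: smult_zero_left smult_add_left smult_in_carrier Pi_iff\<close>)
qed

lemma finsum_smult_smult:
  assumes "cspace V" "finite I" "finite K" "\<And>k. k \<in> K \<Longrightarrow> u k \<in> carrier V"
  shows "(\<Oplus>\<^bsub>V\<^esub>i\<in>I. a i \<odot>\<^bsub>V\<^esub> (\<Oplus>\<^bsub>V\<^esub>k\<in>K. c i k \<odot>\<^bsub>V\<^esub> u k)) = (\<Oplus>\<^bsub>V\<^esub>k\<in>K. (\<Sum>i\<in>I. a i * c i k) \<odot>\<^bsub>V\<^esub> u k)"
proof -
  interpret V: module complex_ring V by fact
  have "(\<Oplus>\<^bsub>V\<^esub>i\<in>I. a i \<odot>\<^bsub>V\<^esub> (\<Oplus>\<^bsub>V\<^esub>k\<in>K. c i k \<odot>\<^bsub>V\<^esub> u k)) = (\<Oplus>\<^bsub>V\<^esub>i\<in>I. \<Oplus>\<^bsub>V\<^esub>k\<in>K. (a i * c i k) \<odot>\<^bsub>V\<^esub> u k)"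
  proof (rule V.finsum_cong'[OF refl])
    fix i
    have "a i \<odot>\<^bsub>V\<^esub> (\<Oplus>\<^bsub>V\<^esub>k\<in>K. c i k \<odot>\<^bsub>V\<^esub> u k) = (\<Oplus>\<^bsub>V\<^esub>k\<in>K. a i \<odot>\<^bsub>V\<^esub> (c i k \<odot>\<^bsub>V\<^esub> u k))"
      using assms by (intro V.finsum_smult_ldistr) (auto simp: smult_in_carrier)
    also have "\<dots> = (\<Oplus>\<^bsub>V\<^esub>k\<in>K. (a i * c i k) \<odot>\<^bsub>V\<^esub> u k)"
      using assms by (intro V.finsum_cong') (auto simp: smult_in_carrier smult_mult_left)
    finally show "a i \<odot>\<^bsub>V\<^esub> (\<Oplus>\<^bsub>V\<^esub>k\<in>K. c i k \<odot>\<^bsub>V\<^esub> u k) = (\<Oplus>\<^bsub>V\<^esub>k\<in>K. (a i * c i k) \<odot>\<^bsub>V\<^esub> u k)" .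
  qed (use assms in \<open>auto intro!: V.finsum_closed simp: smult_in_carrier\<close>)
  also have "\<dots> = (\<Oplus>\<^bsub>V\<^esub>k\<in>K. \<Oplus>\<^bsub>V\<^esub>i\<in>I. (a i * c i k) \<odot>\<^bsub>V\<^esub> u k)"
    using assms by (intro finsum_swap) (auto simp: smult_in_carrier)
  also have "\<dots> = (\<Oplus>\<^bsub>V\<^esub>k\<in>K. (\<Sum>i\<in>I. a i * c i k) \<odot>\<^bsub>V\<^esub> u k)"
    using assms by (intro V.finsum_cong') (auto simp: smult_in_carrier smult_sum_left)
  finally show ?thesis .
qed

text \<open>A difference of products of two operators with polynomial coefficients only affects the
  coefficients.\<close>

lemma alternating_sum_operator_product:
  fixes R :: nat
  assumes M: "cspace M" and B: "\<And>j. linear_map M M (B j)" and y: "y \<in> carrier M"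
  shows "(\<Oplus>\<^bsub>M\<^esub>i\<in>{..s}. alt_binomial s i \<odot>\<^bsub>M\<^esub> (\<Oplus>\<^bsub>M\<^esub>j\<in>{..R}. poly (P j) (x + of_nat i) \<odot>\<^bsub>M\<^esub>
            B j (\<Oplus>\<^bsub>M\<^esub>k\<in>{..R}. poly (Q k) (x + of_nat i) \<odot>\<^bsub>M\<^esub> B k y)))
       = (\<Oplus>\<^bsub>M\<^esub>j\<in>{..R}. \<Oplus>\<^bsub>M\<^esub>k\<in>{..R}. (\<Sum>i\<le>s. alt_binomial s i * poly (P j * Q k) (x + of_nat i)) \<odot>\<^bsub>M\<^esub> B j (B k y))"
    (is "?lhs = ?rhs")
proof -
  interpret M: module complex_ring M by (rule M)
  have cl: "B k v \<in> carrier M" if "k \<le> R" "v \<in> carrier M" for k v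
    using linear_map_closed[OF B] that by blast
  note sc = smult_in_carrier[OF M]
  let ?z = "\<lambda>i j. \<Oplus>\<^bsub>M\<^esub>k\<in>{..R}. poly (Q k) (x + of_nat i) \<odot>\<^bsub>M\<^esub> B j (B k y)"
  have z: "?z i j \<in> carrier M" if "j \<le> R" for i j
    using that y cl sc by (intro M.finsum_closed) auto
  have push: "B j (\<Oplus>\<^bsub>M\<^esub>k\<in>{..R}. poly (Q k) (x + of_nat i) \<odot>\<^bsub>M\<^esub> B k y) = ?z i j" if "j \<le> R" for i j
  proof -
    have "B j (\<Oplus>\<^bsub>M\<^esub>k\<in>{..R}. poly (Q k) (x + of_nat i) \<odot>\<^bsub>M\<^esub> B k y)
        = (\<Oplus>\<^bsub>M\<^esub>k\<in>{..R}. B j (poly (Q k) (x + of_nat i) \<odot>\<^bsub>M\<^esub> B k y))"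
      using y cl sc by (intro linear_map_finsum[OF M M B]) auto
    also have "\<dots> = ?z i j"
      using y cl sc that by (intro M.finsum_cong') (auto simp: linear_map_smult[OF B])
    finally show ?thesis .
  qed
  have "?lhs = (\<Oplus>\<^bsub>M\<^esub>i\<in>{..s}. \<Oplus>\<^bsub>M\<^esub>j\<in>{..R}. (alt_binomial s i * poly (P j) (x + of_nat i)) \<odot>\<^bsub>M\<^esub> ?z i j)"
  proof (rule M.finsum_cong'[OF refl])
    fix i
    have "(\<Oplus>\<^bsub>M\<^esub>j\<in>{..R}. poly (P j) (x + of_nat i) \<odot>\<^bsub>M\<^esub>
            B j (\<Oplus>\<^bsub>M\<^esub>k\<in>{..R}. poly (Q k) (x + of_nat i) \<odot>\<^bsub>M\<^esub> B k y))
        = (\<Oplus>\<^bsub>M\<^esub>j\<in>{..R}. poly (P j) (x + of_nat i) \<odot>\<^bsub>M\<^esub> ?z i j)"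
      using z sc by (intro M.finsum_cong') (auto simp: push)
    also have "alt_binomial s i \<odot>\<^bsub>M\<^esub> \<dots> = (\<Oplus>\<^bsub>M\<^esub>j\<in>{..R}. alt_binomial s i \<odot>\<^bsub>M\<^esub> (poly (P j) (x + of_nat i) \<odot>\<^bsub>M\<^esub> ?z i j))"
      using z sc by (intro M.finsum_smult_ldistr) auto
    also have "\<dots> = (\<Oplus>\<^bsub>M\<^esub>j\<in>{..R}. (alt_binomial s i * poly (P j) (x + of_nat i)) \<odot>\<^bsub>M\<^esub> ?z i j)"
      using z sc by (intro M.finsum_cong') (auto simp: smult_mult_left[OF M])
    finally show "alt_binomial s i \<odot>\<^bsub>M\<^esub> (\<Oplus>\<^bsub>M\<^esub>j\<in>{..R}. poly (P j) (x + of_nat i) \<odot>\<^bsub>M\<^esub>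
            B j (\<Oplus>\<^bsub>M\<^esub>k\<in>{..R}. poly (Q k) (x + of_nat i) \<odot>\<^bsub>M\<^esub> B k y))
        = (\<Oplus>\<^bsub>M\<^esub>j\<in>{..R}. (alt_binomial s i * poly (P j) (x + of_nat i)) \<odot>\<^bsub>M\<^esub> ?z i j)" .
  qed (use z sc in \<open>auto intro!: M.finsum_closed\<close>)
  also have "\<dots> = (\<Oplus>\<^bsub>M\<^esub>j\<in>{..R}. \<Oplus>\<^bsub>M\<^esub>i\<in>{..s}. (alt_binomial s i * poly (P j) (x + of_nat i)) \<odot>\<^bsub>M\<^esub> ?z i j)"
    using z sc by (intro finsum_swap[OF M]) auto
  also have "\<dots> = ?rhs"
  proof (rule M.finsum_cong'[OF refl])
    fix j assume "j \<in> {..R}"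
    then have "(\<Oplus>\<^bsub>M\<^esub>i\<in>{..s}. (alt_binomial s i * poly (P j) (x + of_nat i)) \<odot>\<^bsub>M\<^esub> ?z i j)
        = (\<Oplus>\<^bsub>M\<^esub>k\<in>{..R}. (\<Sum>i\<le>s. alt_binomial s i * poly (P j) (x + of_nat i) * poly (Q k) (x + of_nat i)) \<odot>\<^bsub>M\<^esub> B j (B k y))"
      using cl y by (intro finsum_smult_smult[OF M]) auto
    then show "(\<Oplus>\<^bsub>M\<^esub>i\<in>{..s}. (alt_binomial s i * poly (P j) (x + of_nat i)) \<odot>\<^bsub>M\<^esub> ?z i j)
        = (\<Oplus>\<^bsub>M\<^esub>k\<in>{..R}. (\<Sum>i\<le>s. alt_binomial s i * poly (P j * Q k) (x + of_nat i)) \<odot>\<^bsub>M\<^esub> B j (B k y))"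
      by (simp add: mult.assoc)
  qed (use cl y sc in \<open>auto intro!: M.finsum_closed\<close>)
  finally show ?thesis .
qed

text \<open>Among the products \<open>P j * Q k\<close> only the one with \<open>j = k = R\<close> reaches degree \<open>2 R\<close>. The degree of \<open>P 0\<close> is
  allowed to be \<open>1\<close> instead of \<open>0\<close>: in \<open>N(M, \<alpha>)\<close> the second letter of a word shifts the weight that the
  first one sees. Because of \<open>R \<ge> 2\<close> this stays below the top degree.\<close>

lemma
  assumes M: "cspace M" and B: "\<And>j. linear_map M M (B j)" and y: "y \<in> carrier M"
    and deg: "\<And>j. j \<le> R \<Longrightarrow> degree (P j) \<le> max 1 j" "\<And>k. k \<le> R \<Longrightarrow> degree (Q k) \<le> k" and R: "R \<ge> 2"
  shows alternating_sum_operator_product_zero: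
      "(\<Oplus>\<^bsub>M\<^esub>i\<in>{..Suc (2 * R)}. alt_binomial (Suc (2 * R)) i \<odot>\<^bsub>M\<^esub> (\<Oplus>\<^bsub>M\<^esub>j\<in>{..R}. poly (P j) (x + of_nat i) \<odot>\<^bsub>M\<^esub>
            B j (\<Oplus>\<^bsub>M\<^esub>k\<in>{..R}. poly (Q k) (x + of_nat i) \<odot>\<^bsub>M\<^esub> B k y))) = \<zero>\<^bsub>M\<^esub>" (is ?A)
    and alternating_sum_operator_product_top:
      "(\<Oplus>\<^bsub>M\<^esub>i\<in>{..2 * R}. alt_binomial (2 * R) i \<odot>\<^bsub>M\<^esub> (\<Oplus>\<^bsub>M\<^esub>j\<in>{..R}. poly (P j) (x + of_nat i) \<odot>\<^bsub>M\<^esub>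
            B j (\<Oplus>\<^bsub>M\<^esub>k\<in>{..R}. poly (Q k) (x + of_nat i) \<odot>\<^bsub>M\<^esub> B k y)))
       = (fact (2 * R) * coeff (P R * Q R) (2 * R)) \<odot>\<^bsub>M\<^esub> B R (B R y)" (is ?B)
proof -
  interpret M: module complex_ring M by (rule M)
  have cl: "B k v \<in> carrier M" if "k \<le> R" "v \<in> carrier M" for k v
    using linear_map_closed[OF B] that by blast
  note sc = smult_in_carrier[OF M]
  have d: "degree (P j * Q k) \<le> max 1 j + k" if "j \<le> R" "k \<le> R" for j k
    using degree_mult_le[of "P j" "Q k"] deg that by (meson add_mono order_trans)
  have "(\<Oplus>\<^bsub>M\<^esub>j\<in>{..R}. \<Oplus>\<^bsub>M\<^esub>k\<in>{..R}. (\<Sum>i\<le>Suc (2 * R). alt_binomial (Suc (2 * R)) i * poly (P j * Q k) (x + of_nat i)) \<odot>\<^bsub>M\<^esub> B j (B k y))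
      = (\<Oplus>\<^bsub>M\<^esub>j\<in>{..R}. \<Oplus>\<^bsub>M\<^esub>k\<in>{..R}. \<zero>\<^bsub>M\<^esub>)"
  proof (intro M.finsum_cong' refl)
    fix j k assume jk: "j \<in> {..R}" "k \<in> {..R}"
    then have "degree (P j * Q k) < Suc (2 * R)" using d[of j k] R by auto
    note zero = sum_alt_binomial_poly_zero[OF this, of x]
    have "B j (B k y) \<in> carrier M" using jk cl y by auto
    then show "(\<Sum>i\<le>Suc (2 * R). alt_binomial (Suc (2 * R)) i * poly (P j * Q k) (x + of_nat i)) \<odot>\<^bsub>M\<^esub> B j (B k y) = \<zero>\<^bsub>M\<^esub>"
      unfolding zero by (rule smult_zero_left[OF M])
  qed auto
  then show ?A
    unfolding alternating_sum_operator_product[OF M B y] by (rule trans) simp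
  let ?c = "fact (2 * R) * coeff (P R * Q R) (2 * R)"
  have c: "(\<Sum>i\<le>2 * R. alt_binomial (2 * R) i * poly (P j * Q k) (x + of_nat i)) = (if R = j \<and> R = k then ?c else 0)"
    if "j \<le> R" "k \<le> R" for j k
  proof (cases "j = R \<and> k = R")
    case True
    have "degree (P R * Q R) \<le> 2 * R" using d[of R R] R by simp
    from sum_alt_binomial_poly[OF this, of x] True show ?thesis by simp
  next
    case False
    then have "degree (P j * Q k) < 2 * R" using d[OF that] that R by linarith
    from sum_alt_binomial_poly_zero[OF this, of x] False show ?thesis by auto
  qed
  have "(\<Oplus>\<^bsub>M\<^esub>j\<in>{..R}. \<Oplus>\<^bsub>M\<^esub>k\<in>{..R}. (\<Sum>i\<le>2 * R. alt_binomial (2 * R) i * poly (P j * Q k) (x + of_nat i)) \<odot>\<^bsub>M\<^esub> B j (B k y))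
      = (\<Oplus>\<^bsub>M\<^esub>j\<in>{..R}. \<Oplus>\<^bsub>M\<^esub>k\<in>{..R}. if R = k then (if R = j then ?c \<odot>\<^bsub>M\<^esub> B R (B R y) else \<zero>\<^bsub>M\<^esub>) else \<zero>\<^bsub>M\<^esub>)"
    using cl y sc by (intro M.finsum_cong' refl) (auto simp: c smult_zero_left[OF M] simp del: poly_mult)
  also have "\<dots> = (\<Oplus>\<^bsub>M\<^esub>j\<in>{..R}. if R = j then ?c \<odot>\<^bsub>M\<^esub> B R (B R y) else \<zero>\<^bsub>M\<^esub>)"
    using cl y sc by (intro M.finsum_cong' refl M.finsum_singleton) auto
  also have "\<dots> = ?c \<odot>\<^bsub>M\<^esub> B R (B R y)"
    using cl y sc by (intro M.finsum_singleton) auto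
  finally show ?B
    unfolding alternating_sum_operator_product[OF M B y] .
qed

section \<open>The modules \<open>N(M, \<alpha>)\<close>\<close>

lemma tensor_free_map_eqI:
  assumes "cspace V" "cspace P"
    and "linear_map (tensor_space V (free_space B)) P f" "linear_map (tensor_space V (free_space B)) P g"
    and "\<And>v b. \<lbrakk>v \<in> carrier V; b \<in> B\<rbrakk> \<Longrightarrow> f (pure_tensor V (free_space B) v (Poly_Mapping.single b 1))
      = g (pure_tensor V (free_space B) v (Poly_Mapping.single b 1))"
    and "x \<in> carrier (tensor_space V (free_space B))"
  shows "f x = g x"
proof (rule tensor_map_eqI[OF assms(1) cspace_free_space assms(2-4) _ assms(6)])
  fix v w assume v: "v \<in> carrier V" and w: "w \<in> carrier (free_space B)"
  have p: "linear_map (free_space B) (tensor_space V (free_space B)) (pure_tensor V (free_space B) v)"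
    using bilinear_map_pure_tensor[OF assms(1) cspace_free_space] v unfolding bilinear_map_def by blast
  show "f (pure_tensor V (free_space B) v w) = g (pure_tensor V (free_space B) v w)"
    by (rule linear_map_free_space_eqI[OF assms(2) linear_map_comp[OF p assms(3)] linear_map_comp[OF p assms(4)] _ w])
      (rule assms(5)[OF v])
qed

text \<open>The coefficient of the basis vector with index \<open>b\<close> of an element of \<open>V \<otimes> F\<close>, where \<open>F\<close> is the free space.\<close>

definition tensor_coeff :: "(complex, 'v, 'x) module_scheme \<Rightarrow> 'b \<Rightarrow> ('v \<times> ('b \<Rightarrow>\<^sub>0 complex) \<Rightarrow>\<^sub>0 complex) set \<Rightarrow> 'v" where
  "tensor_coeff V b = tensor_lift V (\<lambda>v f. Poly_Mapping.lookup f b \<odot>\<^bsub>V\<^esub> v)"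

lemma
  assumes V: "cspace V"
  shows linear_map_tensor_coeff: "linear_map (tensor_space V (free_space UNIV)) V (tensor_coeff V b)"
    and tensor_coeff_pure: "v \<in> carrier V \<Longrightarrow> tensor_coeff V b (pure_tensor V (free_space UNIV) v f) = Poly_Mapping.lookup f b \<odot>\<^bsub>V\<^esub> v"
proof -
  note F = cspace_free_space[of UNIV]
  have bil: "bilinear_map V (free_space UNIV) V (\<lambda>v f. Poly_Mapping.lookup f b \<odot>\<^bsub>V\<^esub> v)"
    unfolding bilinear_map_def
  proof (intro conjI ballI)
    show "linear_map (free_space UNIV) V (\<lambda>f. Poly_Mapping.lookup f b \<odot>\<^bsub>V\<^esub> v)" if "v \<in> carrier V" for v
      by (rule linear_map_comp[OF linear_map_lookup linear_map_smult_vector[OF V that]])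
    show "linear_map V V (\<lambda>v. Poly_Mapping.lookup f b \<odot>\<^bsub>V\<^esub> v)" for f
      by (rule linear_map_smult_fun[OF V linear_map_id])
  qed
  show "linear_map (tensor_space V (free_space UNIV)) V (tensor_coeff V b)"
    unfolding tensor_coeff_def by (rule linear_map_tensor_lift[OF V F V bil])
  show "tensor_coeff V b (pure_tensor V (free_space UNIV) v f) = Poly_Mapping.lookup f b \<odot>\<^bsub>V\<^esub> v" if "v \<in> carrier V"
    unfolding tensor_coeff_def by (rule tensor_lift_pure_tensor[OF V F V bil that]) simp
qed

text \<open>Let \<open>X\<close> be the finite set of all indices that occur in a representative of \<open>x\<close>. Then \<open>x\<close> is the sum of the
  tensors of its coefficients with the basis vectors from \<open>X\<close>: the map \<open>proj\<close> that forms this sum is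
  linear and fixes every pure tensor from which \<open>x\<close> is built.\<close>

lemma tensor_coeff_zero_imp_zero:
  fixes x :: "('v \<times> ('b \<Rightarrow>\<^sub>0 complex) \<Rightarrow>\<^sub>0 complex) set"
  assumes V: "cspace V" and x: "x \<in> carrier (tensor_space V (free_space UNIV))"
    and zero: "\<And>b. tensor_coeff V b x = \<zero>\<^bsub>V\<^esub>"
  shows "x = zero (tensor_space V (free_space UNIV))"
proof -
  let ?L = "free_space UNIV :: (complex, 'b \<Rightarrow>\<^sub>0 complex) module"
  let ?T = "tensor_space V ?L" and ?p = "pure_tensor V ?L"
  note L = cspace_free_space[of "UNIV :: 'b set"]
  note T = cspace_tensor_space[OF V L]
  interpret T: module complex_ring ?T by (rule T)
  let ?F = "free_space (carrier V \<times> carrier ?L)"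
  let ?q = "\<lambda>y. tensor_kernel V ?L +>\<^bsub>?F\<^esub> y"
  have pv: "linear_map V ?T (\<lambda>v. ?p v f)" for f
    using bilinear_map_pure_tensor[OF V L] unfolding bilinear_map_def by simp
  have pf: "linear_map ?L ?T (?p v)" if "v \<in> carrier V" for v
    using bilinear_map_pure_tensor[OF V L] that unfolding bilinear_map_def by simp
  have q: "linear_map ?F ?T ?q"
    unfolding tensor_space_def by (intro linear_map_coset cspace_free_space submodule_tensor_kernel V)
  from x obtain y where y: "y \<in> carrier ?F" "x = ?q y"
    unfolding tensor_space_def quotient_space_simps mem_a_rcosets_iff by auto
  let ?Y = "Poly_Mapping.keys y"
  define X where "X = (\<Union>b\<in>?Y. Poly_Mapping.keys (snd b))"
  have "finite X" unfolding X_def by simp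
  define proj where "proj z = (\<Oplus>\<^bsub>?T\<^esub>n\<in>X. ?p (tensor_coeff V n z) (Poly_Mapping.single n 1))" for z
  have proj: "linear_map ?T ?T proj"
    unfolding proj_def
    by (intro linear_map_finsum_fun[OF T T \<open>finite X\<close>] linear_map_comp[OF linear_map_tensor_coeff[OF V] pv])
  have sub: "linear_map (free_space ?Y) ?T f" if "linear_map ?F ?T f" for f
  proof -
    have inc: "z \<in> carrier ?F" if "z \<in> carrier (free_space ?Y)" for z
      using that y(1) by (simp only: free_space_simps) blast
    show ?thesis
      using linear_map_closed[OF that inc] linear_map_add[OF that inc inc] linear_map_smult[OF that inc]
      by (intro linear_mapI) (simp_all only: free_space_simps)
  qed
  have proj_pure: "proj (?p v f) = ?p v f" if v: "v \<in> carrier V" and f: "Poly_Mapping.keys f \<subseteq> X" for v f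
  proof -
    let ?s = "\<lambda>n. Poly_Mapping.lookup f n \<odot>\<^bsub>?L\<^esub> Poly_Mapping.single n 1"
    have "finsum ?L ?s X = f"
      using sum_single_lookup[OF \<open>finite X\<close> f] \<open>finite X\<close> by (simp add: finsum_free_space)
    then have "?p v f = ?p v (finsum ?L ?s X)" by simp
    also have "\<dots> = (\<Oplus>\<^bsub>?T\<^esub>n\<in>X. ?p v (?s n))"
      by (rule linear_map_finsum[OF L T pf[OF v] \<open>finite X\<close>]) simp
    also have "\<dots> = proj (?p v f)"
      unfolding proj_def
    proof (rule T.finsum_cong'[OF refl])
      fix n
      have s: "Poly_Mapping.single n 1 \<in> carrier ?L" by simp
      show "?p v (?s n) = ?p (tensor_coeff V n (?p v f)) (Poly_Mapping.single n 1)"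
        unfolding tensor_coeff_pure[OF V v] linear_map_smult[OF pf[OF v] s] linear_map_smult[OF pv v] ..
      show "(\<lambda>n. ?p (tensor_coeff V n (?p v f)) (Poly_Mapping.single n 1)) \<in> X \<rightarrow> carrier ?T"
        using linear_map_closed[OF pv] v by (auto simp: tensor_coeff_pure[OF V] smult_in_carrier[OF V])
    qed
    finally show ?thesis by simp
  qed
  have "proj (?q y) = ?q y"
  proof (rule linear_map_free_space_eqI[OF T sub[OF linear_map_comp[OF q proj]] sub[OF q]])
    show "y \<in> carrier (free_space ?Y)" by simp
    fix b assume b: "b \<in> ?Y"
    obtain v f where vf: "b = (v, f)" by (cases b)
    with b y(1) have "v \<in> carrier V" "Poly_Mapping.keys f \<subseteq> X" by (auto simp: X_def)
    from proj_pure[OF this] show "proj (?q (Poly_Mapping.single b 1)) = ?q (Poly_Mapping.single b 1)"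
      unfolding vf pure_tensor_def .
  qed
  moreover have "proj x = \<zero>\<^bsub>?T\<^esub>"
    unfolding proj_def zero using linear_map_zero[OF V T pv] by simp
  ultimately show ?thesis using y by simp
qed

lemma dbar_closed: "dbar r i \<in> carrier (lie_a r)"
proof -
  have "vir_d (int i) \<in> carrier vir_plus"
    unfolding vir_plus_def using generated_submodule_superset by fastforce
  moreover have "carrier (lie_a r) = a_rcosets\<^bsub>vir_plus\<^esub> vir_plus_ideal r"
    by (simp add: lie_a_def quotient_lie_algebra_def)
  ultimately show ?thesis unfolding dbar_def by (simp add: coset_in_rcosets)
qed

lemma linear_map_act_dbar:
  assumes "lie_module (lie_a r) M"
  shows "linear_map M M (act M (dbar r i))"
  using lie_module.act_closed[OF assms dbar_closed] lie_module.act_add_right[OF assms dbar_closed]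
    lie_module.act_smult_right[OF assms dbar_closed] by (rule linear_mapI)

text \<open>The operator by which \<open>d\<^bsub>m\<^esub>\<close> maps \<open>M \<otimes> t\<^sup>n\<close> to \<open>M \<otimes> t\<^bsup>n+m\<^esup>\<close>, both identified with \<open>M\<close>.\<close>

definition N_operator :: "nat \<Rightarrow> (vir set, 'v) lie_mod \<Rightarrow> complex \<Rightarrow> int \<Rightarrow> int \<Rightarrow> 'v \<Rightarrow> 'v" where
  "N_operator r M \<alpha> n m v = ((\<alpha> + of_int n) \<odot>\<^bsub>M\<^esub> v) \<oplus>\<^bsub>M\<^esub>
     (\<Oplus>\<^bsub>M\<^esub>i \<in> {0..r}. (of_int m ^ (i + 1) / fact (i + 1)) \<odot>\<^bsub>M\<^esub> act M (dbar r i) v)"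

lemma linear_map_N_operator:
  assumes "lie_module (lie_a r) M"
  shows "linear_map M M (N_operator r M \<alpha> n m)"
proof -
  have M: "cspace M" using assms by (simp add: lie_module_def)
  show ?thesis
    unfolding N_operator_def
    by (intro linear_map_add_fun[OF M] linear_map_smult_fun[OF M linear_map_id] linear_map_finsum_fun[OF M M]
        linear_map_smult_fun[OF M linear_map_act_dbar[OF assms]]) simp
qed

text \<open>With the scalar term as the summand \<open>j = 0\<close>, the coefficient of the \<open>j\<close>-th operator has degree \<open>j\<close> in \<open>m\<close>.\<close>

lemma N_operator_eq:
  assumes "lie_module (lie_a r) M" "v \<in> carrier M"
  shows "N_operator r M \<alpha> n m v = (\<Oplus>\<^bsub>M\<^esub>j\<in>{..Suc r}.
     (case j of 0 \<Rightarrow> \<alpha> + of_int n | Suc i \<Rightarrow> of_int m ^ Suc i / fact (Suc i)) \<odot>\<^bsub>M\<^esub>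
       (case j of 0 \<Rightarrow> v | Suc i \<Rightarrow> act M (dbar r i) v))"
proof -
  have M: "cspace M" using assms by (simp add: lie_module_def)
  interpret M: module complex_ring M by (rule M)
  have cl: "act M (dbar r i) v \<in> carrier M" for i
    using linear_map_closed[OF linear_map_act_dbar[OF assms(1)] assms(2)] .
  show ?thesis
    unfolding N_operator_def atLeast0AtMost
    by (subst M.finsum_Suc2)
      (use cl assms(2) smult_in_carrier[OF M] in \<open>auto simp: M.a_comm split: nat.split intro!: M.finsum_closed\<close>)
qed

lemma
  assumes mod: "lie_module (lie_a r) M"
  shows vir_linear_N: "vir_linear (N_module r M \<alpha>)"
    and carrier_N: "carrier (N_module r M \<alpha>) = carrier (tensor_space M laurent)"
    and zero_N: "zero (N_module r M \<alpha>) = zero (tensor_space M laurent)"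
    and linear_map_coeff_N: "linear_map (N_module r M \<alpha>) M (tensor_coeff M n)"
    and tensor_coeff_act_N: "x \<in> carrier (N_module r M \<alpha>) \<Longrightarrow>
      tensor_coeff M n (act (N_module r M \<alpha>) (vir_d m) x) = N_operator r M \<alpha> (n - m) m (tensor_coeff M (n - m) x)"
proof -
  have M: "cspace M" using mod by (simp add: lie_module_def)
  note L = cspace_free_space[of "UNIV :: int set"]
  let ?T = "tensor_space M laurent" and ?p = "pure_tensor M laurent"
  let ?A = "N_operator r M \<alpha>"
  note T = cspace_tensor_space[OF M L]
  note A = linear_map_N_operator[OF mod, of \<alpha>]
  have pv: "linear_map M ?T (\<lambda>v. ?p v f)" for f
    using bilinear_map_pure_tensor[OF M L] unfolding bilinear_map_def by simp
  have p_closed: "?p v f \<in> carrier ?T" if "v \<in> carrier M" for v f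
    by (rule linear_map_closed[OF pv that])
  define g where "g m v = linear_extension ?T (\<lambda>n. ?p (?A n m v) (tpow (n + m)))" for m v
  have N: "N_module r M \<alpha> = vir_module ?T (\<lambda>m. tensor_lift ?T (g m)) (\<lambda>_. \<zero>\<^bsub>?T\<^esub>)"
    unfolding N_module_def Let_def g_def N_operator_def ..
  have bil: "bilinear_map M laurent ?T (g m)" for m
    unfolding bilinear_map_def
  proof (intro conjI ballI)
    show "linear_map laurent ?T (g m v)" if "v \<in> carrier M" for v
      unfolding g_def using p_closed linear_map_closed[OF A that] by (intro linear_map_linear_extension[OF T]) auto
    show "linear_map M ?T (\<lambda>v. g m v f)" for f
      unfolding g_def linear_extension_def
      by (intro linear_map_finsum_fun[OF M T] linear_map_smult_fun[OF T] linear_map_comp[OF A pv]) simp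
  qed
  note lin = linear_map_tensor_lift[OF M L T bil]
  show "vir_linear (N_module r M \<alpha>)"
    unfolding N by (rule vir_linear_vir_module[OF T lin])
  show "carrier (N_module r M \<alpha>) = carrier ?T" "zero (N_module r M \<alpha>) = zero ?T"
    by (simp_all add: N)
  have coeff: "linear_map ?T M (tensor_coeff M n)" for n
    by (rule linear_map_tensor_coeff[OF M])
  then show "linear_map (N_module r M \<alpha>) M (tensor_coeff M n)"
    by (simp add: linear_map_def N)
  show "tensor_coeff M n (act (N_module r M \<alpha>) (vir_d m) x) = ?A (n - m) m (tensor_coeff M (n - m) x)"
    if "x \<in> carrier (N_module r M \<alpha>)"
  proof -
    have x: "x \<in> carrier ?T" using that by (simp add: N)
    have "tensor_coeff M n (tensor_lift ?T (g m) x) = ?A (n - m) m (tensor_coeff M (n - m) x)"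
    proof (rule tensor_free_map_eqI[OF M M linear_map_comp[OF lin coeff] linear_map_comp[OF coeff A] _ x])
      fix v k assume v: "v \<in> carrier M"
      have Av: "?A k m v \<in> carrier M" for k by (rule linear_map_closed[OF A v])
      have "tensor_lift ?T (g m) (?p v (tpow k)) = g m v (tpow k)"
        by (rule tensor_lift_pure_tensor[OF M L T bil v]) simp
      also have "\<dots> = ?p (?A k m v) (tpow (k + m))"
        unfolding g_def using linear_extension_single[OF T, of "\<lambda>n. ?p (?A n m v) (tpow (n + m))" k 1] p_closed[OF Av]
        by (simp add: smult_one_left[OF T])
      finally have "tensor_coeff M n (tensor_lift ?T (g m) (?p v (tpow k)))
          = Poly_Mapping.lookup (tpow (k + m)) n \<odot>\<^bsub>M\<^esub> ?A k m v"
        using tensor_coeff_pure[OF M Av] by simp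
      also have "\<dots> = ?A (n - m) m (Poly_Mapping.lookup (tpow k) (n - m) \<odot>\<^bsub>M\<^esub> v)"
        using linear_map_zero[OF M M A] Av v
        by (cases "k = n - m") (auto simp: lookup_single when_def smult_zero_left[OF M] smult_one_left[OF M])
      finally show "tensor_coeff M n (tensor_lift ?T (g m) (?p v (tpow k))) = ?A (n - m) m (tensor_coeff M (n - m) (?p v (tpow k)))"
        unfolding tensor_coeff_pure[OF M v] .
    qed
    then show ?thesis
      unfolding N using act_vir_module[OF T, of "\<lambda>m. tensor_lift ?T (g m)"] linear_map_closed[OF lin x] by simp
  qed
qed

text \<open>In terms of the coefficients of an element, \<open>d\<^bsub>l-m\<^esub> d\<^bsub>m\<^esub>\<close> is a product of two operators on \<open>M\<close> with
  polynomial coefficients in \<open>m\<close>, the first of degree \<open>r + 1\<close> in \<open>l - m\<close> and the second of degree \<open>r + 1\<close> in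
  \<open>m\<close>. Its difference of order \<open>2 (r + 1)\<close> is a nonzero multiple of the square of the action of
  \<open>dbar r r\<close>.\<close>

lemma difference_order_N:
  fixes M :: "(vir set, 'v) lie_mod"
  assumes r: "r \<ge> 1" and mod: "lie_module (lie_a r) M" and inj: "inj_on (act M (dbar r r)) (carrier M)"
  shows "difference_order (N_module r M \<alpha>) (2 * Suc r)"
proof -
  have M: "cspace M" using mod by (simp add: lie_module_def)
  interpret M: module complex_ring M by (rule M)
  let ?N = "N_module r M \<alpha>" and ?c = "tensor_coeff M" and ?R = "Suc r"
  note N = vir_linear_N[OF mod, of \<alpha>]
  note Nc = vir_linear_cspace[OF N]
  interpret N: module complex_ring ?N by (rule Nc)
  note c = linear_map_coeff_N[OF mod, of \<alpha>]
  define B where "B j v = (case j of 0 \<Rightarrow> v | Suc i \<Rightarrow> act M (dbar r i) v)" for j v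
  have B: "linear_map M M (B j)" for j
    unfolding B_def using linear_map_id linear_map_act_dbar[OF mod] by (cases j) auto
  \<comment> \<open>The coefficients as polynomials in \<open>m\<close>, of the second applied letter \<open>d\<^bsub>l-m\<^esub>\<close>, which sees the weight
    \<open>\<alpha> + n + m\<close>, and of the first applied letter \<open>d\<^bsub>m\<^esub>\<close>.\<close>
  define P where "P n l j = (case j of 0 \<Rightarrow> [:\<alpha> + of_int n, 1:] | Suc i \<Rightarrow> Polynomial.smult (1 / fact (Suc i)) ([:of_int l, - 1:] ^ Suc i))"
    for n l :: int and j :: nat
  define Q where "Q n k = (case k of 0 \<Rightarrow> [:\<alpha> + of_int n:] | Suc i \<Rightarrow> Polynomial.smult (1 / fact (Suc i)) ([:0, 1:] ^ Suc i))"
    for n :: int and k :: nat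
  have degP: "degree (P n l j) \<le> max 1 j" for n l j
    using degree_power_le[of "[:of_int l, - 1:] :: complex poly" j]
    by (cases j) (auto simp: P_def simp del: power_Suc intro!: order_trans[OF degree_smult_le])
  have degQ: "degree (Q n k) \<le> k" for n k
    using degree_power_le[of "[:0, 1:] :: complex poly" k]
    by (cases k) (auto simp: Q_def simp del: power_Suc intro!: order_trans[OF degree_smult_le])
  have top: "coeff (P n l ?R * Q n ?R) (2 * ?R) \<noteq> 0" for n l
  proof -
    define X where "X = P n l ?R * Q n ?R"
    have "degree X = 2 * ?R"
      unfolding X_def P_def Q_def
      by (simp add: degree_mult_eq degree_power_eq del: power_Suc fact_Suc)
    moreover from this have "X \<noteq> 0" by auto
    ultimately show ?thesis using leading_coeff_neq_0[of X] unfolding X_def by simp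
  qed
  have A_inner: "N_operator r M \<alpha> n (m + int i) v
      = (\<Oplus>\<^bsub>M\<^esub>k\<in>{..?R}. poly (Q n k) (of_int m + of_nat i) \<odot>\<^bsub>M\<^esub> B k v)" if "v \<in> carrier M" for n m i v
    unfolding N_operator_eq[OF mod that] B_def
    by (intro M.finsum_cong' refl)
      (use linear_map_closed[OF linear_map_act_dbar[OF mod] that] that in
        \<open>auto simp: Q_def smult_in_carrier[OF M] simp del: power_Suc fact_Suc split: nat.split\<close>)
  have shift: "of_int l - (of_int m + of_nat i) = (of_int l + (- of_int m - of_nat i) :: complex)" for l m :: int and i :: nat
    by simp
  have A_outer: "N_operator r M \<alpha> (n + (m + int i)) (l - m - int i) v
      = (\<Oplus>\<^bsub>M\<^esub>j\<in>{..?R}. poly (P n l j) (of_int m + of_nat i) \<odot>\<^bsub>M\<^esub> B j v)" if "v \<in> carrier M" for n m l i v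
    unfolding N_operator_eq[OF mod that] B_def
    by (intro M.finsum_cong' refl)
      (use linear_map_closed[OF linear_map_act_dbar[OF mod] that] that in
        \<open>auto simp: P_def smult_in_carrier[OF M] diff_diff_eq add.assoc shift simp del: power_Suc fact_Suc split: nat.split\<close>)
  have coeff_quad: "?c n (quad_difference ?N s l m x)
      = (\<Oplus>\<^bsub>M\<^esub>i\<in>{..s}. alt_binomial s i \<odot>\<^bsub>M\<^esub> (\<Oplus>\<^bsub>M\<^esub>j\<in>{..?R}. poly (P (n - l) l j) (of_int m + of_nat i) \<odot>\<^bsub>M\<^esub>
            B j (\<Oplus>\<^bsub>M\<^esub>k\<in>{..?R}. poly (Q (n - l) k) (of_int m + of_nat i) \<odot>\<^bsub>M\<^esub> B k (?c (n - l) x))))"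
    if x: "x \<in> carrier ?N" for n s l m x
  proof -
    let ?y = "?c (n - l) x"
    have y: "?y \<in> carrier M" by (rule linear_map_closed[OF c x])
    let ?d = "\<lambda>i. act ?N (vir_d (l - m - int i)) (act ?N (vir_d (m + int i)) x)"
    have d: "?d i \<in> carrier ?N" for i by (intro vir_linear_closed[OF N] x)
    have step: "?c n (?d i) = N_operator r M \<alpha> (n - l + (m + int i)) (l - m - int i) (N_operator r M \<alpha> (n - l) (m + int i) ?y)" for i
    proof -
      have e: "n - (l - m - int i) = n - l + (m + int i)" "n - l + (m + int i) - (m + int i) = n - l" by simp_all
      show ?thesis
        unfolding tensor_coeff_act_N[OF mod vir_linear_closed[OF N x]] tensor_coeff_act_N[OF mod x] e ..
    qed
    have "?c n (quad_difference ?N s l m x) = (\<Oplus>\<^bsub>M\<^esub>i\<in>{..s}. ?c n (alt_binomial s i \<odot>\<^bsub>?N\<^esub> ?d i))"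
      unfolding quad_difference_def using d by (intro linear_map_finsum[OF Nc M c]) (auto simp: smult_in_carrier[OF Nc])
    also have "\<dots> = (\<Oplus>\<^bsub>M\<^esub>i\<in>{..s}. alt_binomial s i \<odot>\<^bsub>M\<^esub>
        N_operator r M \<alpha> (n - l + (m + int i)) (l - m - int i) (N_operator r M \<alpha> (n - l) (m + int i) ?y))"
      using linear_map_closed[OF linear_map_N_operator[OF mod]] y
      by (intro M.finsum_cong' refl) (auto simp: linear_map_smult[OF c d] step smult_in_carrier[OF M])
    finally show ?thesis
      unfolding A_outer[OF linear_map_closed[OF linear_map_N_operator[OF mod] y]] unfolding A_inner[OF y] .
  qed
  have R: "?R \<ge> 2" using r by simp
  have zeroI: "x = \<zero>\<^bsub>?N\<^esub>" if "x \<in> carrier ?N" "\<And>n. ?c n x = \<zero>\<^bsub>M\<^esub>" for x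
    using tensor_coeff_zero_imp_zero[OF M] that unfolding carrier_N[OF mod] zero_N[OF mod] by blast
  have q_closed: "quad_difference ?N s l m x \<in> carrier ?N" if "x \<in> carrier ?N" for s l m x
    unfolding quad_difference_def using that vir_linear_closed[OF N] smult_in_carrier[OF Nc]
    by (intro N.finsum_closed) auto
  have B_inj: "v = \<zero>\<^bsub>M\<^esub>" if "B ?R v = \<zero>\<^bsub>M\<^esub>" "v \<in> carrier M" for v
    using inj that linear_map_zero[OF M M linear_map_act_dbar[OF mod, of r]]
    by (simp add: B_def inj_on_def)
  show ?thesis
    unfolding difference_order_def
  proof (intro conjI allI ballI impI)
    fix l m x assume x: "x \<in> carrier ?N"
    show "quad_difference ?N (Suc (2 * ?R)) l m x = \<zero>\<^bsub>?N\<^esub>"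
      by (rule zeroI[OF q_closed[OF x]])
        (unfold coeff_quad[OF x], rule alternating_sum_operator_product_zero[OF M B linear_map_closed[OF c x] degP degQ R])
    assume "quad_difference ?N (2 * ?R) l m x = \<zero>\<^bsub>?N\<^esub>"
    then have zero: "?c n (quad_difference ?N (2 * ?R) l m x) = \<zero>\<^bsub>M\<^esub>" for n
      using linear_map_zero[OF Nc M c] by simp
    show "x = \<zero>\<^bsub>?N\<^esub>"
    proof (rule zeroI[OF x])
      fix n
      let ?y = "?c n x"
      let ?k = "fact (2 * ?R) * coeff (P n l ?R * Q n ?R) (2 * ?R)"
      have y: "?y \<in> carrier M" by (rule linear_map_closed[OF c x])
      have By: "B ?R ?y \<in> carrier M" "B ?R (B ?R ?y) \<in> carrier M"
        by (intro linear_map_closed[OF B] y)+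
      have k: "?k \<odot>\<^bsub>M\<^esub> B ?R (B ?R ?y) = \<zero>\<^bsub>M\<^esub>"
        using zero[of "n + l"] unfolding coeff_quad[OF x] add_diff_cancel_right'
          alternating_sum_operator_product_top[OF M B y degP degQ R] .
      have "?k \<noteq> 0" using top by (simp only: mult_eq_0_iff fact_nonzero) simp
      then have "B ?R (B ?R ?y) = \<zero>\<^bsub>M\<^esub>"
        using smult_eq_zeroD[OF M By(2)] k by blast
      then show "?y = \<zero>\<^bsub>M\<^esub>" using B_inj y By by blast
    qed
  qed
qed

theorem theorem7:
  fixes r :: nat and \<alpha> :: complex and M :: "(vir set, 'v) lie_mod"
  assumes "r \<ge> 1"
    and "simple_lie_module (lie_a r) M"
    and "inj_on (act M (dbar r r)) (carrier M)"
  shows "(\<forall>a b cd h J. maximal_proper_lie_submodule J virasoro (verma cd h) \<longrightarrow>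
            \<not> lie_module_isomorphic virasoro (N_module r M \<alpha>)
                (tensor_lie_module (quotient_lie_module (verma cd h) J) (intermediate' a b))) \<and>
         (\<forall>b h \<gamma> p. \<not> lie_module_isomorphic virasoro (N_module r M \<alpha>) (E_module h b \<gamma> p))"
proof -
  have mod: "lie_module (lie_a r) M" using assms(2) by (simp add: simple_lie_module_def)
  note order = difference_order_N[OF assms(1) mod assms(3)]
  note iso = difference_order_isomorphic[OF vir_linear_N[OF mod]]
  have s: "2 * Suc r > 2" using assms(1) by simp
  show ?thesis
  proof (intro conjI allI impI notI)
    fix a b cd h J
    assume J: "maximal_proper_lie_submodule J virasoro (verma cd h)"
      and i: "lie_module_isomorphic virasoro (N_module r M \<alpha>)
                (tensor_lie_module (quotient_lie_module (verma cd h) J) (intermediate' a b))"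
    from highest_weight_quotient[OF J] obtain v where
      V: "vir_linear (quotient_lie_module (verma cd h) J)"
      and v: "v \<in> carrier (quotient_lie_module (verma cd h) J)" "v \<noteq> zero (quotient_lie_module (verma cd h) J)"
        "\<And>i. i > 0 \<Longrightarrow> act (quotient_lie_module (verma cd h) J) (vir_d i) v = zero (quotient_lie_module (verma cd h) J)"
      by blast
    have "vir_linear (tensor_lie_module (quotient_lie_module (verma cd h) J) (intermediate' a b))"
      by (rule vir_linear_tensor[OF V vir_linear_intermediate'])
    note order' = iso[OF this i order]
    show False
      by (rule tensor_intermediate_no_difference_order[OF V v s order'])
  next
    fix b h \<gamma> p
    assume "lie_module_isomorphic virasoro (N_module r M \<alpha>) (E_module h b \<gamma> p)"
    from iso[OF vir_linear_E_module this order] show False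
      by (rule E_module_no_difference_order[OF s])
  qed
qed

end
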